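(* Let $k$ be a commutative ring, let $R$ be a $k$-algebra and let $A$ be a bijective skew PBW extension over $R$ which is a $k$-algebra. Then the enveloping algebra $A^{e}=A\otimes_k A^{\mathrm{op}}$ is a bijective skew PBW extension over $R^{e}=R\otimes_k R^{\mathrm{op}}$.
   Context: Rings are associative with unity, not necessarily commutative. Given rings $R\subseteq A$, $A$ is a skew PBW extension over $R$, written $A=\sigma(R)\langle x_1,\dots,x_n\rangle$, if: (i) $R\subseteq A$; (ii) there are elements $x_1,\dots,x_n\in A$ such that $A$ is a free left $R$-module with basis $\mathrm{Mon}(A)=\{x_1^{\alpha_1}\cdots x_n^{\alpha_n}\mid (\alpha_1,\dots,\alpha_n)\in\mathbb{N}^n\}$; (iii) for each $1\le i\le n$ and each $r\in R\setminus\{0\}$ there is $c_{i,r}\in R\setminus\{0\}$ with $x_ir-c_{i,r}x_i\in R$; (iv) for all $1\le i,j\le n$ there is $c_{i,j}\in R\setminus\{0\}$ with $x_jx_i-c_{i,j}x_ix_j\in R+Rx_1+\cdots+Rx_n$. For such $A$, for each $i$ there exist an injective ring endomorphism $\sigma_i$ of $R$ and a $\sigma_i$-derivation $\delta_i$ of $R$ such that $x_ir=\sigma_i(r)x_i+\delta_i(r)$ for all $r\in R$. $A$ is called bijective if every $\sigma_i$ is bijective and the elements $c_{i,j}$ are invertible for $1\le i<j\le n$. For a $k$-algebra $B$, $B^{\mathrm{op}}$ is the opposite algebra (product $a*b=ba$) and $B^e=B\otimes_k B^{\mathrm{op}}$ is the enveloping algebra. *)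

theory Defs
  imports "HOL-Algebra.Algebra"
begin

definition is_algebra :: "('k, 'm) ring_scheme \<Rightarrow> ('a, 'n) ring_scheme \<Rightarrow> ('k \<Rightarrow> 'a) \<Rightarrow> bool" where
  "is_algebra K A phi \<longleftrightarrow> cring K \<and> ring A \<and> phi \<in> ring_hom K A \<and>
     (\<forall>c\<in>carrier K. \<forall>a\<in>carrier A. phi c \<otimes>\<^bsub>A\<^esub> a = a \<otimes>\<^bsub>A\<^esub> phi c)"

definition opp :: "'a ring \<Rightarrow> 'a ring" where
  "opp A = A\<lparr>monoid.mult := (\<lambda>x y. y \<otimes>\<^bsub>A\<^esub> x)\<rparr>"

definition expo :: "nat \<Rightarrow> (nat \<Rightarrow> nat) set" where
  "expo n = {\<alpha>. \<forall>i\<ge>n. \<alpha> i = 0}"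

definition mon :: "'a ring \<Rightarrow> nat \<Rightarrow> (nat \<Rightarrow> 'a) \<Rightarrow> (nat \<Rightarrow> nat) \<Rightarrow> 'a" where
  "mon A n x \<alpha> = foldr (\<lambda>i acc. (x i [^]\<^bsub>A\<^esub> \<alpha> i) \<otimes>\<^bsub>A\<^esub> acc) [0..<n] \<one>\<^bsub>A\<^esub>"

definition coeffs :: "'a ring \<Rightarrow> 'a set \<Rightarrow> nat \<Rightarrow> ((nat \<Rightarrow> nat) \<Rightarrow> 'a) set" where
  "coeffs A S n = {c. (\<forall>\<alpha>. c \<alpha> \<in> S) \<and> (\<forall>\<alpha>. \<alpha> \<notin> expo n \<longrightarrow> c \<alpha> = \<zero>\<^bsub>A\<^esub>)
                     \<and> finite {\<alpha>. c \<alpha> \<noteq> \<zero>\<^bsub>A\<^esub>}}"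

definition lin_comb :: "'a ring \<Rightarrow> nat \<Rightarrow> (nat \<Rightarrow> 'a) \<Rightarrow> ((nat \<Rightarrow> nat) \<Rightarrow> 'a) \<Rightarrow> 'a" where
  "lin_comb A n x c = finsum A (\<lambda>\<alpha>. c \<alpha> \<otimes>\<^bsub>A\<^esub> mon A n x \<alpha>) {\<alpha>. c \<alpha> \<noteq> \<zero>\<^bsub>A\<^esub>}"

definition pbw_rel :: "'a ring \<Rightarrow> 'a set \<Rightarrow> nat \<Rightarrow> (nat \<Rightarrow> 'a) \<Rightarrow> nat \<Rightarrow> nat \<Rightarrow> 'a \<Rightarrow> bool" where
  "pbw_rel A S n x i j c \<longleftrightarrow>
     (\<exists>r0\<in>S. \<exists>r. (\<forall>l. r l \<in> S) \<and>
        x j \<otimes>\<^bsub>A\<^esub> x i \<ominus>\<^bsub>A\<^esub> c \<otimes>\<^bsub>A\<^esub> x i \<otimes>\<^bsub>A\<^esub> x j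
          = r0 \<oplus>\<^bsub>A\<^esub> finsum A (\<lambda>l. r l \<otimes>\<^bsub>A\<^esub> x l) {..<n})"

definition skew_PBW :: "'a ring \<Rightarrow> 'a set \<Rightarrow> nat \<Rightarrow> (nat \<Rightarrow> 'a) \<Rightarrow> bool" where
  "skew_PBW A S n x \<longleftrightarrow>
     ring A \<and> subring S A \<and> (\<forall>i<n. x i \<in> carrier A) \<and>
     \<comment> \<open>(ii) A is a free left S-module with basis Mon(A)\<close>
     (\<forall>a\<in>carrier A. \<exists>!c. c \<in> coeffs A S n \<and> a = lin_comb A n x c) \<and>
     \<comment> \<open>(iii)\<close>
     (\<forall>i<n. \<forall>r\<in>S - {\<zero>\<^bsub>A\<^esub>}. \<exists>c\<in>S - {\<zero>\<^bsub>A\<^esub>}.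
         x i \<otimes>\<^bsub>A\<^esub> r \<ominus>\<^bsub>A\<^esub> c \<otimes>\<^bsub>A\<^esub> x i \<in> S) \<and>
     \<comment> \<open>(iv)\<close>
     (\<forall>i<n. \<forall>j<n. \<exists>c\<in>S - {\<zero>\<^bsub>A\<^esub>}. pbw_rel A S n x i j c)"

text \<open>Bijective: each sigma_i (determined by x_i r = sigma_i(r) x_i + delta_i(r), delta_i(r) in S;
  unique by freeness) is bijective on S, and the c_{i,j} (unique for i<j by freeness)
  are invertible in S.\<close>
definition bij_skew_PBW :: "'a ring \<Rightarrow> 'a set \<Rightarrow> nat \<Rightarrow> (nat \<Rightarrow> 'a) \<Rightarrow> bool" where
  "bij_skew_PBW A S n x \<longleftrightarrow> skew_PBW A S n x \<and>
     (\<forall>i<n. \<exists>\<sigma>. bij_betw \<sigma> S S \<and>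
         (\<forall>r\<in>S. x i \<otimes>\<^bsub>A\<^esub> r \<ominus>\<^bsub>A\<^esub> \<sigma> r \<otimes>\<^bsub>A\<^esub> x i \<in> S)) \<and>
     (\<forall>i j. i < j \<and> j < n \<longrightarrow>
         (\<exists>c\<in>Units (A\<lparr>carrier := S\<rparr>). pbw_rel A S n x i j c))"

text \<open>Built as the free abelian group on carrier A x carrier B (finitely supported integer
  valued functions) modulo the subgroup generated by biadditivity and K-balancedness
  relations; multiplication (a (x) b)(c (x) d) = ac (x) bd extended bilinearly.\<close>

definition tens_free :: "('a, 'm) ring_scheme \<Rightarrow> ('b, 'n) ring_scheme \<Rightarrow> ('a \<times> 'b \<Rightarrow> int) set" where
  "tens_free A B = {f. finite {p. f p \<noteq> 0} \<and>
      (\<forall>p. f p \<noteq> 0 \<longrightarrow> fst p \<in> carrier A \<and> snd p \<in> carrier B)}"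

definition delta :: "'p \<Rightarrow> 'p \<Rightarrow> int" where
  "delta p = (\<lambda>q. if q = p then 1 else 0)"

inductive_set tens_rel :: "('k, 'l) ring_scheme \<Rightarrow> ('a, 'm) ring_scheme \<Rightarrow> ('b, 'n) ring_scheme
    \<Rightarrow> ('k \<Rightarrow> 'a) \<Rightarrow> ('k \<Rightarrow> 'b) \<Rightarrow> ('a \<times> 'b \<Rightarrow> int) set"
  for K A B phiA phiB where
  zero: "(\<lambda>_. 0) \<in> tens_rel K A B phiA phiB"
| addl: "\<lbrakk>a \<in> carrier A; a' \<in> carrier A; b \<in> carrier B\<rbrakk> \<Longrightarrow>
     (\<lambda>p. delta (a \<oplus>\<^bsub>A\<^esub> a', b) p - delta (a, b) p - delta (a', b) p) \<in> tens_rel K A B phiA phiB"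
| addr: "\<lbrakk>a \<in> carrier A; b \<in> carrier B; b' \<in> carrier B\<rbrakk> \<Longrightarrow>
     (\<lambda>p. delta (a, b \<oplus>\<^bsub>B\<^esub> b') p - delta (a, b) p - delta (a, b') p) \<in> tens_rel K A B phiA phiB"
| bal: "\<lbrakk>c \<in> carrier K; a \<in> carrier A; b \<in> carrier B\<rbrakk> \<Longrightarrow>
     (\<lambda>p. delta (phiA c \<otimes>\<^bsub>A\<^esub> a, b) p - delta (a, phiB c \<otimes>\<^bsub>B\<^esub> b) p) \<in> tens_rel K A B phiA phiB"
| plus: "\<lbrakk>f \<in> tens_rel K A B phiA phiB; g \<in> tens_rel K A B phiA phiB\<rbrakk> \<Longrightarrow>
     (\<lambda>p. f p + g p) \<in> tens_rel K A B phiA phiB"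
| neg: "f \<in> tens_rel K A B phiA phiB \<Longrightarrow> (\<lambda>p. - f p) \<in> tens_rel K A B phiA phiB"

definition tens_class :: "('k, 'l) ring_scheme \<Rightarrow> ('a, 'm) ring_scheme \<Rightarrow> ('b, 'n) ring_scheme
    \<Rightarrow> ('k \<Rightarrow> 'a) \<Rightarrow> ('k \<Rightarrow> 'b) \<Rightarrow> ('a \<times> 'b \<Rightarrow> int) \<Rightarrow> ('a \<times> 'b \<Rightarrow> int) set" where
  "tens_class K A B phiA phiB f =
     {g \<in> tens_free A B. (\<lambda>p. g p - f p) \<in> tens_rel K A B phiA phiB}"

definition tens_rep :: "('a \<times> 'b \<Rightarrow> int) set \<Rightarrow> ('a \<times> 'b \<Rightarrow> int)" where
  "tens_rep U = (SOME f. f \<in> U)"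

definition tens_conv :: "('a, 'm) ring_scheme \<Rightarrow> ('b, 'n) ring_scheme
    \<Rightarrow> ('a \<times> 'b \<Rightarrow> int) \<Rightarrow> ('a \<times> 'b \<Rightarrow> int) \<Rightarrow> ('a \<times> 'b \<Rightarrow> int)" where
  "tens_conv A B f g = (\<lambda>z. sum (\<lambda>(p, q). f p * g q) {(p, q). f p \<noteq> 0 \<and> g q \<noteq> 0 \<and>
        (fst p \<otimes>\<^bsub>A\<^esub> fst q, snd p \<otimes>\<^bsub>B\<^esub> snd q) = z})"

definition tensor :: "('k, 'l) ring_scheme \<Rightarrow> ('a, 'm) ring_scheme \<Rightarrow> ('b, 'n) ring_scheme
    \<Rightarrow> ('k \<Rightarrow> 'a) \<Rightarrow> ('k \<Rightarrow> 'b) \<Rightarrow> ('a \<times> 'b \<Rightarrow> int) set ring" where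
  "tensor K A B phiA phiB =
     \<lparr>carrier = tens_class K A B phiA phiB ` tens_free A B,
      monoid.mult = (\<lambda>U V. tens_class K A B phiA phiB (tens_conv A B (tens_rep U) (tens_rep V))),
      one = tens_class K A B phiA phiB (delta (\<one>\<^bsub>A\<^esub>, \<one>\<^bsub>B\<^esub>)),
      ring.zero = tens_class K A B phiA phiB (\<lambda>_. 0),
      ring.add = (\<lambda>U V. tens_class K A B phiA phiB (\<lambda>p. tens_rep U p + tens_rep V p))\<rparr>"

definition envelop :: "('k, 'l) ring_scheme \<Rightarrow> 'a ring \<Rightarrow> ('k \<Rightarrow> 'a) \<Rightarrow> ('a \<times> 'a \<Rightarrow> int) set ring" where
  "envelop K A phi = tensor K A (opp A) phi phi"

text \<open>The canonical map R^e -> A^e induced by the inclusion of the subring S of A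
  (R = A restricted to S): r (x) s |-> r (x) s.\<close>
definition env_incl :: "('k, 'l) ring_scheme \<Rightarrow> 'a ring \<Rightarrow> ('k \<Rightarrow> 'a)
    \<Rightarrow> ('a \<times> 'a \<Rightarrow> int) set \<Rightarrow> ('a \<times> 'a \<Rightarrow> int) set" where
  "env_incl K A phi U = tens_class K A (opp A) phi phi (tens_rep U)"

end

theory Submission
  imports Defs
begin

text \<open>
  If \<open>A\<close> is free as a left module over \<open>S\<close> on its monomials and the \<open>\<sigma>\<^sub>i\<close> are bijective, then the
  matrix expressing the right multiples of the monomials through the left multiples is triangular
  with bijective diagonal, so the monomials are also a basis of the right module. Hence the opposite
  algebra, with the variables reversed, is again a bijective skew PBW extension.

  For two such extensions \<open>A\<close> of \<open>S\<close> and \<open>B\<close> of \<open>T\<close> the coordinate functions are additive and linear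
  over \<open>K\<close>, so functoriality of the tensor product turns each pair of them into a map from
  \<open>A \<otimes> B\<close> to \<open>S \<otimes> T\<close>. These maps are coordinates for the products of monomials, which gives
  freeness; the coordinate of the trivial monomial is a left inverse of the canonical map from
  \<open>S \<otimes> T\<close>, which is therefore injective. The endomorphisms for the new variables are
  \<open>\<sigma>\<^sub>i \<otimes> id\<close> and \<open>id \<otimes> \<sigma>\<^sub>j\<close>, whose inverses again come from functoriality.
\<close>

section \<open>Additive closures and additive maps\<close>

text \<open>The two tensor factors carry their coefficients on different sides: the product of A^op
  puts a left coefficient to the right of a monomial of A. Changing sides is therefore unavoidable,
  and it is exactly here that surjectivity of the twists enters. A second obstacle is that K is an
  arbitrary commutative ring, so tensoring need not preserve the inclusion of R into A; the
  coefficient ring of A^e has to be identified with an image, and an explicit retraction must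
  replace any flatness argument. A third is hidden in the word nonzero in (iii) and (iv): as soon as
  there are variables, R^e itself has to be shown nonzero. The multiplication map from R \<otimes>
  R^op to A, which is additive but in general no ring homomorphism, does this. Since an element of a
  tensor product is a class with an unspecified representative, maps out of it are obtained from
  balanced maps and identities are tested on pure tensors. The closure \<open>acl\<close> expresses
  that elements are sums of generators, and additive maps are all that is asked for.\<close>

inductive_set acl :: "('a, 'm) ring_scheme \<Rightarrow> 'a set \<Rightarrow> 'a set" for G Y where
  base: "a \<in> Y \<Longrightarrow> a \<in> acl G Y"
| zero: "\<zero>\<^bsub>G\<^esub> \<in> acl G Y"
| add: "\<lbrakk>a \<in> acl G Y; b \<in> acl G Y\<rbrakk> \<Longrightarrow> a \<oplus>\<^bsub>G\<^esub> b \<in> acl G Y"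

lemma (in abelian_group) acl_closed:
  "Y \<subseteq> carrier G \<Longrightarrow> a \<in> acl G Y \<Longrightarrow> a \<in> carrier G"
  by (rotate_tac, induction rule: acl.induct) auto

lemma acl_mono: "a \<in> acl G Y \<Longrightarrow> Y \<subseteq> acl G Z \<Longrightarrow> a \<in> acl G Z"
  by (induction rule: acl.induct) (auto intro: acl.intros)

text \<open>\<open>acl\<close> has no rule for negation, which shortens every induction over it.
  Negatives come for free when the generators are stable under them, as pure tensors and coefficient
  multiples of monomials are.\<close>

lemma (in abelian_group) acl_neg:
  assumes "Y \<subseteq> carrier G" and "\<And>a. a \<in> Y \<Longrightarrow> \<ominus> a \<in> acl G Y" and "a \<in> acl G Y"
  shows "\<ominus> a \<in> acl G Y"
  using assms(3)
proof (induction rule: acl.induct)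
  case (add a b)
  then show ?case using acl_closed[OF assms(1)] by (simp add: minus_add acl.add)
next
  case zero
  have "\<ominus> \<zero> = \<zero>" by (rule minus_equality) auto
  then show ?case using acl.zero[of G Y] by metis
qed (rule assms)

text \<open>Coordinates, one-sided multiplications and the map b \<mapsto> a \<otimes> b do not
  respect products, so only additivity is bundled.\<close>

definition addhom :: "('a, 'm) ring_scheme \<Rightarrow> ('b, 'n) ring_scheme \<Rightarrow> ('a \<Rightarrow> 'b) \<Rightarrow> bool" where
  "addhom G H h \<longleftrightarrow> h \<in> carrier G \<rightarrow> carrier H \<and>
     (\<forall>a\<in>carrier G. \<forall>b\<in>carrier G. h (a \<oplus>\<^bsub>G\<^esub> b) = h a \<oplus>\<^bsub>H\<^esub> h b)"

lemma addhom_closed: "addhom G H h \<Longrightarrow> a \<in> carrier G \<Longrightarrow> h a \<in> carrier H"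
  by (auto simp: addhom_def)

lemma addhom_add: "addhom G H h \<Longrightarrow> a \<in> carrier G \<Longrightarrow> b \<in> carrier G \<Longrightarrow> h (a \<oplus>\<^bsub>G\<^esub> b) = h a \<oplus>\<^bsub>H\<^esub> h b"
  by (auto simp: addhom_def)

lemma addhom_zero:
  assumes "abelian_group G" "abelian_group H" "addhom G H h"
  shows "h \<zero>\<^bsub>G\<^esub> = \<zero>\<^bsub>H\<^esub>"
proof -
  interpret G: abelian_group G by fact
  interpret H: abelian_group H by fact
  have "h \<zero>\<^bsub>G\<^esub> \<oplus>\<^bsub>H\<^esub> h \<zero>\<^bsub>G\<^esub> = h \<zero>\<^bsub>G\<^esub>" "h \<zero>\<^bsub>G\<^esub> \<in> carrier H"
    using addhom_add[OF assms(3), of "\<zero>\<^bsub>G\<^esub>" "\<zero>\<^bsub>G\<^esub>"] addhom_closed[OF assms(3)] by auto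
  then show ?thesis by (metis H.add.r_cancel_one)
qed

lemma addhom_neg:
  assumes "abelian_group G" "abelian_group H" "addhom G H h" "a \<in> carrier G"
  shows "h (\<ominus>\<^bsub>G\<^esub> a) = \<ominus>\<^bsub>H\<^esub> h a"
proof -
  interpret G: abelian_group G by fact
  interpret H: abelian_group H by fact
  have "h (\<ominus>\<^bsub>G\<^esub> a) \<oplus>\<^bsub>H\<^esub> h a = \<zero>\<^bsub>H\<^esub>"
    using addhom_add[OF assms(3), of "\<ominus>\<^bsub>G\<^esub> a" a] addhom_zero[OF assms(1-3)] assms(4) G.l_neg by auto
  then show ?thesis using addhom_closed[OF assms(3)] assms(4)
    by (metis G.a_inv_closed H.minus_equality)
qed

lemma addhom_acl:
  assumes "abelian_group G" "abelian_group H" "addhom G H h" "Y \<subseteq> carrier G"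
    and "\<And>a. a \<in> Y \<Longrightarrow> h a \<in> acl H Z" "a \<in> acl G Y"
  shows "h a \<in> acl H Z"
  using assms(6)
proof (induction rule: acl.induct)
  case zero then show ?case using addhom_zero[OF assms(1-3)] acl.zero[of H Z] by simp
next
  case (add a b)
  then show ?case
    using addhom_add[OF assms(3)] abelian_group.acl_closed[OF assms(1,4)] acl.add by metis
qed (auto simp: assms)

text \<open>With the constant zero map as \<open>h'\<close> this is also the way to show that an
  additive map vanishes on a span.\<close>

lemma addhom_eq:
  assumes "abelian_group G" "abelian_group H" "addhom G H h" "addhom G H h'" "Y \<subseteq> carrier G"
    and "\<And>a. a \<in> Y \<Longrightarrow> h a = h' a" "a \<in> acl G Y"
  shows "h a = h' a"
  using assms(7)
proof (induction rule: acl.induct)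
  case zero then show ?case using addhom_zero[OF assms(1-3)] addhom_zero[OF assms(1,2,4)] by simp
next
  case (add a b)
  then show ?case
    using addhom_add[OF assms(3)] addhom_add[OF assms(4)] abelian_group.acl_closed[OF assms(1,5)] by metis
qed (auto simp: assms)

section \<open>Tensor products of algebras\<close>

text \<open>Reduces biadditive claims to the basis functions \<open>delta\<close>. Integer multiples
  of one basis function arise by repeated addition, followed by \<open>neg\<close> for negative
  ones; a general function is then stripped of one support point at a time.\<close>

lemma tens_free_induct [consumes 1, case_names zero delta add neg]:
  assumes f: "f \<in> tens_free A B"
    and z: "P (\<lambda>_. 0)"
    and d: "\<And>a b. a \<in> carrier A \<Longrightarrow> b \<in> carrier B \<Longrightarrow> P (delta (a, b))"
    and a: "\<And>f g. f \<in> tens_free A B \<Longrightarrow> g \<in> tens_free A B \<Longrightarrow> P f \<Longrightarrow> P g \<Longrightarrow> P (\<lambda>p. f p + g p)"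
    and n: "\<And>f. f \<in> tens_free A B \<Longrightarrow> P f \<Longrightarrow> P (\<lambda>p. - f p)"
  shows "P f"
proof -
  have single: "P (\<lambda>p. k * delta (a, b) p)" if ab: "a \<in> carrier A" "b \<in> carrier B" for k a b
  proof -
    have fr: "(\<lambda>p. k * delta (a, b) p) \<in> tens_free A B" for k
      using ab by (auto simp: tens_free_def delta_def intro: finite_subset[of _ "{(a,b)}"])
    have "P (\<lambda>p. int m * delta (a, b) p)" for m
    proof (induction m)
      case 0 then show ?case using z by simp
    next
      case (Suc m)
      have "P (\<lambda>p. int m * delta (a, b) p + 1 * delta (a, b) p)"
        using a[OF fr fr[of 1] Suc] d[OF ab] by simp
      then show ?case by (simp add: algebra_simps)
    qed
    then show ?thesis
    proof (cases k)
      case (neg m)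
      then show ?thesis using n[OF fr \<open>\<And>m. P (\<lambda>p. int m * delta (a, b) p)\<close>[of "Suc m"]]
        by (simp only: mult_minus_left)
    qed auto
  qed
  have "finite {p. f p \<noteq> 0}" using f by (simp add: tens_free_def)
  moreover have "\<And>F f. finite F \<Longrightarrow> {p. f p \<noteq> 0} = F \<Longrightarrow> f \<in> tens_free A B \<Longrightarrow> P f"
  proof -
    fix F f assume "finite F" "{p. f p \<noteq> 0} = F" "f \<in> tens_free A B"
    then show "P f"
    proof (induction F arbitrary: f)
      case empty
      then have "f = (\<lambda>_. 0)" by auto
      then show ?case using z by simp
    next
      case (insert q F)
      obtain a' b' where q: "q = (a', b')" by force
      have ab: "a' \<in> carrier A" "b' \<in> carrier B"
        using insert.prems q by (auto simp: tens_free_def)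
      let ?g = "f(q := 0)"
      have supp: "{p. ?g p \<noteq> 0} = F" using insert.prems(1) insert.hyps(2) by (auto split: if_splits)
      then have g: "?g \<in> tens_free A B"
        using insert.prems(2) insert.hyps(1) by (auto simp: tens_free_def split: if_splits)
      have k: "(\<lambda>p. f q * delta (a', b') p) \<in> tens_free A B"
        using ab by (auto simp: tens_free_def delta_def intro: finite_subset[of _ "{(a',b')}"])
      have "P (\<lambda>p. ?g p + f q * delta (a', b') p)"
        by (rule a[OF g k insert.IH[OF supp g] single[OF ab]])
      moreover have "(\<lambda>p. ?g p + f q * delta (a', b') p) = f"
        by (auto simp: delta_def q)
      ultimately show ?case by simp
    qed
  qed
  ultimately show ?thesis using f by blast
qed

section \<open>The free abelian group on pairs and its convolution product\<close>

lemma delta_in_free: "a \<in> carrier A \<Longrightarrow> b \<in> carrier B \<Longrightarrow> delta (a, b) \<in> tens_free A B"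
  by (auto simp: tens_free_def delta_def)

lemma zero_in_free: "(\<lambda>_. 0) \<in> tens_free A B"
  by (auto simp: tens_free_def)

lemma tens_free_iff:
  "f \<in> tens_free A B \<longleftrightarrow> finite {p. f p \<noteq> 0} \<and> {p. f p \<noteq> 0} \<subseteq> carrier A \<times> carrier B"
  unfolding tens_free_def by (simp add: subset_iff mem_Times_iff)

lemma add_in_free:
  assumes "f \<in> tens_free A B" "g \<in> tens_free A B"
  shows "(\<lambda>p. f p + g p) \<in> tens_free A B"
proof -
  have "{p. f p + g p \<noteq> 0} \<subseteq> {p. f p \<noteq> 0} \<union> {p. g p \<noteq> 0}" by auto
  then show ?thesis
    using assms unfolding tens_free_iff by (meson finite_UnI finite_subset le_supI order.trans)
qed

lemma neg_in_free: "f \<in> tens_free A B \<Longrightarrow> (\<lambda>p. - f p) \<in> tens_free A B"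
  by (auto simp: tens_free_def)

lemma diff_in_free: "f \<in> tens_free A B \<Longrightarrow> g \<in> tens_free A B \<Longrightarrow> (\<lambda>p. f p - g p) \<in> tens_free A B"
  using add_in_free[of f A B "\<lambda>p. - g p"] neg_in_free[of g A B] by simp

text \<open>The defining sum ranges over a set that depends on both supports and on
  \<open>z\<close>. Summing over a fixed rectangle, with \<open>delta\<close> selecting the fibre
  over \<open>z\<close>, allows several functions to be expanded over one common index set, which is
  what additivity needs.\<close>

lemma conv_expand:
  assumes "finite P" "{p. f p \<noteq> 0} \<subseteq> P" "finite Q" "{q. g q \<noteq> 0} \<subseteq> Q"
  shows "tens_conv A B f g z = (\<Sum>p\<in>P. \<Sum>q\<in>Q. f p * g q *
           delta (fst p \<otimes>\<^bsub>A\<^esub> fst q, snd p \<otimes>\<^bsub>B\<^esub> snd q) z)"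
proof -
  have "(\<Sum>p\<in>P. \<Sum>q\<in>Q. f p * g q * delta (fst p \<otimes>\<^bsub>A\<^esub> fst q, snd p \<otimes>\<^bsub>B\<^esub> snd q) z)
     = (\<Sum>(p,q)\<in>P \<times> Q. f p * g q * delta (fst p \<otimes>\<^bsub>A\<^esub> fst q, snd p \<otimes>\<^bsub>B\<^esub> snd q) z)"
    by (rule sum.cartesian_product)
  also have "\<dots> = tens_conv A B f g z"
    unfolding tens_conv_def
  proof (rule sum.mono_neutral_cong_right)
    show "finite (P \<times> Q)" using assms by simp
    show "{(p, q). f p \<noteq> 0 \<and> g q \<noteq> 0 \<and> (fst p \<otimes>\<^bsub>A\<^esub> fst q, snd p \<otimes>\<^bsub>B\<^esub> snd q) = z} \<subseteq> P \<times> Q"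
      using assms by blast
    show "\<forall>r\<in>P \<times> Q - {(p, q). f p \<noteq> 0 \<and> g q \<noteq> 0 \<and>
        (fst p \<otimes>\<^bsub>A\<^esub> fst q, snd p \<otimes>\<^bsub>B\<^esub> snd q) = z}.
      (case r of (p, q) \<Rightarrow> f p * g q * delta (fst p \<otimes>\<^bsub>A\<^esub> fst q, snd p \<otimes>\<^bsub>B\<^esub> snd q) z) = 0"
      unfolding delta_def by fastforce
  qed (auto simp: delta_def)
  finally show ?thesis by simp
qed

lemma conv_add_left:
  assumes "f \<in> tens_free A B" "f' \<in> tens_free A B" "g \<in> tens_free A B"
  shows "tens_conv A B (\<lambda>p. f p + f' p) g = (\<lambda>p. tens_conv A B f g p + tens_conv A B f' g p)"
proof
  fix z
  let ?P = "{p. f p \<noteq> 0} \<union> {p. f' p \<noteq> 0}" and ?Q = "{q. g q \<noteq> 0}"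
  have fin: "finite ?P" "finite ?Q" using assms by (auto simp: tens_free_def)
  note expand = conv_expand[OF fin(1) _ fin(2) order.refl, of _ A B z]
  have "tens_conv A B (\<lambda>p. f p + f' p) g z = (\<Sum>p\<in>?P. \<Sum>q\<in>?Q. (f p + f' p) * g q *
      delta (fst p \<otimes>\<^bsub>A\<^esub> fst q, snd p \<otimes>\<^bsub>B\<^esub> snd q) z)"
    by (rule expand) auto
  also have "\<dots> = (\<Sum>p\<in>?P. \<Sum>q\<in>?Q. f p * g q *
        delta (fst p \<otimes>\<^bsub>A\<^esub> fst q, snd p \<otimes>\<^bsub>B\<^esub> snd q) z)
      + (\<Sum>p\<in>?P. \<Sum>q\<in>?Q. f' p * g q *
        delta (fst p \<otimes>\<^bsub>A\<^esub> fst q, snd p \<otimes>\<^bsub>B\<^esub> snd q) z)"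
    by (simp only: distrib_right sum.distrib)
  also have "\<dots> = tens_conv A B f g z + tens_conv A B f' g z"
    by (rule arg_cong2[where f = "(+)", OF expand[symmetric] expand[symmetric]]) (rule Un_upper1 Un_upper2)+
  finally show "tens_conv A B (\<lambda>p. f p + f' p) g z = tens_conv A B f g z + tens_conv A B f' g z" .
qed

lemma conv_add_right:
  assumes "f \<in> tens_free A B" "f' \<in> tens_free A B" "g \<in> tens_free A B"
  shows "tens_conv A B g (\<lambda>p. f p + f' p) = (\<lambda>p. tens_conv A B g f p + tens_conv A B g f' p)"
proof
  fix z
  let ?P = "{p. f p \<noteq> 0} \<union> {p. f' p \<noteq> 0}" and ?Q = "{q. g q \<noteq> 0}"
  have fin: "finite ?P" "finite ?Q" using assms by (auto simp: tens_free_def)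
  note expand = conv_expand[OF fin(2) order.refl fin(1), of _ A B z]
  have "tens_conv A B g (\<lambda>p. f p + f' p) z = (\<Sum>p\<in>?Q. \<Sum>q\<in>?P. g p * (f q + f' q) *
      delta (fst p \<otimes>\<^bsub>A\<^esub> fst q, snd p \<otimes>\<^bsub>B\<^esub> snd q) z)"
    by (rule expand) auto
  also have "\<dots> = (\<Sum>p\<in>?Q. \<Sum>q\<in>?P. g p * f q *
        delta (fst p \<otimes>\<^bsub>A\<^esub> fst q, snd p \<otimes>\<^bsub>B\<^esub> snd q) z)
      + (\<Sum>p\<in>?Q. \<Sum>q\<in>?P. g p * f' q *
        delta (fst p \<otimes>\<^bsub>A\<^esub> fst q, snd p \<otimes>\<^bsub>B\<^esub> snd q) z)"
    by (simp only: distrib_left distrib_right sum.distrib)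
  also have "\<dots> = tens_conv A B g f z + tens_conv A B g f' z"
    by (rule arg_cong2[where f = "(+)", OF expand[symmetric] expand[symmetric]]) (rule Un_upper1 Un_upper2)+
  finally show "tens_conv A B g (\<lambda>p. f p + f' p) z = tens_conv A B g f z + tens_conv A B g f' z" .
qed

lemma conv_neg:
  "tens_conv A B (\<lambda>p. - f p) g = (\<lambda>p. - tens_conv A B f g p)"
  "tens_conv A B f (\<lambda>p. - g p) = (\<lambda>p. - tens_conv A B f g p)"
  by (simp_all add: tens_conv_def fun_eq_iff case_prod_unfold sum_negf)

lemma conv_zero:
  "tens_conv A B (\<lambda>_. 0) g = (\<lambda>_. 0)" "tens_conv A B f (\<lambda>_. 0) = (\<lambda>_. 0)"
  by (auto simp: tens_conv_def fun_eq_iff)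

lemma conv_diff:
  assumes "f \<in> tens_free A B" "f' \<in> tens_free A B" "g \<in> tens_free A B"
  shows "tens_conv A B (\<lambda>p. f p - f' p) g = (\<lambda>p. tens_conv A B f g p - tens_conv A B f' g p)"
    and "tens_conv A B g (\<lambda>p. f p - f' p) = (\<lambda>p. tens_conv A B g f p - tens_conv A B g f' p)"
  using conv_add_left[OF assms(1) neg_in_free[OF assms(2)] assms(3)]
    conv_add_right[OF assms(1) neg_in_free[OF assms(2)] assms(3)]
  by (simp_all add: conv_neg)

lemma conv_delta:
  "tens_conv A B (delta (a, b)) (delta (c, d)) = delta (a \<otimes>\<^bsub>A\<^esub> c, b \<otimes>\<^bsub>B\<^esub> d)"
proof
  fix z
  have fin: "finite {(a,b)}" "finite {(c,d)}" by auto
  show "tens_conv A B (delta (a, b)) (delta (c, d)) z = delta (a \<otimes>\<^bsub>A\<^esub> c, b \<otimes>\<^bsub>B\<^esub> d) z"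
    using conv_expand[OF fin(1) _ fin(2), of "delta (a, b)" "delta (c, d)" A B z]
    by (simp add: delta_def)
qed

section \<open>The tensor product of two algebras as a ring\<close>

locale tensor_product =
  fixes K :: "('k, 'l) ring_scheme" and A :: "'a ring" and B :: "'b ring"
    and phiA :: "'k \<Rightarrow> 'a" and phiB :: "'k \<Rightarrow> 'b"
  assumes algA: "is_algebra K A phiA" and algB: "is_algebra K B phiB"
begin

sublocale A: ring A using algA by (simp add: is_algebra_def)
sublocale B: ring B using algB by (simp add: is_algebra_def)

abbreviation "rel \<equiv> tens_rel K A B phiA phiB"
abbreviation "free \<equiv> tens_free A B"
abbreviation "cls \<equiv> tens_class K A B phiA phiB"
abbreviation "conv \<equiv> tens_conv A B"
abbreviation "E \<equiv> tensor K A B phiA phiB"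

definition pure :: "'a \<Rightarrow> 'b \<Rightarrow> ('a \<times> 'b \<Rightarrow> int) set" where
  "pure a b = cls (delta (a, b))"

lemma phiA_closed: "c \<in> carrier K \<Longrightarrow> phiA c \<in> carrier A"
  using algA by (auto simp: is_algebra_def ring_hom_def)

lemma phiB_closed: "c \<in> carrier K \<Longrightarrow> phiB c \<in> carrier B"
  using algB by (auto simp: is_algebra_def ring_hom_def)

lemma phiA_comm: "c \<in> carrier K \<Longrightarrow> a \<in> carrier A \<Longrightarrow> a \<otimes>\<^bsub>A\<^esub> phiA c = phiA c \<otimes>\<^bsub>A\<^esub> a"
  using algA by (auto simp: is_algebra_def)

lemma phiB_comm: "c \<in> carrier K \<Longrightarrow> b \<in> carrier B \<Longrightarrow> b \<otimes>\<^bsub>B\<^esub> phiB c = phiB c \<otimes>\<^bsub>B\<^esub> b"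
  using algB by (auto simp: is_algebra_def)

lemma rel_diff: "f \<in> rel \<Longrightarrow> g \<in> rel \<Longrightarrow> (\<lambda>p. f p - g p) \<in> rel"
  using tens_rel.plus[of f K A B phiA phiB "\<lambda>p. - g p"] tens_rel.neg[of g K A B phiA phiB] by simp

lemma rel_free: "f \<in> rel \<Longrightarrow> f \<in> free"
  by (induction rule: tens_rel.induct)
    (auto intro!: zero_in_free diff_in_free delta_in_free neg_in_free add_in_free phiA_closed phiB_closed)

lemma conv_free:
  assumes "f \<in> free" "g \<in> free" shows "conv f g \<in> free"
  using assms(1)
proof (induction rule: tens_free_induct)
  case (delta a b)
  show ?case using assms(2)
  proof (induction rule: tens_free_induct)
    case (add f g)
    then show ?case by (simp add: conv_add_right[OF add(1,2) delta_in_free[OF delta]] add_in_free)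
  qed (auto simp: conv_delta conv_zero conv_neg delta intro: delta_in_free zero_in_free neg_in_free)
next
  case (add f f')
  then show ?case by (simp add: conv_add_left[OF add(1,2) assms(2)] add_in_free)
qed (auto simp: conv_zero conv_neg intro: zero_in_free neg_in_free)

text \<open>One half of the fact that the relations form an ideal. Multiplying a generating relation
  by a pure tensor on the right gives a relation of the same kind, by distributivity and, for
  balancing, by associativity.\<close>

lemma conv_rel_right:
  assumes "f \<in> rel" "g \<in> free" shows "conv f g \<in> rel"
  using assms(2)
proof (induction rule: tens_free_induct)
  case (delta c d)
  note cd = delta delta_in_free[OF delta]
  show ?case using assms(1)
  proof (induction rule: tens_rel.induct)
    case (addl a a' b)
    then show ?case
      using cd tens_rel.addl[of "a \<otimes>\<^bsub>A\<^esub> c" A "a' \<otimes>\<^bsub>A\<^esub> c" "b \<otimes>\<^bsub>B\<^esub> d" B K phiA phiB]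
      by (simp add: conv_diff conv_delta diff_in_free delta_in_free A.l_distr)
  next
    case (addr a b b')
    then show ?case
      using cd tens_rel.addr[of "a \<otimes>\<^bsub>A\<^esub> c" A "b \<otimes>\<^bsub>B\<^esub> d" B "b' \<otimes>\<^bsub>B\<^esub> d" K phiA phiB]
      by (simp add: conv_diff conv_delta diff_in_free delta_in_free B.l_distr)
  next
    case (bal k a b)
    then show ?case
      using cd tens_rel.bal[of k K "a \<otimes>\<^bsub>A\<^esub> c" A "b \<otimes>\<^bsub>B\<^esub> d" B phiA phiB]
      by (simp add: conv_diff conv_delta diff_in_free delta_in_free A.m_assoc B.m_assoc phiA_closed phiB_closed)
  next
    case (plus f g)
    then show ?case using cd by (simp add: conv_add_left rel_free tens_rel.plus)
  qed (auto simp: conv_zero conv_neg intro: tens_rel.zero tens_rel.neg)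
next
  case (add g g')
  then show ?case using assms(1) by (simp add: conv_add_right rel_free tens_rel.plus)
qed (auto simp: conv_zero conv_neg intro: tens_rel.zero tens_rel.neg)

text \<open>On this side the scalar of a balancing relation stands behind the new factor and must be
  moved in front of it; this uses that the images of K are central.\<close>

lemma conv_rel_left:
  assumes "f \<in> rel" "g \<in> free" shows "conv g f \<in> rel"
  using assms(2)
proof (induction rule: tens_free_induct)
  case (delta c d)
  note cd = delta delta_in_free[OF delta]
  show ?case using assms(1)
  proof (induction rule: tens_rel.induct)
    case (addl a a' b)
    then show ?case
      using cd tens_rel.addl[of "c \<otimes>\<^bsub>A\<^esub> a" A "c \<otimes>\<^bsub>A\<^esub> a'" "d \<otimes>\<^bsub>B\<^esub> b" B K phiA phiB]
      by (simp add: conv_diff conv_delta diff_in_free delta_in_free A.r_distr)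
  next
    case (addr a b b')
    then show ?case
      using cd tens_rel.addr[of "c \<otimes>\<^bsub>A\<^esub> a" A "d \<otimes>\<^bsub>B\<^esub> b" B "d \<otimes>\<^bsub>B\<^esub> b'" K phiA phiB]
      by (simp add: conv_diff conv_delta diff_in_free delta_in_free B.r_distr)
  next
    case (bal k a b)
    have "c \<otimes>\<^bsub>A\<^esub> (phiA k \<otimes>\<^bsub>A\<^esub> a) = phiA k \<otimes>\<^bsub>A\<^esub> (c \<otimes>\<^bsub>A\<^esub> a)"
      "d \<otimes>\<^bsub>B\<^esub> (phiB k \<otimes>\<^bsub>B\<^esub> b) = phiB k \<otimes>\<^bsub>B\<^esub> (d \<otimes>\<^bsub>B\<^esub> b)"
      using bal cd by (simp_all add: A.m_assoc[symmetric] B.m_assoc[symmetric] phiA_closed phiB_closed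
          phiA_comm phiB_comm)
    then show ?case
      using bal cd tens_rel.bal[of k K "c \<otimes>\<^bsub>A\<^esub> a" A "d \<otimes>\<^bsub>B\<^esub> b" B phiA phiB]
      by (simp add: conv_diff conv_delta diff_in_free delta_in_free phiA_closed phiB_closed)
  next
    case (plus f g)
    then show ?case using cd by (simp add: conv_add_right rel_free tens_rel.plus)
  qed (auto simp: conv_zero conv_neg intro: tens_rel.zero tens_rel.neg)
next
  case (add g g')
  then show ?case using assms(1) by (simp add: conv_add_left rel_free tens_rel.plus)
qed (auto simp: conv_zero conv_neg intro: tens_rel.zero tens_rel.neg)

lemma cls_eqI:
  assumes "(\<lambda>p. f p - g p) \<in> rel"
  shows "cls f = cls g"
  unfolding tens_class_def
proof (intro Collect_cong conj_cong refl iffI)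
  fix h
  assume "(\<lambda>p. h p - f p) \<in> rel"
  from tens_rel.plus[OF this assms] show "(\<lambda>p. h p - g p) \<in> rel" by simp
next
  fix h
  assume "(\<lambda>p. h p - g p) \<in> rel"
  from rel_diff[OF this assms] show "(\<lambda>p. h p - f p) \<in> rel" by simp
qed

text \<open>\<open>tens_rep\<close> is an arbitrary choice. The only usable information about it is
  that it differs from any given representative by a relation.\<close>

lemma rep_cls:
  assumes "f \<in> free"
  shows "tens_rep (cls f) \<in> free" "(\<lambda>p. tens_rep (cls f) p - f p) \<in> rel"
proof -
  have "f \<in> cls f" using assms tens_rel.zero by (simp add: tens_class_def)
  then have "tens_rep (cls f) \<in> cls f" unfolding tens_rep_def by (rule someI[of "\<lambda>h. h \<in> cls f"])
  then show "tens_rep (cls f) \<in> free" "(\<lambda>p. tens_rep (cls f) p - f p) \<in> rel"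
    by (simp_all add: tens_class_def)
qed

lemma cls_add:
  assumes "f \<in> free" "g \<in> free"
  shows "cls f \<oplus>\<^bsub>E\<^esub> cls g = cls (\<lambda>p. f p + g p)"
proof -
  have "(\<lambda>p. (tens_rep (cls f) p - f p) + (tens_rep (cls g) p - g p)) \<in> rel"
    using rep_cls assms by (intro tens_rel.plus) auto
  then show ?thesis
    by (auto simp: tensor_def algebra_simps intro!: cls_eqI)
qed

lemma cls_mult:
  assumes "f \<in> free" "g \<in> free"
  shows "cls f \<otimes>\<^bsub>E\<^esub> cls g = cls (conv f g)"
proof -
  let ?f = "tens_rep (cls f)" and ?g = "tens_rep (cls g)"
  \<comment> \<open>The telescoping identity f'g' - fg = (f' - f)g' + f(g' - g) writes the change of
    representatives as two relations.\<close>
  have "(\<lambda>p. conv (\<lambda>p. ?f p - f p) ?g p + conv f (\<lambda>p. ?g p - g p) p) \<in> rel"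
    using rep_cls assms by (intro tens_rel.plus conv_rel_left conv_rel_right) auto
  then have "(\<lambda>p. conv ?f ?g p - conv f g p) \<in> rel"
    using rep_cls assms by (simp add: conv_diff)
  then show ?thesis by (auto simp: tensor_def intro!: cls_eqI)
qed

lemma E_one: "\<one>\<^bsub>E\<^esub> = pure \<one>\<^bsub>A\<^esub> \<one>\<^bsub>B\<^esub>" by (simp add: tensor_def pure_def)
lemma E_zero: "\<zero>\<^bsub>E\<^esub> = cls (\<lambda>_. 0)" by (simp add: tensor_def)
lemma E_carrier: "carrier E = cls ` free" by (simp add: tensor_def)

lemma pure_add_left:
  assumes "a \<in> carrier A" "a' \<in> carrier A" "b \<in> carrier B"
  shows "pure (a \<oplus>\<^bsub>A\<^esub> a') b = pure a b \<oplus>\<^bsub>E\<^esub> pure a' b"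
proof -
  have "pure (a \<oplus>\<^bsub>A\<^esub> a') b = cls (\<lambda>p. delta (a, b) p + delta (a', b) p)"
    unfolding pure_def
    using tens_rel.addl[OF assms, where ?K = K and phiA = phiA and phiB = phiB]
    by (intro cls_eqI) (simp add: algebra_simps)
  then show ?thesis using assms by (simp add: pure_def cls_add delta_in_free)
qed

lemma pure_add_right:
  assumes "a \<in> carrier A" "b \<in> carrier B" "b' \<in> carrier B"
  shows "pure a (b \<oplus>\<^bsub>B\<^esub> b') = pure a b \<oplus>\<^bsub>E\<^esub> pure a b'"
proof -
  have "pure a (b \<oplus>\<^bsub>B\<^esub> b') = cls (\<lambda>p. delta (a, b) p + delta (a, b') p)"
    unfolding pure_def
    using tens_rel.addr[OF assms, where ?K = K and phiA = phiA and phiB = phiB]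
    by (intro cls_eqI) (simp add: algebra_simps)
  then show ?thesis using assms by (simp add: pure_def cls_add delta_in_free)
qed

lemma pure_bal:
  assumes "c \<in> carrier K" "a \<in> carrier A" "b \<in> carrier B"
  shows "pure (phiA c \<otimes>\<^bsub>A\<^esub> a) b = pure a (phiB c \<otimes>\<^bsub>B\<^esub> b)"
  unfolding pure_def using tens_rel.bal[OF assms] by (intro cls_eqI)

lemma pure_mult:
  assumes "a \<in> carrier A" "b \<in> carrier B" "a' \<in> carrier A" "b' \<in> carrier B"
  shows "pure a b \<otimes>\<^bsub>E\<^esub> pure a' b' = pure (a \<otimes>\<^bsub>A\<^esub> a') (b \<otimes>\<^bsub>B\<^esub> b')"
  using assms by (simp add: pure_def cls_mult delta_in_free conv_delta)

lemma pure_closed: "a \<in> carrier A \<Longrightarrow> b \<in> carrier B \<Longrightarrow> pure a b \<in> carrier E"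
  by (simp add: pure_def E_carrier delta_in_free)

lemma conv_assoc:
  assumes "f \<in> free" "g \<in> free" "h \<in> free"
  shows "conv (conv f g) h = conv f (conv g h)"
  using assms(1)
proof (induction rule: tens_free_induct)
  case (delta a b)
  note ab = delta delta_in_free[OF delta]
  show ?case using assms(2)
  proof (induction rule: tens_free_induct)
    case (delta c d)
    note cd = delta delta_in_free[OF delta]
    show ?case using assms(3)
    proof (induction rule: tens_free_induct)
      case (delta e e')
      then show ?case using ab cd by (simp add: conv_delta A.m_assoc B.m_assoc)
    next
      case (add f g)
      then show ?case using ab cd by (simp add: conv_add_right conv_free)
    qed (auto simp: conv_zero conv_neg)
  next
    case (add f g)
    then show ?case using ab assms(3) by (simp add: conv_add_right conv_add_left conv_free)
  qed (auto simp: conv_zero conv_neg)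
next
  case (add f f')
  then show ?case using assms by (simp add: conv_add_left conv_free)
qed (auto simp: conv_zero conv_neg)

lemma conv_one:
  assumes "f \<in> free"
  shows "conv (delta (\<one>\<^bsub>A\<^esub>, \<one>\<^bsub>B\<^esub>)) f = f" "conv f (delta (\<one>\<^bsub>A\<^esub>, \<one>\<^bsub>B\<^esub>)) = f"
  using assms
proof (induction rule: tens_free_induct)
  case (add f f')
  {
    case 1
    then show ?case using add by (simp add: conv_add_right delta_in_free)
  next
    case 2
    then show ?case using add by (simp add: conv_add_left delta_in_free)
  }
qed (auto simp: conv_zero conv_neg conv_delta)

lemma ring_tensor: "ring E"
proof (rule ringI)
  show "abelian_group E"
  proof (rule abelian_groupI)
    fix x assume "x \<in> carrier E"
    then obtain f where f: "f \<in> free" "x = cls f" by (auto simp: E_carrier)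
    then have "cls (\<lambda>p. - f p) \<oplus>\<^bsub>E\<^esub> x = \<zero>\<^bsub>E\<^esub>"
      by (simp add: cls_add neg_in_free E_zero)
    then show "\<exists>y\<in>carrier E. y \<oplus>\<^bsub>E\<^esub> x = \<zero>\<^bsub>E\<^esub>"
      using f by (auto simp: E_carrier neg_in_free)
  qed (auto simp: E_carrier cls_add E_zero add_in_free zero_in_free add_ac)
  show "monoid E"
    by (rule monoidI) (auto simp: E_carrier E_one cls_mult conv_free delta_in_free pure_def conv_assoc conv_one)
qed (auto simp: E_carrier cls_add cls_mult conv_free add_in_free conv_add_left conv_add_right)

sublocale E: ring E by (rule ring_tensor)

lemma cls_neg: "f \<in> free \<Longrightarrow> cls (\<lambda>p. - f p) = \<ominus>\<^bsub>E\<^esub> cls f"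
  by (rule E.minus_equality[symmetric])
    (auto simp: E_carrier cls_add neg_in_free E_zero add_in_free)

lemma pure_addhom_left: "b \<in> carrier B \<Longrightarrow> addhom A E (\<lambda>a. pure a b)"
  by (auto simp: addhom_def pure_closed pure_add_left)

lemma pure_addhom_right: "a \<in> carrier A \<Longrightarrow> addhom B E (\<lambda>b. pure a b)"
  by (auto simp: addhom_def pure_closed pure_add_right)

lemma pure_zero_left: "b \<in> carrier B \<Longrightarrow> pure \<zero>\<^bsub>A\<^esub> b = \<zero>\<^bsub>E\<^esub>"
  using addhom_zero[OF _ _ pure_addhom_left] A.abelian_group_axioms E.abelian_group_axioms by auto

lemma pure_zero_right: "a \<in> carrier A \<Longrightarrow> pure a \<zero>\<^bsub>B\<^esub> = \<zero>\<^bsub>E\<^esub>"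
  using addhom_zero[OF _ _ pure_addhom_right] B.abelian_group_axioms E.abelian_group_axioms by auto

lemma pure_neg_left: "a \<in> carrier A \<Longrightarrow> b \<in> carrier B \<Longrightarrow> pure (\<ominus>\<^bsub>A\<^esub> a) b = \<ominus>\<^bsub>E\<^esub> pure a b"
  using addhom_neg[OF _ _ pure_addhom_left] A.abelian_group_axioms E.abelian_group_axioms by auto

definition pures :: "('a \<times> 'b \<Rightarrow> int) set set" where
  "pures = {pure a b | a b. a \<in> carrier A \<and> b \<in> carrier B}"

lemma pures_closed: "pures \<subseteq> carrier E"
  by (auto simp: pures_def pure_closed)

text \<open>Sums of pure tensors suffice, without differences, because -(a \<otimes> b) = (-a)
  \<otimes> b is again pure.\<close>

lemma tensor_generated: "u \<in> carrier E \<Longrightarrow> u \<in> acl E pures"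
proof -
  assume "u \<in> carrier E"
  then obtain f where f: "f \<in> free" "u = cls f" by (auto simp: E_carrier)
  have "cls f \<in> acl E pures" using f(1)
  proof (induction rule: tens_free_induct)
    case zero then show ?case using acl.zero[of E] by (simp add: E_zero)
  next
    case (delta a b)
    then show ?case by (intro acl.base) (auto simp: pures_def pure_def)
  next
    case (add f g)
    then show ?case using acl.add[OF add(3,4)] by (simp add: cls_add)
  next
    case (neg f)
    show ?case unfolding cls_neg[OF neg(1)]
    proof (rule E.acl_neg[OF pures_closed _ neg(2)])
      fix a assume "a \<in> pures"
      then show "\<ominus>\<^bsub>E\<^esub> a \<in> acl E pures"
        using A.a_inv_closed by (fastforce simp: pures_def pure_neg_left[symmetric] intro!: acl.base)
    qed
  qed
  then show ?thesis using f by simp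
qed

section \<open>The universal property for balanced maps\<close>

definition lift :: "('c, 'n) ring_scheme \<Rightarrow> ('a \<Rightarrow> 'b \<Rightarrow> 'c) \<Rightarrow> ('a \<times> 'b \<Rightarrow> int) \<Rightarrow> 'c" where
  "lift G F f = finsum G (\<lambda>p. add_pow G (f p) (F (fst p) (snd p))) {p. f p \<noteq> 0}"

definition balanced :: "('c, 'n) ring_scheme \<Rightarrow> ('a \<Rightarrow> 'b \<Rightarrow> 'c) \<Rightarrow> bool" where
  "balanced G F \<longleftrightarrow> (\<forall>a\<in>carrier A. addhom B G (F a)) \<and> (\<forall>b\<in>carrier B. addhom A G (\<lambda>a. F a b)) \<and>
     (\<forall>c\<in>carrier K. \<forall>a\<in>carrier A. \<forall>b\<in>carrier B. F (phiA c \<otimes>\<^bsub>A\<^esub> a) b = F a (phiB c \<otimes>\<^bsub>B\<^esub> b))"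

context
  fixes G :: "('c, 'n) ring_scheme" and F
  assumes G: "abelian_group G" and F: "balanced G F"
begin

interpretation G: abelian_group G by (rule G)

lemma balanced_closed: "a \<in> carrier A \<Longrightarrow> b \<in> carrier B \<Longrightarrow> F a b \<in> carrier G"
  using F by (auto simp: balanced_def addhom_def)

lemma lift_expand:
  assumes "f \<in> free" "finite P" "{p. f p \<noteq> 0} \<subseteq> P" "P \<subseteq> carrier A \<times> carrier B"
  shows "lift G F f = finsum G (\<lambda>p. add_pow G (f p) (F (fst p) (snd p))) P"
  unfolding lift_def using assms
  by (intro G.add.finprod_mono_neutral_cong_left)
    (auto simp: add_pow_def intro!: group.int_pow_closed[OF G.a_group, simplified] balanced_closed)

lemma lift_add:
  assumes "f \<in> free" "g \<in> free"
  shows "lift G F (\<lambda>p. f p + g p) = lift G F f \<oplus>\<^bsub>G\<^esub> lift G F g"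
proof -
  let ?P = "{p. f p \<noteq> 0} \<union> {p. g p \<noteq> 0}"
  have P: "finite ?P" "?P \<subseteq> carrier A \<times> carrier B" using assms by (auto simp: tens_free_def)
  have F_closed: "F (fst p) (snd p) \<in> carrier G" if "p \<in> ?P" for p
    using P that by (auto intro!: balanced_closed)
  have "lift G F (\<lambda>p. f p + g p) = finsum G (\<lambda>p. add_pow G (f p + g p) (F (fst p) (snd p))) ?P"
    using P by (intro lift_expand add_in_free assms) auto
  also have "\<dots> = finsum G (\<lambda>p. add_pow G (f p) (F (fst p) (snd p)) \<oplus>\<^bsub>G\<^esub> add_pow G (g p) (F (fst p) (snd p))) ?P"
    using F_closed by (intro G.finsum_cong' refl) (auto simp: G.add.int_pow_mult)
  also have "\<dots> = finsum G (\<lambda>p. add_pow G (f p) (F (fst p) (snd p))) ?P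
      \<oplus>\<^bsub>G\<^esub> finsum G (\<lambda>p. add_pow G (g p) (F (fst p) (snd p))) ?P"
    using F_closed by (intro G.finsum_addf) auto
  also have "\<dots> = lift G F f \<oplus>\<^bsub>G\<^esub> lift G F g"
    using P assms by (intro arg_cong2[where f = "add G"] lift_expand[symmetric]) auto
  finally show ?thesis .
qed

lemma lift_delta:
  assumes "a \<in> carrier A" "b \<in> carrier B"
  shows "lift G F (delta (a, b)) = F a b"
  using assms
  using lift_expand[OF delta_in_free[OF assms], of "{(a, b)}"] by (simp add: delta_def balanced_closed)

lemma lift_zero: "lift G F (\<lambda>_. 0) = \<zero>\<^bsub>G\<^esub>"
  by (simp add: lift_def)

lemma lift_closed: "f \<in> free \<Longrightarrow> lift G F f \<in> carrier G"
  unfolding lift_def by (auto simp: tens_free_def intro!: G.finsum_closed balanced_closed)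

lemma lift_neg:
  assumes "f \<in> free"
  shows "lift G F (\<lambda>p. - f p) = \<ominus>\<^bsub>G\<^esub> lift G F f"
  using lift_add[OF neg_in_free[OF assms] assms] lift_zero lift_closed assms neg_in_free
  by (intro G.minus_equality[symmetric]) auto

lemma lift_diff:
  assumes "f \<in> free" "g \<in> free"
  shows "lift G F (\<lambda>p. f p - g p) = lift G F f \<ominus>\<^bsub>G\<^esub> lift G F g"
  using lift_add[OF assms(1) neg_in_free[OF assms(2)]] by (simp add: lift_neg[OF assms(2)] a_minus_def)

lemma lift_rel: "f \<in> rel \<Longrightarrow> lift G F f = \<zero>\<^bsub>G\<^esub>"
proof (induction rule: tens_rel.induct)
  case (addl a a' b)
  then have "F (a \<oplus>\<^bsub>A\<^esub> a') b = F a b \<oplus>\<^bsub>G\<^esub> F a' b"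
    using F by (simp add: balanced_def addhom_def)
  moreover have "F a b \<oplus>\<^bsub>G\<^esub> F a' b \<ominus>\<^bsub>G\<^esub> F a b \<ominus>\<^bsub>G\<^esub> F a' b = \<zero>\<^bsub>G\<^esub>"
    using addl balanced_closed
    by (metis G.a_assoc G.a_comm G.a_inv_closed G.add.m_closed G.r_neg G.r_neg1 a_minus_def)
  ultimately show ?case using addl by (simp add: lift_diff diff_in_free delta_in_free lift_delta)
next
  case (addr a b b')
  then have "F a (b \<oplus>\<^bsub>B\<^esub> b') = F a b \<oplus>\<^bsub>G\<^esub> F a b'"
    using F by (simp add: balanced_def addhom_def)
  moreover have "F a b \<oplus>\<^bsub>G\<^esub> F a b' \<ominus>\<^bsub>G\<^esub> F a b \<ominus>\<^bsub>G\<^esub> F a b' = \<zero>\<^bsub>G\<^esub>"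
    using addr balanced_closed
    by (metis G.a_assoc G.a_comm G.a_inv_closed G.add.m_closed G.r_neg G.r_neg1 a_minus_def)
  ultimately show ?case using addr by (simp add: lift_diff diff_in_free delta_in_free lift_delta)
next
  case (bal c a b)
  then show ?case using F balanced_closed
    by (simp add: lift_diff diff_in_free delta_in_free lift_delta phiA_closed phiB_closed balanced_def a_minus_def G.r_neg)
qed (auto simp: lift_zero lift_add lift_neg rel_free)

lemma lift_cls:
  assumes "f \<in> free" shows "lift G F (tens_rep (cls f)) = lift G F f"
  using lift_rel[OF rep_cls(2)[OF assms]] lift_diff[OF rep_cls(1)[OF assms] assms]
    lift_closed[OF assms] lift_closed[OF rep_cls(1)[OF assms]]
  by (metis G.a_inv_closed G.minus_equality G.minus_minus a_minus_def)

text \<open>Evaluating \<open>lift\<close> at the chosen representative is harmless because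
  relations are sent to zero. Only existence is stated; where two maps have to be compared,
  \<open>addhom_eq\<close> and \<open>tensor_generated\<close> give uniqueness.\<close>

lemma tensor_universal:
  "\<exists>h. addhom E G h \<and> (\<forall>a\<in>carrier A. \<forall>b\<in>carrier B. h (pure a b) = F a b)"
proof (intro exI conjI ballI)
  let ?h = "\<lambda>u. lift G F (tens_rep u)"
  show "addhom E G ?h"
    by (auto simp: addhom_def E_carrier lift_cls lift_closed cls_add add_in_free lift_add)
  show "?h (pure a b) = F a b" if "a \<in> carrier A" "b \<in> carrier B" for a b
    using that by (simp add: pure_def lift_cls delta_in_free lift_delta)
qed

end

end

section \<open>Free left modules on monomials\<close>

lemma addhom_id: "addhom G G (\<lambda>a. a)"
  by (auto simp: addhom_def)

lemma addhom_comp: "addhom G H f \<Longrightarrow> addhom H J g \<Longrightarrow> addhom G J (\<lambda>a. g (f a))"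
  by (auto simp: addhom_def Pi_iff)

lemma (in ring) addhom_l_mult: "a \<in> carrier R \<Longrightarrow> addhom R R (\<lambda>b. a \<otimes> b)"
  by (auto simp: addhom_def r_distr)

lemma (in ring) addhom_r_mult: "a \<in> carrier R \<Longrightarrow> addhom R R (\<lambda>b. b \<otimes> a)"
  by (auto simp: addhom_def l_distr)

lemma (in abelian_group) finsum_in_acl:
  assumes "Y \<subseteq> carrier G" "\<And>i. i \<in> F \<Longrightarrow> f i \<in> acl G Y"
  shows "finsum G f F \<in> acl G Y"
  using assms(2)
proof (induction F rule: infinite_finite_induct)
  case (insert i F)
  have "f \<in> F \<rightarrow> carrier G" "f i \<in> carrier G"
    using insert.prems acl_closed[OF assms(1)] by auto
  then show ?case using insert acl.add[of "f i" G Y] by simp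
qed (auto intro: acl.zero)

lemma expo_zero: "(\<lambda>_. 0) \<in> expo n"
  by (simp add: expo_def)

definition unit_expo :: "nat \<Rightarrow> nat \<Rightarrow> nat" where
  "unit_expo i = (\<lambda>_. 0)(i := 1)"

lemma unit_expo_in: "i < n \<Longrightarrow> unit_expo i \<in> expo n"
  by (auto simp: expo_def unit_expo_def)

lemma unit_expo_neq_zero: "unit_expo i \<noteq> (\<lambda>_. 0)"
  by (auto simp: unit_expo_def fun_eq_iff)

text \<open>\<open>mon\<close> with its interval of indices replaced by a list, so that splitting,
  reversing and shifting the variables become list operations.\<close>

definition monl :: "('a, 'm) ring_scheme \<Rightarrow> nat list \<Rightarrow> (nat \<Rightarrow> 'a) \<Rightarrow> (nat \<Rightarrow> nat) \<Rightarrow> 'a" where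
  "monl A xs x \<alpha> = foldr (\<lambda>i acc. (x i [^]\<^bsub>A\<^esub> \<alpha> i) \<otimes>\<^bsub>A\<^esub> acc) xs \<one>\<^bsub>A\<^esub>"

lemma mon_monl: "mon A n x \<alpha> = monl A [0..<n] x \<alpha>"
  by (simp add: mon_def monl_def)

lemma monl_Nil: "monl A [] x \<alpha> = \<one>\<^bsub>A\<^esub>"
  and monl_Cons: "monl A (i # xs) x \<alpha> = (x i [^]\<^bsub>A\<^esub> \<alpha> i) \<otimes>\<^bsub>A\<^esub> monl A xs x \<alpha>"
  by (simp_all add: monl_def)

context ring
begin

lemma monl_closed: "(\<And>i. i \<in> set xs \<Longrightarrow> x i \<in> carrier R) \<Longrightarrow> monl R xs x \<alpha> \<in> carrier R"
  by (induction xs) (auto simp: monl_Nil monl_Cons)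

lemma monl_append:
  assumes "\<And>i. i \<in> set xs \<union> set ys \<Longrightarrow> x i \<in> carrier R"
  shows "monl R (xs @ ys) x \<alpha> = monl R xs x \<alpha> \<otimes> monl R ys x \<alpha>"
  using assms by (induction xs) (auto simp: monl_Nil monl_Cons monl_closed m_assoc)

lemma monl_trivial: "(\<And>i. i \<in> set xs \<Longrightarrow> \<alpha> i = 0) \<Longrightarrow> monl R xs x \<alpha> = \<one>"
  by (induction xs) (auto simp: monl_Nil monl_Cons)

lemma monl_cong:
  "(\<And>i. i \<in> set xs \<Longrightarrow> x i [^] \<alpha> i = y i [^] \<beta> i) \<Longrightarrow> monl R xs x \<alpha> = monl R xs y \<beta>"
  by (induction xs) (auto simp: monl_Nil monl_Cons)

end

text \<open>Freeness is left to a separate locale: the opposite ring and the tensor product use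
  these notions while their freeness is still being proved.\<close>

locale monomials = ring A for A :: "'a ring" (structure) +
  fixes S :: "'a set" and n :: nat and x :: "nat \<Rightarrow> 'a"
  assumes S_subring: "subring S A" and x_closed: "\<And>i. i < n \<Longrightarrow> x i \<in> carrier A"
begin

abbreviation "M \<equiv> mon A n x"

definition terms :: "'a set" where
  "terms = {s \<otimes> M \<alpha> | s \<alpha>. s \<in> S \<and> \<alpha> \<in> expo n}"

lemma S_closed: "s \<in> S \<Longrightarrow> s \<in> carrier A"
  using subringE(1)[OF S_subring] by blast

lemmas S_zero = subringE(2)[OF S_subring]
lemmas S_one = subringE(3)[OF S_subring]
lemmas S_neg = subringE(5)[OF S_subring]
lemmas S_mult = subringE(6)[OF S_subring]
lemmas S_add = subringE(7)[OF S_subring]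

lemma mon_closed: "M \<alpha> \<in> carrier A"
  unfolding mon_monl by (rule monl_closed) (simp add: x_closed)

lemma term_closed: "s \<in> S \<Longrightarrow> s \<otimes> M \<alpha> \<in> carrier A"
  by (simp add: S_closed mon_closed)

lemma terms_closed: "terms \<subseteq> carrier A"
  by (auto simp: terms_def term_closed)

text \<open>A variable may be multiplied on from the left without any commutation relation when no
  variable of smaller index occurs. This is the only way in which monomials are built up
  below.\<close>

lemma mon_step:
  assumes "i < n" "\<And>j. j < i \<Longrightarrow> \<beta> j = 0"
  shows "M (\<beta>(i := Suc (\<beta> i))) = x i \<otimes> M \<beta>"
proof -
  have split: "[0..<n] = [0..<i] @ i # [Suc i..<n]"
    using assms(1) upt_add_eq_append[of 0 i "n - i"] by (simp add: upt_conv_Cons)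
  let ?t = "monl A [Suc i..<n] x \<beta>"
  have t: "?t \<in> carrier A" by (rule monl_closed) (simp add: x_closed)
  have xi: "x i \<in> carrier A" using assms x_closed by blast
  have *: "M \<gamma> = x i [^] \<gamma> i \<otimes> monl A [Suc i..<n] x \<gamma>" if "\<And>j. j < i \<Longrightarrow> \<gamma> j = 0" for \<gamma>
  proof -
    have "M \<gamma> = monl A [0..<i] x \<gamma> \<otimes> monl A (i # [Suc i..<n]) x \<gamma>"
      unfolding mon_monl split using assms(1) by (intro monl_append) (auto simp: x_closed)
    also have "monl A [0..<i] x \<gamma> = \<one>" by (rule monl_trivial) (simp add: that)
    moreover have "monl A [Suc i..<n] x \<gamma> \<in> carrier A"
      by (rule monl_closed) (simp add: x_closed)
    ultimately show ?thesis using xi by (simp add: monl_Cons)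
  qed
  have "monl A [Suc i..<n] x (\<beta>(i := Suc (\<beta> i))) = ?t"
    by (rule monl_cong) simp
  then have "M (\<beta>(i := Suc (\<beta> i))) = x i [^] Suc (\<beta> i) \<otimes> ?t"
    using *[of "\<beta>(i := Suc (\<beta> i))"] assms(2) by simp
  also have "\<dots> = x i \<otimes> (x i [^] \<beta> i \<otimes> ?t)"
    unfolding nat_pow_Suc2[OF xi] using xi t by (simp add: m_assoc)
  finally show ?thesis using *[of \<beta>] assms(2) by simp
qed

lemma mon_zero: "M (\<lambda>_. 0) = \<one>"
  unfolding mon_monl by (rule monl_trivial) simp

lemma mon_unit: "i < n \<Longrightarrow> M (unit_expo i) = x i"
  using mon_step[of i "\<lambda>_. 0"] by (simp add: unit_expo_def mon_zero x_closed)

lemma coeffs_in: "c \<in> coeffs A S n \<Longrightarrow> c \<alpha> \<in> S"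
  by (simp add: coeffs_def)

lemma lin_comb_expand:
  assumes "c \<in> coeffs A S n" "finite F" "{\<alpha>. c \<alpha> \<noteq> \<zero>} \<subseteq> F"
  shows "lin_comb A n x c = finsum A (\<lambda>\<alpha>. c \<alpha> \<otimes> M \<alpha>) F"
  unfolding lin_comb_def
  using assms by (intro add.finprod_mono_neutral_cong_left) (auto simp: coeffs_in term_closed mon_closed)

lemma coeffs_add:
  assumes "c \<in> coeffs A S n" "d \<in> coeffs A S n"
  shows "(\<lambda>\<alpha>. c \<alpha> \<oplus> d \<alpha>) \<in> coeffs A S n"
    and "lin_comb A n x (\<lambda>\<alpha>. c \<alpha> \<oplus> d \<alpha>) = lin_comb A n x c \<oplus> lin_comb A n x d"
proof -
  let ?F = "{\<alpha>. c \<alpha> \<noteq> \<zero>} \<union> {\<alpha>. d \<alpha> \<noteq> \<zero>}"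
  have F: "finite ?F" "{\<alpha>. c \<alpha> \<oplus> d \<alpha> \<noteq> \<zero>} \<subseteq> ?F" using assms by (auto simp: coeffs_def)
  then have "finite {\<alpha>. c \<alpha> \<oplus> d \<alpha> \<noteq> \<zero>}" by (rule rev_finite_subset)
  then show cd: "(\<lambda>\<alpha>. c \<alpha> \<oplus> d \<alpha>) \<in> coeffs A S n"
    using assms by (auto simp: coeffs_def S_add)
  have "lin_comb A n x (\<lambda>\<alpha>. c \<alpha> \<oplus> d \<alpha>) = finsum A (\<lambda>\<alpha>. c \<alpha> \<otimes> M \<alpha> \<oplus> d \<alpha> \<otimes> M \<alpha>) ?F"
    using lin_comb_expand[OF cd F]
    by (simp add: l_distr mon_closed S_closed coeffs_in[OF assms(1)] coeffs_in[OF assms(2)])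
  also have "\<dots> = finsum A (\<lambda>\<alpha>. c \<alpha> \<otimes> M \<alpha>) ?F \<oplus> finsum A (\<lambda>\<alpha>. d \<alpha> \<otimes> M \<alpha>) ?F"
    by (rule finsum_addf) (auto simp: term_closed coeffs_in[OF assms(1)] coeffs_in[OF assms(2)])
  also have "\<dots> = lin_comb A n x c \<oplus> lin_comb A n x d"
    using lin_comb_expand[OF assms(1) F(1)] lin_comb_expand[OF assms(2) F(1)] by simp
  finally show "lin_comb A n x (\<lambda>\<alpha>. c \<alpha> \<oplus> d \<alpha>) = lin_comb A n x c \<oplus> lin_comb A n x d" .
qed

lemma coeffs_single:
  assumes "s \<in> S" "\<alpha> \<in> expo n"
  shows "(\<lambda>_. \<zero>)(\<alpha> := s) \<in> coeffs A S n"
    and "lin_comb A n x ((\<lambda>_. \<zero>)(\<alpha> := s)) = s \<otimes> M \<alpha>"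
proof -
  have sub: "{\<beta>. ((\<lambda>_. \<zero>)(\<alpha> := s)) \<beta> \<noteq> \<zero>} \<subseteq> {\<alpha>}" by auto
  then have fin: "finite {\<beta>. ((\<lambda>_. \<zero>)(\<alpha> := s)) \<beta> \<noteq> \<zero>}" by (rule finite_subset) simp
  then show c: "(\<lambda>_. \<zero>)(\<alpha> := s) \<in> coeffs A S n"
    using assms by (auto simp: coeffs_def S_zero)
  have "lin_comb A n x ((\<lambda>_. \<zero>)(\<alpha> := s)) = finsum A (\<lambda>\<beta>. ((\<lambda>_. \<zero>)(\<alpha> := s)) \<beta> \<otimes> M \<beta>) {\<alpha>}"
    by (rule lin_comb_expand[OF c _ sub]) simp
  also have "\<dots> = s \<otimes> M \<alpha>" using assms by (simp add: S_closed mon_closed)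
  finally show "lin_comb A n x ((\<lambda>_. \<zero>)(\<alpha> := s)) = s \<otimes> M \<alpha>" .
qed

lemma coeffs_zero: "(\<lambda>_. \<zero>) \<in> coeffs A S n" "lin_comb A n x (\<lambda>_. \<zero>) = \<zero>"
  by (auto simp: coeffs_def lin_comb_def S_zero)

lemma acl_terms_lin_comb:
  "a \<in> acl A terms \<Longrightarrow> \<exists>c\<in>coeffs A S n. a = lin_comb A n x c"
proof (induction rule: acl.induct)
  case (base a)
  then obtain s \<alpha> where "a = s \<otimes> M \<alpha>" "s \<in> S" "\<alpha> \<in> expo n" by (auto simp: terms_def)
  then show ?case using coeffs_single by metis
next
  case zero
  then show ?case using coeffs_zero by metis
next
  case (add a b)
  then show ?case using coeffs_add by metis
qed

text \<open>The remainder is kept as a member of a closure, so that an additive map can be evaluated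
  on it term by term.\<close>

lemma lin_comb_split:
  assumes "c \<in> coeffs A S n"
  shows "\<exists>r \<in> acl A {c \<beta> \<otimes> M \<beta> | \<beta>. \<beta> \<in> expo n \<and> \<beta> \<noteq> \<alpha> \<and> c \<beta> \<noteq> \<zero>}.
    lin_comb A n x c = c \<alpha> \<otimes> M \<alpha> \<oplus> r"
proof -
  let ?F = "{\<beta>. c \<beta> \<noteq> \<zero>} - {\<alpha>}"
  let ?r = "finsum A (\<lambda>\<beta>. c \<beta> \<otimes> M \<beta>) ?F"
  have fin: "finite ?F" using assms by (simp add: coeffs_def)
  have supp: "\<beta> \<in> expo n" if "c \<beta> \<noteq> \<zero>" for \<beta>
    using that assms by (auto simp: coeffs_def)
  have "lin_comb A n x c = finsum A (\<lambda>\<alpha>. c \<alpha> \<otimes> M \<alpha>) (insert \<alpha> ?F)"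
    using fin by (intro lin_comb_expand assms) auto
  also have "\<dots> = c \<alpha> \<otimes> M \<alpha> \<oplus> ?r"
    using fin by (intro finsum_insert) (auto simp: term_closed coeffs_in[OF assms])
  finally have "lin_comb A n x c = c \<alpha> \<otimes> M \<alpha> \<oplus> ?r" .
  moreover have "?r \<in> acl A {c \<beta> \<otimes> M \<beta> | \<beta>. \<beta> \<in> expo n \<and> \<beta> \<noteq> \<alpha> \<and> c \<beta> \<noteq> \<zero>}"
    by (rule finsum_in_acl) (auto simp: term_closed coeffs_in[OF assms] intro!: acl.base supp)
  ultimately show ?thesis by blast
qed

lemma lin_comb_in_acl:
  assumes "c \<in> coeffs A S n"
  shows "lin_comb A n x c \<in> acl A terms"
proof -
  have "c \<beta> \<otimes> M \<beta> \<in> acl A terms" if "c \<beta> \<noteq> \<zero>" for \<beta>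
    using that assms by (intro acl.base) (auto simp: terms_def coeffs_def)
  then show ?thesis
    unfolding lin_comb_def by (intro finsum_in_acl terms_closed) auto
qed

lemma coeffs_neg:
  assumes "c \<in> coeffs A S n"
  shows "(\<lambda>\<alpha>. \<ominus> c \<alpha>) \<in> coeffs A S n"
proof -
  have "{\<alpha>. \<ominus> c \<alpha> \<noteq> \<zero>} \<subseteq> {\<alpha>. c \<alpha> \<noteq> \<zero>}" by auto
  then have "finite {\<alpha>. \<ominus> c \<alpha> \<noteq> \<zero>}" by (rule finite_subset) (use assms in \<open>simp add: coeffs_def\<close>)
  then show ?thesis using assms by (auto simp: coeffs_def S_neg)
qed

text \<open>Uniqueness of coefficients reduces to the zero element, since the difference of two
  expansions of \<open>a\<close> is a vanishing combination.\<close>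

lemma freeI:
  assumes gen: "\<And>a. a \<in> carrier A \<Longrightarrow> a \<in> acl A terms"
    and indep: "\<And>c. c \<in> coeffs A S n \<Longrightarrow> lin_comb A n x c = \<zero> \<Longrightarrow> c = (\<lambda>_. \<zero>)"
  shows "\<forall>a\<in>carrier A. \<exists>!c. c \<in> coeffs A S n \<and> a = lin_comb A n x c"
proof
  fix a assume "a \<in> carrier A"
  then obtain c where c: "c \<in> coeffs A S n" "a = lin_comb A n x c"
    using acl_terms_lin_comb[OF gen] by blast
  show "\<exists>!c. c \<in> coeffs A S n \<and> a = lin_comb A n x c"
  proof (intro ex1I[of _ c] conjI c)
    fix d assume d: "d \<in> coeffs A S n \<and> a = lin_comb A n x d"
    let ?c = "\<lambda>\<alpha>. \<ominus> c \<alpha>"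
    have nc: "?c \<in> coeffs A S n" by (rule coeffs_neg[OF c(1)])
    have closed: "c \<alpha> \<in> carrier A" "d \<alpha> \<in> carrier A" for \<alpha>
      using c d coeffs_in S_closed by auto
    have zero: "lin_comb A n x c \<oplus> lin_comb A n x ?c = \<zero>"
      using coeffs_add(2)[OF c(1) nc] closed by (simp add: r_neg coeffs_zero)
    have "(\<lambda>\<alpha>. d \<alpha> \<oplus> ?c \<alpha>) = (\<lambda>_. \<zero>)"
    proof (rule indep)
      show "(\<lambda>\<alpha>. d \<alpha> \<oplus> ?c \<alpha>) \<in> coeffs A S n" using coeffs_add(1)[OF _ nc] d by blast
      have "lin_comb A n x (\<lambda>\<alpha>. d \<alpha> \<oplus> ?c \<alpha>) = lin_comb A n x d \<oplus> lin_comb A n x ?c"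
        using coeffs_add(2)[OF _ nc] d by blast
      then show "lin_comb A n x (\<lambda>\<alpha>. d \<alpha> \<oplus> ?c \<alpha>) = \<zero>" using d c(2) zero by metis
    qed
    then have "d \<alpha> \<oplus> \<ominus> c \<alpha> = \<zero>" for \<alpha> by metis
    then show "d = c"
      using closed by (intro ext) (metis a_inv_closed minus_equality minus_minus)
  qed
qed

text \<open>A dual family of additive functionals proves independence. Their values may lie in any
  abelian group \<open>G\<close>, and the one for \<alpha> need only detect whether the \<alpha>-th
  coefficient is zero; for the tensor product they take values in the small tensor product instead
  of its image.\<close>

lemma independentI:
  assumes coord: "\<And>\<alpha>. \<alpha> \<in> expo n \<Longrightarrow> \<exists>h. addhom A G h \<and> (\<forall>s\<in>S. h (s \<otimes> M \<alpha>) = \<zero>\<^bsub>G\<^esub> \<longrightarrow> s = \<zero>) \<and>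
      (\<forall>s\<in>S. \<forall>\<beta>\<in>expo n. \<beta> \<noteq> \<alpha> \<longrightarrow> h (s \<otimes> M \<beta>) = \<zero>\<^bsub>G\<^esub>)"
    and G: "abelian_group G" and c: "c \<in> coeffs A S n" and zero: "lin_comb A n x c = \<zero>"
  shows "c = (\<lambda>_. \<zero>)"
proof
  fix \<alpha>
  interpret G: abelian_group G by fact
  show "c \<alpha> = \<zero>"
  proof (cases "\<alpha> \<in> expo n")
    case True
    from coord[OF True] obtain h where h: "addhom A G h" "\<And>s. s \<in> S \<Longrightarrow> h (s \<otimes> M \<alpha>) = \<zero>\<^bsub>G\<^esub> \<Longrightarrow> s = \<zero>"
      "\<And>s \<beta>. s \<in> S \<Longrightarrow> \<beta> \<in> expo n \<Longrightarrow> \<beta> \<noteq> \<alpha> \<Longrightarrow> h (s \<otimes> M \<beta>) = \<zero>\<^bsub>G\<^esub>" by blast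
    let ?Y = "{c \<beta> \<otimes> M \<beta> | \<beta>. \<beta> \<in> expo n \<and> \<beta> \<noteq> \<alpha> \<and> c \<beta> \<noteq> \<zero>}"
    have Y: "?Y \<subseteq> carrier A" by (auto simp: term_closed coeffs_in[OF c])
    from lin_comb_split[OF c, of \<alpha>] obtain r where r: "r \<in> acl A ?Y" "\<zero> = c \<alpha> \<otimes> M \<alpha> \<oplus> r"
      using zero by auto
    have "h r = \<zero>\<^bsub>G\<^esub>"
      by (rule addhom_eq[OF abelian_group_axioms G h(1) _ Y _ r(1), of "\<lambda>_. \<zero>\<^bsub>G\<^esub>"])
        (use h(3) coeffs_in[OF c] in \<open>auto simp: addhom_def\<close>)
    moreover have "h \<zero> = \<zero>\<^bsub>G\<^esub>" by (rule addhom_zero[OF abelian_group_axioms G h(1)])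
    moreover have "r \<in> carrier A" by (rule acl_closed[OF Y r(1)])
    ultimately have "h (c \<alpha> \<otimes> M \<alpha>) = \<zero>\<^bsub>G\<^esub>"
      using r(2) addhom_add[OF h(1), of "c \<alpha> \<otimes> M \<alpha>" r] addhom_closed[OF h(1), of "c \<alpha> \<otimes> M \<alpha>"]
        term_closed coeffs_in[OF c] by auto
    then show ?thesis using h(2) coeffs_in[OF c] by blast
  next
    case False
    then show ?thesis using c by (auto simp: coeffs_def)
  qed
qed

text \<open>The module R + Rx_1 + ... + Rx_n of condition (iv). As a closure it is easily seen to be
  stable under sums, negation and left multiples; \<open>low_iff\<close> recovers the form with
  explicit coefficients.\<close>

definition low :: "'a set" where
  "low = acl A (S \<union> {s \<otimes> x l | s l. s \<in> S \<and> l < n})"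

lemma low_gens_closed: "S \<union> {s \<otimes> x l | s l. s \<in> S \<and> l < n} \<subseteq> carrier A"
  by (auto simp: S_closed x_closed)

lemma low_S: "s \<in> S \<Longrightarrow> s \<in> low"
  and low_x: "s \<in> S \<Longrightarrow> l < n \<Longrightarrow> s \<otimes> x l \<in> low"
  and low_add: "a \<in> low \<Longrightarrow> b \<in> low \<Longrightarrow> a \<oplus> b \<in> low"
  by (auto simp: low_def intro: acl.intros)

lemma low_closed: "a \<in> low \<Longrightarrow> a \<in> carrier A"
  unfolding low_def by (rule acl_closed[OF low_gens_closed])

lemma low_neg: "a \<in> low \<Longrightarrow> \<ominus> a \<in> low"
  unfolding low_def
proof (rule acl_neg[OF low_gens_closed])
  fix a assume "a \<in> S \<union> {s \<otimes> x l | s l. s \<in> S \<and> l < n}"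
  then have "\<ominus> a \<in> low"
    by (auto simp: low_S S_neg l_minus[symmetric] S_closed x_closed low_x)
  then show "\<ominus> a \<in> acl A (S \<union> {s \<otimes> x l | s l. s \<in> S \<and> l < n})" by (simp add: low_def)
qed

lemma low_lmult:
  assumes "s \<in> S" "a \<in> low" shows "s \<otimes> a \<in> low"
proof -
  have "s \<otimes> b \<in> low" if "b \<in> S \<union> {s \<otimes> x l | s l. s \<in> S \<and> l < n}" for b
  proof -
    consider "b \<in> S" | t l where "b = t \<otimes> x l" "t \<in> S" "l < n" using \<open>b \<in> _\<close> by auto
    then show ?thesis
    proof cases
      case 2
      then have "s \<otimes> b = (s \<otimes> t) \<otimes> x l" using assms(1) by (simp add: m_assoc S_closed x_closed)
      then show ?thesis using 2 assms(1) by (simp add: low_x S_mult)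
    qed (simp add: low_S S_mult assms(1))
  qed
  then show ?thesis
    using addhom_acl[OF abelian_group_axioms abelian_group_axioms addhom_l_mult[OF S_closed[OF assms(1)]]
        low_gens_closed] assms(2) unfolding low_def by blast
qed

lemma low_iff:
  "a \<in> low \<longleftrightarrow> (\<exists>r0\<in>S. \<exists>r. (\<forall>l. r l \<in> S) \<and> a = r0 \<oplus> finsum A (\<lambda>l. r l \<otimes> x l) {..<n})"
proof -
  have fin: "finsum A (\<lambda>l. r l \<otimes> x l) {..<n} \<in> low" if "\<forall>l. r l \<in> S" for r
    unfolding low_def using that by (intro finsum_in_acl low_gens_closed acl.base) auto
  have "\<exists>r0\<in>S. \<exists>r. (\<forall>l. r l \<in> S) \<and> a = r0 \<oplus> finsum A (\<lambda>l. r l \<otimes> x l) {..<n}" if "a \<in> low" for a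
    using that unfolding low_def
  proof (induction rule: acl.induct)
    case (base a)
    then consider "a \<in> S" | s l where "a = s \<otimes> x l" "s \<in> S" "l < n" by auto
    then show ?case
    proof cases
      case 1
      have "finsum A (\<lambda>l. \<zero> \<otimes> x l) {..<n} = \<zero>"
        by (rule add.finprod_one_eqI) (simp add: x_closed)
      then show ?thesis using 1 S_zero S_closed by (intro bexI[of _ a] exI[of _ "\<lambda>_. \<zero>"]) auto
    next
      case 2
      have "finsum A (\<lambda>k. ((\<lambda>_. \<zero>)(l := s)) k \<otimes> x k) {..<n} = finsum A (\<lambda>k. if l = k then s \<otimes> x k else \<zero>) {..<n}"
        using 2 by (intro add.finprod_cong') (auto simp: x_closed S_closed)
      also have "\<dots> = s \<otimes> x l"
        using 2 by (intro add.finprod_singleton[of l "{..<n}" "\<lambda>k. s \<otimes> x k"]) (auto simp: x_closed S_closed)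
      finally show ?thesis using 2 S_zero S_closed x_closed
        by (intro bexI[of _ \<zero>] exI[of _ "(\<lambda>_. \<zero>)(l := s)"]) auto
    qed
  next
    case zero
    have "finsum A (\<lambda>l. \<zero> \<otimes> x l) {..<n} = \<zero>"
      by (rule add.finprod_one_eqI) (simp add: x_closed)
    then show ?case using S_zero by (intro bexI[of _ \<zero>] exI[of _ "\<lambda>_. \<zero>"]) auto
  next
    case (add a b)
    then obtain r0 r q0 q where r: "r0 \<in> S" "\<forall>l. r l \<in> S" "a = r0 \<oplus> finsum A (\<lambda>l. r l \<otimes> x l) {..<n}"
      "q0 \<in> S" "\<forall>l. q l \<in> S" "b = q0 \<oplus> finsum A (\<lambda>l. q l \<otimes> x l) {..<n}" by blast
    have "finsum A (\<lambda>l. (r l \<oplus> q l) \<otimes> x l) {..<n} = finsum A (\<lambda>l. r l \<otimes> x l \<oplus> q l \<otimes> x l) {..<n}"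
      using r by (intro add.finprod_cong') (auto simp: x_closed S_closed l_distr)
    also have "\<dots> = finsum A (\<lambda>l. r l \<otimes> x l) {..<n} \<oplus> finsum A (\<lambda>l. q l \<otimes> x l) {..<n}"
      using r by (intro finsum_addf) (auto simp: x_closed S_closed)
    finally have sum: "finsum A (\<lambda>l. (r l \<oplus> q l) \<otimes> x l) {..<n} =
      finsum A (\<lambda>l. r l \<otimes> x l) {..<n} \<oplus> finsum A (\<lambda>l. q l \<otimes> x l) {..<n}" .
    have "a \<oplus> b = (r0 \<oplus> q0) \<oplus> finsum A (\<lambda>l. (r l \<oplus> q l) \<otimes> x l) {..<n}"
      unfolding sum r(3,6) using r low_closed[OF fin[OF r(2)]] low_closed[OF fin[OF r(5)]]
      by (simp add: S_closed a_ac)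
    then show ?case using r S_add
      by (intro bexI[of _ "r0 \<oplus> q0"] exI[of _ "\<lambda>l. r l \<oplus> q l"]) auto
  qed
  then show ?thesis using fin low_add low_S by blast
qed

lemma pbw_rel_iff:
  "pbw_rel A S n x i j c \<longleftrightarrow> x j \<otimes> x i \<ominus> c \<otimes> x i \<otimes> x j \<in> low"
  unfolding pbw_rel_def low_iff ..

end

section \<open>Coordinates with respect to the monomial basis\<close>

locale free_monomials = monomials +
  assumes free: "\<forall>a\<in>carrier A. \<exists>!c. c \<in> coeffs A S n \<and> a = lin_comb A n x c"
begin

lemma generated: "a \<in> carrier A \<Longrightarrow> a \<in> acl A terms"
  using free lin_comb_in_acl by blast

definition coef :: "(nat \<Rightarrow> nat) \<Rightarrow> 'a \<Rightarrow> 'a" where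
  "coef \<alpha> a = (THE c. c \<in> coeffs A S n \<and> a = lin_comb A n x c) \<alpha>"

lemma lin_comb_closed: "c \<in> coeffs A S n \<Longrightarrow> lin_comb A n x c \<in> carrier A"
  by (rule acl_closed[OF terms_closed lin_comb_in_acl])

lemma coef_lin_comb: "c \<in> coeffs A S n \<Longrightarrow> coef \<alpha> (lin_comb A n x c) = c \<alpha>"
  unfolding coef_def using free lin_comb_closed by (subst the1_equality[of _ c]) auto

lemma coef_term: "s \<in> S \<Longrightarrow> \<beta> \<in> expo n \<Longrightarrow> coef \<alpha> (s \<otimes> M \<beta>) = (if \<alpha> = \<beta> then s else \<zero>)"
  using coef_lin_comb[OF coeffs_single(1), of s \<beta> \<alpha>] by (simp add: coeffs_single)

lemma coef_in: "a \<in> carrier A \<Longrightarrow> coef \<alpha> a \<in> S"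
  using free coef_lin_comb coeffs_in by metis

lemma coef_addhom: "addhom A A (coef \<alpha>)"
  unfolding addhom_def
proof (intro conjI ballI funcsetI)
  fix a b assume "a \<in> carrier A" "b \<in> carrier A"
  then obtain c d where "c \<in> coeffs A S n" "a = lin_comb A n x c" "d \<in> coeffs A S n" "b = lin_comb A n x d"
    using free by metis
  then show "coef \<alpha> (a \<oplus> b) = coef \<alpha> a \<oplus> coef \<alpha> b"
    using coef_lin_comb[OF coeffs_add(1)] by (simp add: coef_lin_comb coeffs_add(2))
qed (simp add: coef_in S_closed)

text \<open>As the images of K lie in \<open>S\<close>, this contains the K-linearity that
  \<open>tensor_map\<close> asks of a coordinate function.\<close>

lemma coef_smult:
  assumes "s \<in> S" "a \<in> carrier A"
  shows "coef \<alpha> (s \<otimes> a) = s \<otimes> coef \<alpha> a"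
proof (rule addhom_eq[OF abelian_group_axioms abelian_group_axioms _ _ terms_closed _ generated[OF assms(2)]])
  have s: "s \<in> carrier A" using assms S_closed by blast
  show "addhom A A (\<lambda>a. coef \<alpha> (s \<otimes> a))"
    by (rule addhom_comp[OF addhom_l_mult[OF s] coef_addhom])
  show "addhom A A (\<lambda>a. s \<otimes> coef \<alpha> a)"
    by (rule addhom_comp[OF coef_addhom addhom_l_mult[OF s]])
  fix a assume "a \<in> terms"
  then show "coef \<alpha> (s \<otimes> a) = s \<otimes> coef \<alpha> a"
    unfolding terms_def using assms(1) s
    by (auto simp: coef_term S_mult S_closed mon_closed simp flip: m_assoc)
qed

end

section \<open>Bijective skew PBW extensions\<close>

text \<open>A core from which the full definition is rebuilt in \<open>bij_skew_PBW\<close>. The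
  assumption \<open>nontrivial\<close> is the trace of the nonzero constants in (iv), which exist
  once there is a variable; with no variables the zero ring is allowed.\<close>

locale bij_pbw = free_monomials +
  assumes sigma_ex: "i < n \<Longrightarrow> \<exists>\<sigma>. bij_betw \<sigma> S S \<and> (\<forall>r\<in>S. x i \<otimes> r \<ominus> \<sigma> r \<otimes> x i \<in> S)"
    and unit_ex: "i < j \<Longrightarrow> j < n \<Longrightarrow>
      \<exists>c\<in>Units (A\<lparr>carrier := S\<rparr>). x j \<otimes> x i \<ominus> c \<otimes> x i \<otimes> x j \<in> low"
    and nontrivial: "0 < n \<Longrightarrow> \<one> \<noteq> \<zero>"
begin

text \<open>Read off as the coordinate at x_i of x_i r, so that additivity and linearity are
  inherited from \<open>coef\<close>. By \<open>sigma_eq\<close> it agrees on \<open>S\<close> with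
  any twist provided by the assumption.\<close>

definition sigma :: "nat \<Rightarrow> 'a \<Rightarrow> 'a" where
  "sigma i r = coef (unit_expo i) (x i \<otimes> r)"

lemma diff_imp_add: "a \<in> carrier A \<Longrightarrow> b \<in> carrier A \<Longrightarrow> a = b \<oplus> (a \<ominus> b)"
  by (simp add: a_minus_def a_lcomm r_neg)

lemma coef_x: "i < n \<Longrightarrow> s \<in> S \<Longrightarrow> d \<in> S \<Longrightarrow> coef (unit_expo i) (s \<otimes> x i \<oplus> d) = s"
  using coef_term[OF _ unit_expo_in, of s i "unit_expo i"] coef_term[OF _ expo_zero, of d "unit_expo i"]
  by (simp add: mon_unit mon_zero addhom_add[OF coef_addhom] S_closed x_closed unit_expo_neq_zero)

lemma sigma_eq:
  assumes "i < n" "r \<in> S" "s \<in> S" "x i \<otimes> r \<ominus> s \<otimes> x i \<in> S"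
  shows "sigma i r = s"
  unfolding sigma_def
  using diff_imp_add[of "x i \<otimes> r" "s \<otimes> x i"] coef_x[OF assms(1,3,4)] assms
  by (simp add: S_closed x_closed)

lemma sigma_bij: "i < n \<Longrightarrow> bij_betw (sigma i) S S"
  and sigma_diff: "i < n \<Longrightarrow> r \<in> S \<Longrightarrow> x i \<otimes> r \<ominus> sigma i r \<otimes> x i \<in> S"
proof -
  assume i: "i < n"
  from sigma_ex[OF i] obtain \<sigma> where \<sigma>: "bij_betw \<sigma> S S" "\<And>r. r \<in> S \<Longrightarrow> x i \<otimes> r \<ominus> \<sigma> r \<otimes> x i \<in> S"
    by blast
  have eq: "sigma i r = \<sigma> r" if "r \<in> S" for r
    by (rule sigma_eq[OF i that _ \<sigma>(2)[OF that]]) (use bij_betwE[OF \<sigma>(1)] that in blast)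
  show "bij_betw (sigma i) S S" using \<sigma>(1) bij_betw_cong[of S "sigma i" \<sigma> S] eq by blast
  show "x i \<otimes> r \<ominus> sigma i r \<otimes> x i \<in> S" if "r \<in> S" using \<sigma>(2)[OF that] eq[OF that] by simp
qed

lemma sigma_in: "i < n \<Longrightarrow> r \<in> S \<Longrightarrow> sigma i r \<in> S"
  by (simp add: sigma_def coef_in S_closed x_closed)

lemma x_mult:
  assumes "i < n" "r \<in> S"
  obtains d where "d \<in> S" "x i \<otimes> r = sigma i r \<otimes> x i \<oplus> d"
  using diff_imp_add[of "x i \<otimes> r" "sigma i r \<otimes> x i"] sigma_diff[OF assms] assms
  by (meson S_closed m_closed sigma_in x_closed)

lemma sigma_add:
  "i < n \<Longrightarrow> r \<in> S \<Longrightarrow> s \<in> S \<Longrightarrow> sigma i (r \<oplus> s) = sigma i r \<oplus> sigma i s"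
  by (simp add: sigma_def r_distr S_closed x_closed addhom_add[OF coef_addhom])

lemma sigma_zero: "i < n \<Longrightarrow> sigma i \<zero> = \<zero>"
  using addhom_zero[OF abelian_group_axioms abelian_group_axioms coef_addhom]
  by (simp add: sigma_def x_closed)

lemma sigma_one: "i < n \<Longrightarrow> sigma i \<one> = \<one>"
  using coef_x[of i \<one> \<zero>] by (simp add: sigma_def x_closed S_one S_zero)

text \<open>Expand x_i (r s) = (x_i r) s twice and compare the coordinates at x_i.\<close>

lemma sigma_mult:
  assumes "i < n" "r \<in> S" "s \<in> S"
  shows "sigma i (r \<otimes> s) = sigma i r \<otimes> sigma i s"
proof -
  obtain d e where de: "d \<in> S" "x i \<otimes> r = sigma i r \<otimes> x i \<oplus> d" "e \<in> S" "x i \<otimes> s = sigma i s \<otimes> x i \<oplus> e"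
    using x_mult assms by metis
  note cl = assms de sigma_in S_closed x_closed
  have "x i \<otimes> (r \<otimes> s) = (x i \<otimes> r) \<otimes> s" using assms by (simp add: m_assoc S_closed x_closed)
  also have "\<dots> = sigma i r \<otimes> (x i \<otimes> s) \<oplus> d \<otimes> s"
    unfolding de(2) using assms de(1) by (simp add: m_assoc l_distr sigma_in S_closed x_closed)
  also have "\<dots> = (sigma i r \<otimes> sigma i s) \<otimes> x i \<oplus> (sigma i r \<otimes> e \<oplus> d \<otimes> s)"
    unfolding de(4) using assms de(1,3) by (simp add: m_assoc r_distr a_assoc sigma_in S_closed x_closed)
  finally show ?thesis
    using coef_x[OF assms(1), of "sigma i r \<otimes> sigma i s" "sigma i r \<otimes> e \<oplus> d \<otimes> s"] cl
    unfolding sigma_def by (simp add: S_mult S_add coef_in)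
qed

text \<open>A central \<open>c\<close> can be pulled in front of x_i, and coordinates are left
  linear. For \<open>c\<close> coming from K this is what makes \<sigma> \<otimes> id well
  defined.\<close>

lemma sigma_central:
  assumes "i < n" "c \<in> S" "r \<in> S" "\<And>a. a \<in> carrier A \<Longrightarrow> a \<otimes> c = c \<otimes> a"
  shows "sigma i (c \<otimes> r) = c \<otimes> sigma i r"
proof -
  have "x i \<otimes> (c \<otimes> r) = c \<otimes> (x i \<otimes> r)"
    using assms by (simp add: S_closed x_closed flip: m_assoc)
  then show ?thesis using assms by (simp add: sigma_def coef_smult S_closed x_closed)
qed

definition tau :: "nat \<Rightarrow> 'a \<Rightarrow> 'a" where
  "tau i = inv_into S (sigma i)"

lemma tau_bij: "i < n \<Longrightarrow> bij_betw (tau i) S S"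
  unfolding tau_def by (rule bij_betw_inv_into[OF sigma_bij])

lemma tau_in: "i < n \<Longrightarrow> r \<in> S \<Longrightarrow> tau i r \<in> S"
  using tau_bij bij_betwE by blast

lemma sigma_tau: "i < n \<Longrightarrow> r \<in> S \<Longrightarrow> sigma i (tau i r) = r"
  unfolding tau_def using bij_betw_inv_into_right[OF sigma_bij] by blast

lemma tau_sigma: "i < n \<Longrightarrow> r \<in> S \<Longrightarrow> tau i (sigma i r) = r"
  unfolding tau_def using bij_betw_inv_into_left[OF sigma_bij] by blast

lemma tau_add:
  assumes "i < n" "r \<in> S" "s \<in> S"
  shows "tau i (r \<oplus> s) = tau i r \<oplus> tau i s"
  using tau_sigma[OF assms(1), of "tau i r \<oplus> tau i s"] assms
  by (simp add: sigma_add tau_in sigma_tau S_add)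

lemma tau_linear:
  assumes "i < n" "c \<in> S" "\<And>r. r \<in> S \<Longrightarrow> sigma i (c \<otimes> r) = c \<otimes> sigma i r" "r \<in> S"
  shows "tau i (c \<otimes> r) = c \<otimes> tau i r"
  using tau_sigma[OF assms(1), of "c \<otimes> tau i r"] assms
  by (simp add: tau_in sigma_tau S_mult)

text \<open>Commutation constants reach the other side of the variables through inverse twists; this
  keeps them invertible.\<close>

lemma tau_unit:
  assumes "i < n" "c \<in> Units (A\<lparr>carrier := S\<rparr>)"
  shows "tau i c \<in> Units (A\<lparr>carrier := S\<rparr>)"
proof -
  obtain d where d: "c \<in> S" "d \<in> S" "d \<otimes> c = \<one>" "c \<otimes> d = \<one>"
    using assms(2) by (auto simp: Units_def)
  have tau_mult: "tau i (r \<otimes> s) = tau i r \<otimes> tau i s" if "r \<in> S" "s \<in> S" for r s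
    using tau_sigma[OF assms(1), of "tau i r \<otimes> tau i s"] that assms(1)
    by (simp add: sigma_mult tau_in sigma_tau S_mult)
  have "tau i \<one> = \<one>" using tau_sigma[OF assms(1) S_one] assms(1) by (simp add: sigma_one)
  then have "tau i d \<otimes> tau i c = \<one>" "tau i c \<otimes> tau i d = \<one>"
    using tau_mult[of d c] tau_mult[of c d] d by auto
  then show ?thesis using d assms(1) by (auto simp: Units_def tau_in)
qed

section \<open>Triangularity of right multiplication by coefficients\<close>

definition deg :: "(nat \<Rightarrow> nat) \<Rightarrow> nat" where
  "deg \<alpha> = (\<Sum>i<n. \<alpha> i)"

text \<open>
  \<open>Orderings.less_fun_def\<close> is the pointwise order; unqualified, the name denotes the lexicographic one.
\<close>
lemma deg_less: "\<alpha> \<in> expo n \<Longrightarrow> \<beta> < \<alpha> \<Longrightarrow> deg \<beta> < deg \<alpha>"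
  unfolding deg_def
proof (rule sum_strict_mono_ex1)
  assume *: "\<alpha> \<in> expo n" "\<beta> < \<alpha>"
  then show "\<forall>i\<in>{..<n}. \<beta> i \<le> \<alpha> i" by (simp add: Orderings.less_fun_def le_fun_def)
  from * obtain i where i: "\<beta> i < \<alpha> i" by (auto simp: Orderings.less_fun_def le_fun_def not_le)
  moreover have "i < n" using * i by (cases "i < n") (auto simp: expo_def)
  ultimately show "\<exists>i\<in>{..<n}. \<beta> i < \<alpha> i" by blast
qed auto

text \<open>The pointwise order is the right one here: each correction term arises by replacing some
  x_i r by an element of \<open>S\<close>, which deletes one variable and leaves the others
  alone.\<close>

definition lower :: "(nat \<Rightarrow> nat) \<Rightarrow> 'a set" where
  "lower \<alpha> = {s \<otimes> M \<beta> | s \<beta>. s \<in> S \<and> \<beta> \<in> expo n \<and> \<beta> < \<alpha>}"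

lemma lower_closed: "lower \<alpha> \<subseteq> carrier A"
  by (auto simp: lower_def term_closed)

lemma coef_lower:
  assumes "l \<in> acl A (lower \<alpha>)" "\<not> \<gamma> < \<alpha>"
  shows "coef \<gamma> l = \<zero>"
  by (rule addhom_eq[OF abelian_group_axioms abelian_group_axioms coef_addhom _ lower_closed _ assms(1),
        of "\<lambda>_. \<zero>"]) (use assms(2) in \<open>auto simp: addhom_def lower_def coef_term\<close>)

text \<open>x_i s M_\<beta> splits into a term with \<beta> raised at i and one with \<beta> itself,
  both below \<alpha> raised at i. Since \<beta> is below \<alpha>, it also avoids the variables
  before x_i, so \<open>mon_step\<close> applies to it.\<close>

lemma x_lower:
  assumes "i < n" "\<And>j. j < i \<Longrightarrow> \<alpha> j = 0" "l \<in> acl A (lower \<alpha>)"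
  shows "x i \<otimes> l \<in> acl A (lower (\<alpha>(i := Suc (\<alpha> i))))"
proof (rule addhom_acl[OF abelian_group_axioms abelian_group_axioms addhom_l_mult lower_closed _ assms(3)])
  show "x i \<in> carrier A" using assms x_closed by blast
  fix a assume "a \<in> lower \<alpha>"
  then obtain s \<beta> where s: "s \<in> S" "\<beta> \<in> expo n" "\<beta> < \<alpha>" "a = s \<otimes> M \<beta>" by (auto simp: lower_def)
  let ?a = "\<alpha>(i := Suc (\<alpha> i))" and ?b = "\<beta>(i := Suc (\<beta> i))"
  obtain d where d: "d \<in> S" "x i \<otimes> s = sigma i s \<otimes> x i \<oplus> d" using x_mult assms(1) s(1) by metis
  have le: "\<beta> j \<le> \<alpha> j" for j using s(3) by (simp add: Orderings.less_fun_def le_fun_def)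
  have "x i \<otimes> a = (x i \<otimes> s) \<otimes> M \<beta>"
    using s assms(1) by (simp add: m_assoc S_closed x_closed mon_closed)
  also have "\<dots> = sigma i s \<otimes> (x i \<otimes> M \<beta>) \<oplus> d \<otimes> M \<beta>"
    using s d assms(1) by (simp add: l_distr m_assoc S_closed x_closed mon_closed sigma_in)
  also have "x i \<otimes> M \<beta> = M ?b"
    using assms(2) le by (intro mon_step[symmetric] assms(1)) (metis le_zero_eq)
  finally have eq: "x i \<otimes> a = sigma i s \<otimes> M ?b \<oplus> d \<otimes> M \<beta>" .
  \<comment> \<open>A position of strict inequality stays strict when \<alpha> alone or both
    exponents are raised at i, even if k = i.\<close>
  obtain k where k: "\<beta> k < \<alpha> k" using s(3) by (auto simp: Orderings.less_fun_def le_fun_def not_le)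
  have "\<beta> \<le> ?a" "?b \<le> ?a" using le by (auto simp: le_fun_def le_SucI)
  moreover have "\<not> ?a \<le> \<beta>" "\<not> ?a \<le> ?b" using k by (auto simp: le_fun_def not_le less_SucI intro!: exI[of _ k])
  ultimately have "\<beta> < ?a" "?b < ?a" by (auto simp: Orderings.less_fun_def)
  moreover have "?b \<in> expo n" using s(2) assms(1) by (auto simp: expo_def)
  ultimately show "x i \<otimes> a \<in> acl A (lower ?a)"
    unfolding eq using s d assms(1) sigma_in
    by (intro acl.add acl.base) (auto simp: lower_def)
qed

text \<open>
  The key triangularity: moving a coefficient from right to left across a monomial twists it by a
  bijection of \<open>S\<close> and only adds monomials with componentwise smaller exponents, because
  \<open>x\<^sub>i\<close> is pushed through one variable at a time and the commutation relations among the
  variables are never needed.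
\<close>
lemma mon_mult:
  assumes "\<alpha> \<in> expo n"
  shows "\<exists>\<tau>. bij_betw \<tau> S S \<and> (\<forall>r\<in>S. \<exists>l\<in>acl A (lower \<alpha>). M \<alpha> \<otimes> r = \<tau> r \<otimes> M \<alpha> \<oplus> l)"
  using assms
proof (induction "deg \<alpha>" arbitrary: \<alpha> rule: less_induct)
  case less
  show ?case
  proof (cases "\<exists>i. \<alpha> i \<noteq> 0")
    case False
    then have "\<alpha> = (\<lambda>_. 0)" by auto
    then show ?thesis
      by (intro exI[of _ id] conjI bij_betw_id ballI bexI[of _ \<zero>])
        (auto simp: mon_zero S_closed intro: acl.zero)
  next
    case True
    \<comment> \<open>Peeling off the leftmost variable that occurs leaves a monomial without
      variables before x_i, as \<open>mon_step\<close> and \<open>x_lower\<close> require.\<close>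
    define i where "i = (LEAST i. \<alpha> i \<noteq> 0)"
    have i: "\<alpha> i \<noteq> 0" unfolding i_def by (rule LeastI_ex[OF True])
    have before: "\<alpha> j = 0" if "j < i" for j using not_less_Least[of j "\<lambda>i. \<alpha> i \<noteq> 0"] that i_def by blast
    have n: "i < n" using less.prems i by (cases "i < n") (auto simp: expo_def)
    define \<beta> where "\<beta> = \<alpha>(i := \<alpha> i - 1)"
    have \<alpha>: "\<alpha> = \<beta>(i := Suc (\<beta> i))" using i by (auto simp: \<beta>_def)
    have \<beta>: "\<beta> \<in> expo n" "\<beta> < \<alpha>" "\<And>j. j < i \<Longrightarrow> \<beta> j = 0"
      using less.prems before i by (auto simp: \<beta>_def expo_def Orderings.less_fun_def le_fun_def not_le)
    have M\<alpha>: "M \<alpha> = x i \<otimes> M \<beta>" unfolding \<alpha> by (rule mon_step) (use n \<beta> in auto)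
    from less.hyps[OF deg_less[OF less.prems \<beta>(2)] \<beta>(1)] obtain \<tau> where
      \<tau>: "bij_betw \<tau> S S" "\<And>r. r \<in> S \<Longrightarrow> \<exists>l\<in>acl A (lower \<beta>). M \<beta> \<otimes> r = \<tau> r \<otimes> M \<beta> \<oplus> l" by blast
    show ?thesis
    \<comment> \<open>The coefficient comes from the right: it passes M_\<beta> first, which twists
      it by \<tau>, and x_i afterwards.\<close>
    proof (intro exI[of _ "sigma i \<circ> \<tau>"] conjI ballI)
      show "bij_betw (sigma i \<circ> \<tau>) S S" by (rule bij_betw_trans[OF \<tau>(1) sigma_bij[OF n]])
      fix r assume r: "r \<in> S"
      have \<tau>r: "\<tau> r \<in> S" using \<tau>(1) r bij_betwE by blast
      from \<tau>(2)[OF r] obtain l where l: "l \<in> acl A (lower \<beta>)" "M \<beta> \<otimes> r = \<tau> r \<otimes> M \<beta> \<oplus> l" by blast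
      obtain d where d: "d \<in> S" "x i \<otimes> \<tau> r = sigma i (\<tau> r) \<otimes> x i \<oplus> d" using x_mult n \<tau>r by metis
      note cl = S_closed x_closed[OF n] mon_closed r \<tau>r acl_closed[OF lower_closed l(1)] d(1) sigma_in[OF n]
      have "M \<alpha> \<otimes> r = x i \<otimes> (\<tau> r \<otimes> M \<beta> \<oplus> l)"
        using cl unfolding M\<alpha> by (simp add: m_assoc l(2))
      also have "\<dots> = (x i \<otimes> \<tau> r) \<otimes> M \<beta> \<oplus> x i \<otimes> l" using cl by (simp add: r_distr m_assoc)
      also have "\<dots> = sigma i (\<tau> r) \<otimes> M \<alpha> \<oplus> (d \<otimes> M \<beta> \<oplus> x i \<otimes> l)"
        unfolding d(2) M\<alpha> using cl by (simp add: l_distr m_assoc a_assoc)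
      finally have eq: "M \<alpha> \<otimes> r = (sigma i \<circ> \<tau>) r \<otimes> M \<alpha> \<oplus> (d \<otimes> M \<beta> \<oplus> x i \<otimes> l)" by simp
      have "d \<otimes> M \<beta> \<oplus> x i \<otimes> l \<in> acl A (lower \<alpha>)"
      proof (rule acl.add)
        show "d \<otimes> M \<beta> \<in> acl A (lower \<alpha>)" using d \<beta> by (intro acl.base) (auto simp: lower_def)
        show "x i \<otimes> l \<in> acl A (lower \<alpha>)" using x_lower[OF n \<beta>(3) l(1)] \<alpha> by simp
      qed
      with eq show "\<exists>l\<in>acl A (lower \<alpha>). M \<alpha> \<otimes> r = (sigma i \<circ> \<tau>) r \<otimes> M \<alpha> \<oplus> l" by blast
    qed
  qed
qed

end

lemma (in monomials) unit_nonzero: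
  assumes "c \<in> Units (A\<lparr>carrier := S\<rparr>)" "\<one> \<noteq> \<zero>"
  shows "c \<in> S - {\<zero>}"
proof -
  obtain d where d: "c \<in> S" "d \<in> S" "d \<otimes> c = \<one>" using assms(1) by (auto simp: Units_def)
  then have "c \<noteq> \<zero>" using assms(2) S_closed r_null by metis
  then show ?thesis using d by simp
qed

lemma bij_skew_PBW_imp:
  assumes "bij_skew_PBW A S n x"
  shows "bij_pbw A S n x"
proof -
  from assms have sk: "skew_PBW A S n x" by (simp add: bij_skew_PBW_def)
  then interpret monomials A S n x
    by (intro monomials.intro monomials_axioms.intro) (auto simp: skew_PBW_def)
  show ?thesis
  proof unfold_locales
    show "\<forall>a\<in>carrier A. \<exists>!c. c \<in> coeffs A S n \<and> a = lin_comb A n x c"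
      using sk by (simp add: skew_PBW_def)
    show "\<exists>\<sigma>. bij_betw \<sigma> S S \<and> (\<forall>r\<in>S. x i \<otimes>\<^bsub>A\<^esub> r \<ominus>\<^bsub>A\<^esub> \<sigma> r \<otimes>\<^bsub>A\<^esub> x i \<in> S)" if "i < n" for i
      using assms that by (simp add: bij_skew_PBW_def)
    show "\<exists>c\<in>Units (A\<lparr>carrier := S\<rparr>). x j \<otimes>\<^bsub>A\<^esub> x i \<ominus>\<^bsub>A\<^esub> c \<otimes>\<^bsub>A\<^esub> x i \<otimes>\<^bsub>A\<^esub> x j \<in> low" if "i < j" "j < n" for i j
      using assms that pbw_rel_iff by (simp add: bij_skew_PBW_def)
    show "\<one>\<^bsub>A\<^esub> \<noteq> \<zero>\<^bsub>A\<^esub>" if n: "0 < n"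
    proof -
      \<comment> \<open>Condition (iv) with both indices equal to 0 already provides a nonzero
        element of \<open>S\<close>.\<close>
      obtain c where "c \<in> S - {\<zero>\<^bsub>A\<^esub>}" using sk n unfolding skew_PBW_def by blast
      then show ?thesis using S_closed one_zeroD by auto
    qed
  qed
qed

text \<open>The clauses about nonzero constants return as follows. In (iii) the constant is
  \<sigma>_i(r), nonzero because \<sigma>_i is injective and fixes zero. In (iv) equal indices take
  the constant 1, and for j < i the relation of the reversed pair is multiplied by the negative of
  the inverse of its constant.\<close>

lemma (in bij_pbw) bij_skew_PBW: "bij_skew_PBW A S n x"
proof -
  have "\<exists>c\<in>S - {\<zero>}. x i \<otimes> r \<ominus> c \<otimes> x i \<in> S" if "i < n" "r \<in> S - {\<zero>}" for i r
  proof (rule bexI[of _ "sigma i r"])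
    have "sigma i r \<noteq> \<zero>"
      using tau_sigma[OF that(1), of r] tau_sigma[OF that(1) S_zero] sigma_zero[OF that(1)] that by auto
    then show "sigma i r \<in> S - {\<zero>}" using that sigma_in by simp
  qed (use that sigma_diff in simp)
  moreover have "\<exists>c\<in>S - {\<zero>}. pbw_rel A S n x i j c" if ij: "i < n" "j < n" for i j
  proof -
    have one: "\<one> \<noteq> \<zero>" using nontrivial ij by simp
    consider "i < j" | "i = j" | "j < i" by linarith
    then show ?thesis
    proof cases
      case 1
      then obtain c where "c \<in> Units (A\<lparr>carrier := S\<rparr>)" "x j \<otimes> x i \<ominus> c \<otimes> x i \<otimes> x j \<in> low"
        using unit_ex ij by blast
      then show ?thesis using unit_nonzero one pbw_rel_iff by blast
    next
      case 2
      have "x i \<otimes> x i \<ominus> \<one> \<otimes> x i \<otimes> x i = \<zero>" using ij x_closed by (simp add: a_minus_def r_neg)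
      then show ?thesis using 2 one S_one low_S[OF S_zero] pbw_rel_iff by (intro bexI[of _ \<one>]) auto
    next
      case 3
      then obtain c where c: "c \<in> Units (A\<lparr>carrier := S\<rparr>)" "x i \<otimes> x j \<ominus> c \<otimes> x j \<otimes> x i \<in> low"
        using unit_ex ij by blast
      then obtain d where d: "c \<in> S" "d \<in> S" "d \<otimes> c = \<one>" "d \<in> Units (A\<lparr>carrier := S\<rparr>)"
        by (auto simp: Units_def)
      have dc: "d \<otimes> (c \<otimes> x j \<otimes> x i) = x j \<otimes> x i"
        using d ij by (simp add: S_closed x_closed flip: m_assoc)
      have "\<ominus> (d \<otimes> (x i \<otimes> x j \<ominus> c \<otimes> x j \<otimes> x i)) \<in> low"
        using c(2) d low_lmult low_neg by blast
      also have "\<ominus> (d \<otimes> (x i \<otimes> x j \<ominus> c \<otimes> x j \<otimes> x i)) = x j \<otimes> x i \<ominus> d \<otimes> x i \<otimes> x j"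
        using d(1,2) ij dc by (simp add: S_closed x_closed a_minus_def r_distr r_minus minus_add a_comm m_assoc[of d "x i" "x j"])
      finally show ?thesis using unit_nonzero[OF d(4) one] pbw_rel_iff by blast
    qed
  qed
  ultimately have "skew_PBW A S n x"
    unfolding skew_PBW_def using free S_subring x_closed ring_axioms by blast
  then show ?thesis
    unfolding bij_skew_PBW_def using sigma_ex unit_ex pbw_rel_iff by blast
qed

section \<open>The opposite extension\<close>

lemma opp_simps [simp]:
  "carrier (opp A) = carrier A" "a \<otimes>\<^bsub>opp A\<^esub> b = b \<otimes>\<^bsub>A\<^esub> a" "\<one>\<^bsub>opp A\<^esub> = \<one>\<^bsub>A\<^esub>"
  "\<zero>\<^bsub>opp A\<^esub> = \<zero>\<^bsub>A\<^esub>" "add (opp A) = add A"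
  by (simp_all add: opp_def)

lemma opp_a_inv [simp]: "a_inv (opp A) = a_inv A"
  by (simp add: a_inv_def m_inv_def fun_eq_iff)

lemma opp_minus [simp]: "a \<ominus>\<^bsub>opp A\<^esub> b = a \<ominus>\<^bsub>A\<^esub> b"
  by (simp add: a_minus_def)

lemma opp_restrict: "opp (A\<lparr>carrier := S\<rparr>) = (opp A)\<lparr>carrier := S\<rparr>"
  by (simp add: opp_def)

lemma Units_opp: "Units ((opp A)\<lparr>carrier := S\<rparr>) = Units (A\<lparr>carrier := S\<rparr>)"
  by (auto simp: Units_def)

lemma ring_opp:
  assumes "ring A" shows "ring (opp A)"
proof -
  interpret ring A by fact
  show ?thesis
  proof (rule ringI)
    show "abelian_group (opp A)"
    proof (rule abelian_groupI)
      fix a assume "a \<in> carrier (opp A)"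
      then show "\<exists>b\<in>carrier (opp A). b \<oplus>\<^bsub>opp A\<^esub> a = \<zero>\<^bsub>opp A\<^esub>"
        by (intro bexI[of _ "\<ominus>\<^bsub>A\<^esub> a"]) (simp_all add: l_neg)
    qed (simp_all add: a_ac)
    show "monoid (opp A)" by (rule monoidI) (auto simp: m_assoc)
  qed (auto simp: l_distr r_distr)
qed

lemma subring_opp:
  assumes "ring A" "subring S A" shows "subring S (opp A)"
proof (rule ring.subringI[OF ring_opp[OF assms(1)]])
  note S = subringE[OF assms(2)]
  show "S \<subseteq> carrier (opp A)" "\<one>\<^bsub>opp A\<^esub> \<in> S" using S(1,3) by simp_all
  show "\<ominus>\<^bsub>opp A\<^esub> h \<in> S" if "h \<in> S" for h using S(5)[OF that] by simp
  show "h \<otimes>\<^bsub>opp A\<^esub> k \<in> S" "h \<oplus>\<^bsub>opp A\<^esub> k \<in> S" if "h \<in> S" "k \<in> S" for h k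
    using S(6)[OF that(2,1)] S(7)[OF that] by simp_all
qed

lemma is_algebra_opp:
  assumes "is_algebra K A phi" shows "is_algebra K (opp A) phi"
proof -
  from assms have K: "cring K" "ring A" "phi \<in> ring_hom K A"
    and comm: "\<And>c a. c \<in> carrier K \<Longrightarrow> a \<in> carrier A \<Longrightarrow> phi c \<otimes>\<^bsub>A\<^esub> a = a \<otimes>\<^bsub>A\<^esub> phi c"
    by (auto simp: is_algebra_def)
  note hom = ring_hom_closed[OF K(3)] ring_hom_mult[OF K(3)] ring_hom_add[OF K(3)] ring_hom_one[OF K(3)]
  have "phi \<in> ring_hom K (opp A)"
  proof (rule ring_hom_memI)
    fix c d assume cd: "c \<in> carrier K" "d \<in> carrier K"
    show "phi (c \<otimes>\<^bsub>K\<^esub> d) = phi c \<otimes>\<^bsub>opp A\<^esub> phi d"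
      using comm[OF cd(1) hom(1)[OF cd(2)]] hom(2)[OF cd] by simp
  qed (simp_all add: hom)
  moreover have "\<forall>c\<in>carrier K. \<forall>a\<in>carrier (opp A). phi c \<otimes>\<^bsub>opp A\<^esub> a = a \<otimes>\<^bsub>opp A\<^esub> phi c"
    using comm by auto
  ultimately show ?thesis
    using K by (simp only: is_algebra_def ring_opp simp_thms)
qed

lemma acl_cong_ring:
  assumes "\<zero>\<^bsub>G\<^esub> = \<zero>\<^bsub>H\<^esub>" "add G = add H" shows "acl G Y = acl H Y"
proof -
  have "a \<in> acl G Y \<Longrightarrow> a \<in> acl H Y" for a
    by (induction rule: acl.induct) (simp_all add: assms acl.intros)
  moreover have "a \<in> acl H Y \<Longrightarrow> a \<in> acl G Y" for a
    by (induction rule: acl.induct) (simp_all add: acl.intros flip: assms)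
  ultimately show ?thesis by blast
qed

lemma acl_opp [simp]: "acl (opp A) Y = acl A Y"
  by (rule acl_cong_ring) simp_all

lemma monl_map: "monl A (map f xs) x \<alpha> = monl A xs (x \<circ> f) (\<alpha> \<circ> f)"
  by (induction xs) (simp_all add: monl_Nil monl_Cons)

text \<open>
  The opposite algebra carries the variables in reverse order, so that its monomials are exactly
  those of \<open>A\<close>, with coefficients written on the right.
\<close>
definition flip_expo :: "nat \<Rightarrow> (nat \<Rightarrow> nat) \<Rightarrow> nat \<Rightarrow> nat" where
  "flip_expo n \<alpha> i = (if i < n then \<alpha> (n - 1 - i) else 0)"

lemma flip_expo_in: "flip_expo n \<alpha> \<in> expo n"
  by (simp add: flip_expo_def expo_def)

lemma flip_flip: "\<alpha> \<in> expo n \<Longrightarrow> flip_expo n (flip_expo n \<alpha>) = \<alpha>"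
  by (auto simp: flip_expo_def expo_def fun_eq_iff)

lemma rev_upt_map: "rev [0..<n] = map (\<lambda>i. n - 1 - i) [0..<n]"
  by (rule nth_equalityI) (simp_all add: rev_nth)

lemma pow_opp:
  assumes "ring A" "a \<in> carrier A"
  shows "a [^]\<^bsub>opp A\<^esub> (k::nat) = a [^]\<^bsub>A\<^esub> k"
proof -
  interpret A: ring A by fact
  show ?thesis
  proof (induction k)
    case (Suc k)
    then show ?case unfolding A.nat_pow_Suc2[OF assms(2)] by simp
  qed simp
qed

context monomials
begin

definition flip_var :: "nat \<Rightarrow> 'a" where
  "flip_var i = x (n - 1 - i)"

lemma opp_monomials: "monomials (opp A) S n flip_var"
  using ring_opp[OF ring_axioms] subring_opp[OF ring_axioms S_subring] x_closed
  by (auto simp: monomials_def monomials_axioms_def flip_var_def)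

lemma monl_opp:
  "(\<And>i. i \<in> set xs \<Longrightarrow> z i \<in> carrier A) \<Longrightarrow> monl (opp A) xs z \<alpha> = monl A (rev xs) z \<alpha>"
proof (induction xs)
  case (Cons i xs)
  then have "monl A (rev xs @ [i]) z \<alpha> = monl A (rev xs) z \<alpha> \<otimes> monl A [i] z \<alpha>"
    by (intro monl_append) auto
  with Cons show ?case by (simp add: monl_Cons monl_Nil pow_opp ring_axioms)
qed (simp add: monl_Nil)

lemma mon_opp: "mon (opp A) n flip_var \<alpha> = M (flip_expo n \<alpha>)"
proof -
  have "mon (opp A) n flip_var \<alpha> = monl A (map (\<lambda>i. n - 1 - i) [0..<n]) flip_var \<alpha>"
    unfolding mon_monl rev_upt_map[symmetric] by (rule monl_opp) (simp add: x_closed flip_var_def)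
  also have "\<dots> = M (flip_expo n \<alpha>)"
    unfolding mon_monl monl_map by (rule monl_cong) (simp add: flip_expo_def flip_var_def)
  finally show ?thesis .
qed

end

section \<open>Right bases, and the commutation relations with coefficients on the right\<close>

context bij_pbw
begin

interpretation O: monomials "opp A" S n flip_var by (rule opp_monomials)

lemma opp_terms: "O.terms = {M \<alpha> \<otimes> s | s \<alpha>. s \<in> S \<and> \<alpha> \<in> expo n}"
proof -
  have "\<exists>\<beta>\<in>expo n. M \<alpha> \<otimes> s = M (flip_expo n \<beta>) \<otimes> s" if "\<alpha> \<in> expo n" for s \<alpha>
    using flip_expo_in flip_flip[OF that] by metis
  then show ?thesis unfolding O.terms_def by (auto simp: mon_opp) (use flip_expo_in in blast)+
qed

text \<open>Triangular elimination by induction on the degree: bijectivity of the twist yields r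
  with \<tau> r = s, so s M_\<alpha> equals M_\<alpha> r up to terms of smaller degree, and these
  are already sums of right multiples.\<close>

lemma opp_generated:
  assumes "a \<in> carrier A" shows "a \<in> acl A O.terms"
proof -
  have neg: "\<ominus> a \<in> acl A O.terms" if "a \<in> acl A O.terms" for a
  proof (rule acl_neg[OF _ _ that])
    show "O.terms \<subseteq> carrier A" using O.terms_closed by simp
    fix a assume "a \<in> O.terms"
    then obtain s \<alpha> where "a = M \<alpha> \<otimes> s" "s \<in> S" "\<alpha> \<in> expo n" by (auto simp: opp_terms)
    then have "\<ominus> a = M \<alpha> \<otimes> (\<ominus> s)" "\<ominus> s \<in> S" by (auto simp: r_minus mon_closed S_closed S_neg)
    then show "\<ominus> a \<in> acl A O.terms"
      using \<open>\<alpha> \<in> expo n\<close> by (intro acl.base) (auto simp: opp_terms)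
  qed
  have "s \<otimes> M \<alpha> \<in> acl A O.terms" if "\<alpha> \<in> expo n" "s \<in> S" for s \<alpha>
    using that
  proof (induction "deg \<alpha>" arbitrary: \<alpha> s rule: less_induct)
    case less
    obtain \<tau> where \<tau>: "bij_betw \<tau> S S" "\<And>r. r \<in> S \<Longrightarrow> \<exists>l\<in>acl A (lower \<alpha>). M \<alpha> \<otimes> r = \<tau> r \<otimes> M \<alpha> \<oplus> l"
      using mon_mult[OF less.prems(1)] by blast
    obtain r where r: "r \<in> S" "s = \<tau> r" using \<tau>(1) less.prems(2) by (auto simp: bij_betw_def)
    obtain l where l: "l \<in> acl A (lower \<alpha>)" "M \<alpha> \<otimes> r = s \<otimes> M \<alpha> \<oplus> l" using \<tau>(2)[OF r(1)] r(2) by blast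
    have "lower \<alpha> \<subseteq> acl A O.terms"
      using less.hyps deg_less[OF less.prems(1)] by (auto simp: lower_def)
    then have "l \<in> acl A O.terms" by (rule acl_mono[OF l(1)])
    moreover have "M \<alpha> \<otimes> r \<in> acl A O.terms"
      using less.prems r(1) by (intro acl.base) (auto simp: opp_terms)
    moreover have "s \<otimes> M \<alpha> = M \<alpha> \<otimes> r \<oplus> \<ominus> l"
      using l(2) acl_closed[OF lower_closed l(1)] term_closed[OF less.prems(2), of \<alpha>]
      by (simp add: a_assoc r_neg)
    ultimately show ?case using neg acl.add by metis
  qed
  then have "terms \<subseteq> acl A O.terms" by (auto simp: terms_def)
  then show ?thesis by (rule acl_mono[OF generated[OF assms]])
qed

text \<open>
  Take a monomial of maximal degree among those occurring in a vanishing combination: by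
  triangularity its left coordinate only sees its own coefficient.
\<close>
lemma opp_independent:
  assumes c: "c \<in> coeffs (opp A) S n" and zero: "lin_comb (opp A) n flip_var c = \<zero>"
  shows "c = (\<lambda>_. \<zero>)"
proof (rule ccontr)
  assume "c \<noteq> (\<lambda>_. \<zero>)"
  let ?F = "{\<alpha>. c \<alpha> \<noteq> \<zero>}"
  have F: "finite ?F" "?F \<noteq> {}" "?F \<subseteq> expo n"
    using c \<open>c \<noteq> _\<close> by (auto simp: coeffs_def fun_eq_iff)
  define d where "d = (\<lambda>\<alpha>. deg (flip_expo n \<alpha>))"
  have "finite (d ` ?F)" "d ` ?F \<noteq> {}" using F by auto
  then have "Max (d ` ?F) \<in> d ` ?F" by (rule Max_in)
  then obtain \<alpha> where \<alpha>: "\<alpha> \<in> ?F" "Max (d ` ?F) = d \<alpha>" by auto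
  have max: "d \<beta> \<le> d \<alpha>" if "\<beta> \<in> ?F" for \<beta>
    using that F(1) \<alpha>(2) Max_ge[of "d ` ?F" "d \<beta>"] by auto
  let ?a = "flip_expo n \<alpha>"
  let ?Y = "{c \<beta> \<otimes>\<^bsub>opp A\<^esub> mon (opp A) n flip_var \<beta> | \<beta>. \<beta> \<in> expo n \<and> \<beta> \<noteq> \<alpha> \<and> c \<beta> \<noteq> \<zero>\<^bsub>opp A\<^esub>}"
  have cS: "c \<beta> \<in> S" for \<beta> using c by (simp add: coeffs_def)
  obtain r where r': "r \<in> acl (opp A) ?Y"
      "lin_comb (opp A) n flip_var c = c \<alpha> \<otimes>\<^bsub>opp A\<^esub> mon (opp A) n flip_var \<alpha> \<oplus>\<^bsub>opp A\<^esub> r"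
    using O.lin_comb_split[OF c, of \<alpha>] by blast
  then have r: "r \<in> acl A ?Y" "\<zero> = M ?a \<otimes> c \<alpha> \<oplus> r"
    by (simp_all only: acl_opp opp_simps mon_opp zero)
  have Y: "?Y \<subseteq> carrier A" by (auto simp: mon_opp mon_closed S_closed cS)
  have rY: "coef ?a b = \<zero>" if "b \<in> ?Y" for b
  proof -
    from that obtain \<beta> where \<beta>: "\<beta> \<in> expo n" "\<beta> \<noteq> \<alpha>" "c \<beta> \<noteq> \<zero>" "b = M (flip_expo n \<beta>) \<otimes> c \<beta>"
      by (auto simp: mon_opp)
    let ?b = "flip_expo n \<beta>"
    obtain \<tau> where \<tau>: "bij_betw \<tau> S S" "\<And>r. r \<in> S \<Longrightarrow> \<exists>l\<in>acl A (lower ?b). M ?b \<otimes> r = \<tau> r \<otimes> M ?b \<oplus> l"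
      using mon_mult[OF flip_expo_in] by blast
    obtain l where l: "l \<in> acl A (lower ?b)" "b = \<tau> (c \<beta>) \<otimes> M ?b \<oplus> l"
      using \<tau>(2)[OF cS] \<beta>(4) by blast
    have \<tau>c: "\<tau> (c \<beta>) \<in> S" using \<tau>(1) cS bij_betwE by blast
    have "\<alpha> \<in> expo n" using \<alpha>(1) F(3) by blast
    then have "?a \<noteq> ?b" using flip_flip[of \<alpha> n] flip_flip[OF \<beta>(1)] \<beta>(2) by metis
    moreover have "deg ?b \<le> deg ?a" using max[of \<beta>] \<beta>(3) by (simp add: d_def)
    \<comment> \<open>By maximality of the degree, the chosen monomial cannot occur among the
      correction terms of another one.\<close>
    then have "\<not> ?a < ?b" using deg_less[OF flip_expo_in] by (meson leD)
    ultimately show ?thesis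
      using coef_lower[OF l(1)] coef_term[OF \<tau>c flip_expo_in] acl_closed[OF lower_closed l(1)] \<tau>c
      by (simp add: l(2) addhom_add[OF coef_addhom] term_closed)
  qed
  have "coef ?a r = \<zero>"
    by (rule addhom_eq[OF abelian_group_axioms abelian_group_axioms coef_addhom _ Y rY r(1)])
      (simp add: addhom_def)
  moreover have "r \<in> carrier A" by (rule acl_closed[OF Y r(1)])
  moreover have "coef ?a \<zero> = \<zero>" by (rule addhom_zero[OF abelian_group_axioms abelian_group_axioms coef_addhom])
  ultimately have coef0: "coef ?a (M ?a \<otimes> c \<alpha>) = \<zero>"
    using addhom_add[OF coef_addhom, of "M ?a \<otimes> c \<alpha>" r ?a] addhom_closed[OF coef_addhom, of "M ?a \<otimes> c \<alpha>" ?a]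
    by (simp add: mon_closed cS S_closed flip: r(2))
  obtain \<tau> where \<tau>: "bij_betw \<tau> S S" "\<And>r. r \<in> S \<Longrightarrow> \<exists>l\<in>acl A (lower ?a). M ?a \<otimes> r = \<tau> r \<otimes> M ?a \<oplus> l"
    using mon_mult[OF flip_expo_in] by blast
  have coef: "coef ?a (M ?a \<otimes> s) = \<tau> s" if s: "s \<in> S" for s
  proof -
    obtain l where l: "l \<in> acl A (lower ?a)" "M ?a \<otimes> s = \<tau> s \<otimes> M ?a \<oplus> l" using \<tau>(2)[OF s] by blast
    have "\<tau> s \<in> S" using \<tau>(1) s bij_betwE by blast
    then show ?thesis
      using coef_lower[OF l(1), of ?a] coef_term[OF _ flip_expo_in, of "\<tau> s"] acl_closed[OF lower_closed l(1)]
      by (simp add: l(2) addhom_add[OF coef_addhom] term_closed S_closed)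
  qed
  \<comment> \<open>Nothing but bijectivity is known about \<tau>. Its value at zero is therefore
    found from the same coordinate formula, applied to the zero coefficient.\<close>
  have "\<tau> (c \<alpha>) = \<tau> \<zero>"
    using coef0 coef[OF cS] coef[OF S_zero] \<open>coef ?a \<zero> = \<zero>\<close> by (simp add: mon_closed)
  then have "c \<alpha> = \<zero>" using inj_onD[OF bij_betw_imp_inj_on[OF \<tau>(1)]] cS S_zero by blast
  then show False using \<alpha>(1) by simp
qed

text \<open>Modulo \<open>S\<close>, x_l s equals \<sigma>_l(s) x_l. Since \<sigma>_l is onto, the
  left and the right multiples of x_l span the same group together with \<open>S\<close>.\<close>

lemma opp_low: "O.low = low"
proof -
  have low_r: "x l \<otimes> s \<in> low" if "s \<in> S" "l < n" for s l
    using x_mult[OF that(2,1)] that low_x low_add low_S sigma_in by metis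
  have low_l: "s \<otimes> x l \<in> O.low" if sl: "s \<in> S" "l < n" for s l
  proof -
    obtain d where d: "d \<in> S" "x l \<otimes> tau l s = s \<otimes> x l \<oplus> d"
      using x_mult[OF sl(2) tau_in[OF sl(2,1)]] sigma_tau sl by metis
    then have "s \<otimes> x l = x l \<otimes> tau l s \<oplus> \<ominus> d"
      using sl by (simp add: S_closed x_closed a_assoc r_neg)
    moreover have "x l \<otimes> tau l s \<in> O.low"
      using O.low_x[of "tau l s" "n - 1 - l"] sl by (simp add: tau_in flip_var_def)
    moreover have "\<ominus> d \<in> O.low" using O.low_S d(1) S_neg by blast
    ultimately show ?thesis using O.low_add by simp
  qed
  have O_low: "O.low = acl A (S \<union> {s \<otimes>\<^bsub>opp A\<^esub> flip_var l | s l. s \<in> S \<and> l < n})"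
    by (simp only: O.low_def acl_opp)
  have sub1: "S \<union> {s \<otimes>\<^bsub>opp A\<^esub> flip_var l | s l. s \<in> S \<and> l < n} \<subseteq> low"
    using low_r low_S by (auto simp: flip_var_def)
  have sub2: "S \<union> {s \<otimes> x l | s l. s \<in> S \<and> l < n} \<subseteq> O.low"
    using low_l O.low_S by auto
  show ?thesis
  proof (intro subset_antisym subsetI)
    fix a
    show "a \<in> low" if "a \<in> O.low"
      using acl_mono[OF that[unfolded O_low] sub1[unfolded low_def]] by (simp only: low_def)
    show "a \<in> O.low" if "a \<in> low"
      using acl_mono[OF that[unfolded low_def] sub2[unfolded O_low]] by (simp only: O_low)
  qed
qed

lemma add_minus_cancel: "a \<in> carrier A \<Longrightarrow> b \<in> carrier A \<Longrightarrow> (a \<oplus> b) \<ominus> a = b"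
  by (simp add: a_minus_def a_comm[of a b] a_assoc r_neg)

lemma minus_minus_cancel:
  assumes "a \<in> carrier A" "b \<in> carrier A" "c \<in> carrier A"
  shows "(a \<ominus> c) \<oplus> \<ominus> (b \<ominus> c) = a \<ominus> b"
proof -
  have "(a \<ominus> c) \<oplus> \<ominus> (b \<ominus> c) = (a \<oplus> \<ominus> c) \<oplus> (c \<oplus> \<ominus> b)"
    using assms by (simp add: a_minus_def minus_add a_comm)
  also have "\<dots> = a \<oplus> ((\<ominus> c \<oplus> c) \<oplus> \<ominus> b)" using assms by (simp add: a_assoc del: l_neg)
  finally show ?thesis using assms by (simp add: l_neg a_minus_def)
qed

text \<open>How the constant of a commutation relation changes sides: modulo \<open>low\<close>,
  pushing the coefficient left through x_j and then x_i undoes \<open>tau j\<close> and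
  \<open>tau i\<close>. The errors are multiples of x_j and x_i and an element of \<open>S\<close>;
  no product of two variables is left over.\<close>

lemma x_x_tau_in_low:
  assumes "i < n" "j < n" "c \<in> S"
  shows "x i \<otimes> (x j \<otimes> tau j (tau i c)) \<ominus> c \<otimes> x i \<otimes> x j \<in> low"
proof -
  let ?d = "tau i c"
  have d: "?d \<in> S" "tau j ?d \<in> S" using assms tau_in by auto
  obtain e where e: "e \<in> S" "x j \<otimes> tau j ?d = ?d \<otimes> x j \<oplus> e"
    using x_mult[OF assms(2) d(2)] sigma_tau[OF assms(2) d(1)] by metis
  obtain f where f: "f \<in> S" "x i \<otimes> ?d = c \<otimes> x i \<oplus> f"
    using x_mult[OF assms(1) d(1)] sigma_tau[OF assms(1,3)] by metis
  obtain g where g: "g \<in> S" "x i \<otimes> e = sigma i e \<otimes> x i \<oplus> g"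
    using x_mult[OF assms(1) e(1)] by metis
  note cl = S_closed x_closed sigma_in
  have "x i \<otimes> (x j \<otimes> tau j ?d) = (x i \<otimes> ?d) \<otimes> x j \<oplus> x i \<otimes> e"
    unfolding e(2) using assms d(1) e(1) by (simp add: cl r_distr m_assoc)
  also have "\<dots> = c \<otimes> x i \<otimes> x j \<oplus> (f \<otimes> x j \<oplus> (sigma i e \<otimes> x i \<oplus> g))"
    unfolding f(2) g(2) using assms e(1) f(1) g(1) by (simp add: cl l_distr a_assoc)
  finally have "x i \<otimes> (x j \<otimes> tau j ?d) \<ominus> c \<otimes> x i \<otimes> x j = f \<otimes> x j \<oplus> (sigma i e \<otimes> x i \<oplus> g)"
    using assms e(1) f(1) g(1) by (simp add: cl add_minus_cancel)
  then show ?thesis using assms e(1) f(1) g(1) sigma_in by (simp add: low_add low_x low_S)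
qed

text \<open>The twists of the opposite extension are the inverses \<open>tau\<close>. Reversing the
  variables turns i < j into a pair in the opposite order, and reversing the product compensates, so
  the relation of A for that pair can be used with its constant moved to the right as in
  \<open>x_x_tau_in_low\<close>.\<close>

lemma opp_bij_pbw: "bij_pbw (opp A) S n flip_var"
proof unfold_locales
  show "\<forall>a\<in>carrier (opp A). \<exists>!c. c \<in> coeffs (opp A) S n \<and> a = lin_comb (opp A) n flip_var c"
    by (rule O.freeI) (use opp_generated opp_independent in auto)
  show "\<exists>\<sigma>. bij_betw \<sigma> S S \<and> (\<forall>r\<in>S. flip_var i \<otimes>\<^bsub>opp A\<^esub> r \<ominus>\<^bsub>opp A\<^esub> \<sigma> r \<otimes>\<^bsub>opp A\<^esub> flip_var i \<in> S)" if "i < n" for i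
  proof (intro exI conjI ballI)
    have n: "n - 1 - i < n" using that by simp
    show "bij_betw (tau (n - 1 - i)) S S" by (rule tau_bij[OF n])
    fix r assume r: "r \<in> S"
    let ?t = "tau (n - 1 - i) r"
    have "\<ominus> (x (n - 1 - i) \<otimes> ?t \<ominus> r \<otimes> x (n - 1 - i)) \<in> S"
      using sigma_diff[OF n tau_in[OF n r]] sigma_tau[OF n r] S_neg by simp
    also have "\<ominus> (x (n - 1 - i) \<otimes> ?t \<ominus> r \<otimes> x (n - 1 - i)) = r \<otimes> x (n - 1 - i) \<ominus> x (n - 1 - i) \<otimes> ?t"
      using n r tau_in[OF n r] by (simp add: a_minus_def minus_add S_closed x_closed a_comm)
    finally show "flip_var i \<otimes>\<^bsub>opp A\<^esub> r \<ominus>\<^bsub>opp A\<^esub> ?t \<otimes>\<^bsub>opp A\<^esub> flip_var i \<in> S" by (simp add: flip_var_def)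
  qed
  show "\<exists>c\<in>Units (opp A\<lparr>carrier := S\<rparr>). flip_var j \<otimes>\<^bsub>opp A\<^esub> flip_var i \<ominus>\<^bsub>opp A\<^esub> c \<otimes>\<^bsub>opp A\<^esub> flip_var i \<otimes>\<^bsub>opp A\<^esub> flip_var j \<in> O.low"
    if ij: "i < j" "j < n" for i j
  proof -
    let ?p = "n - 1 - i" and ?q = "n - 1 - j"
    have pq: "?q < ?p" "?p < n" "?q < n" using ij by auto
    obtain c where c: "c \<in> Units (A\<lparr>carrier := S\<rparr>)" "x ?p \<otimes> x ?q \<ominus> c \<otimes> x ?q \<otimes> x ?p \<in> low"
      using unit_ex[OF pq(1,2)] by blast
    have cS: "c \<in> S" using c(1) by (simp add: Units_def)
    let ?d = "tau ?p (tau ?q c)"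
    have d: "?d \<in> Units (A\<lparr>carrier := S\<rparr>)" using c(1) pq by (intro tau_unit)
    have dS: "?d \<in> S" using cS pq tau_in by blast
    have "(x ?p \<otimes> x ?q \<ominus> c \<otimes> x ?q \<otimes> x ?p) \<oplus> \<ominus> (x ?q \<otimes> (x ?p \<otimes> ?d) \<ominus> c \<otimes> x ?q \<otimes> x ?p) \<in> low"
      using c(2) x_x_tau_in_low[OF pq(3,2) cS] low_neg low_add by blast
    also have "(x ?p \<otimes> x ?q \<ominus> c \<otimes> x ?q \<otimes> x ?p) \<oplus> \<ominus> (x ?q \<otimes> (x ?p \<otimes> ?d) \<ominus> c \<otimes> x ?q \<otimes> x ?p)
      = x ?p \<otimes> x ?q \<ominus> x ?q \<otimes> (x ?p \<otimes> ?d)"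
      using cS dS pq by (intro minus_minus_cancel) (simp_all add: S_closed x_closed)
    finally show ?thesis using d unfolding opp_low Units_opp by (intro bexI[of _ ?d]) (simp_all add: flip_var_def)
  qed
  show "\<one>\<^bsub>opp A\<^esub> \<noteq> \<zero>\<^bsub>opp A\<^esub>" if "0 < n" using nontrivial that by simp
qed

end

section \<open>Tensor products of bijective skew PBW extensions\<close>

lemma addhom_minus:
  assumes "abelian_group G" "abelian_group H" "addhom G H f" "addhom G H g"
  shows "addhom G H (\<lambda>a. f a \<ominus>\<^bsub>H\<^esub> g a)"
proof -
  interpret G: abelian_group G by fact
  interpret H: abelian_group H by fact
  show ?thesis
    unfolding addhom_def
  proof (intro conjI ballI funcsetI)
    fix a b assume ab: "a \<in> carrier G" "b \<in> carrier G"
    have cl: "f a \<in> carrier H" "f b \<in> carrier H" "g a \<in> carrier H" "g b \<in> carrier H"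
      using ab addhom_closed[OF assms(3)] addhom_closed[OF assms(4)] by auto
    have "(f a \<oplus>\<^bsub>H\<^esub> f b) \<ominus>\<^bsub>H\<^esub> (g a \<oplus>\<^bsub>H\<^esub> g b) = (f a \<oplus>\<^bsub>H\<^esub> f b) \<oplus>\<^bsub>H\<^esub> (\<ominus>\<^bsub>H\<^esub> g a \<oplus>\<^bsub>H\<^esub> \<ominus>\<^bsub>H\<^esub> g b)"
      unfolding a_minus_def by (simp only: H.minus_add[OF cl(3,4)])
    also have "\<dots> = (f a \<ominus>\<^bsub>H\<^esub> g a) \<oplus>\<^bsub>H\<^esub> (f b \<ominus>\<^bsub>H\<^esub> g b)"
      unfolding a_minus_def using cl by (simp add: H.a_ac)
    finally show "f (a \<oplus>\<^bsub>G\<^esub> b) \<ominus>\<^bsub>H\<^esub> g (a \<oplus>\<^bsub>G\<^esub> b) = (f a \<ominus>\<^bsub>H\<^esub> g a) \<oplus>\<^bsub>H\<^esub> (f b \<ominus>\<^bsub>H\<^esub> g b)"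
      by (simp only: addhom_add[OF assms(3) ab] addhom_add[OF assms(4) ab])
  qed (simp add: addhom_closed[OF assms(3)] addhom_closed[OF assms(4)])
qed

text \<open>Functoriality for additive K-linear maps. Multiplicativity of \<open>f\<close> and
  \<open>g\<close> is not asked for, so that coordinate functions and inverse twists
  qualify.\<close>

lemma tensor_map:
  assumes "tensor_product K A B pA pB" "tensor_product K A' B' pA' pB'"
    and f: "addhom A A' f" "\<And>c a. c \<in> carrier K \<Longrightarrow> a \<in> carrier A \<Longrightarrow> f (pA c \<otimes>\<^bsub>A\<^esub> a) = pA' c \<otimes>\<^bsub>A'\<^esub> f a"
    and g: "addhom B B' g" "\<And>c b. c \<in> carrier K \<Longrightarrow> b \<in> carrier B \<Longrightarrow> g (pB c \<otimes>\<^bsub>B\<^esub> b) = pB' c \<otimes>\<^bsub>B'\<^esub> g b"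
  shows "\<exists>h. addhom (tensor K A B pA pB) (tensor K A' B' pA' pB') h \<and>
    (\<forall>a\<in>carrier A. \<forall>b\<in>carrier B. h (tensor_product.pure K A B pA pB a b) =
      tensor_product.pure K A' B' pA' pB' (f a) (g b))"
proof -
  interpret T: tensor_product K A B pA pB by fact
  interpret T': tensor_product K A' B' pA' pB' by fact
  note cl = addhom_closed[OF f(1)] addhom_closed[OF g(1)]
  have "T.balanced T'.E (\<lambda>a b. T'.pure (f a) (g b))"
    unfolding T.balanced_def
  proof (intro conjI ballI)
    fix a assume "a \<in> carrier A"
    then show "addhom B T'.E (\<lambda>b. T'.pure (f a) (g b))"
      by (intro addhom_comp[OF g(1) T'.pure_addhom_right] cl)
  next
    fix b assume "b \<in> carrier B"
    then show "addhom A T'.E (\<lambda>a. T'.pure (f a) (g b))"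
      by (intro addhom_comp[OF f(1) T'.pure_addhom_left] cl)
  next
    fix c a b assume "c \<in> carrier K" "a \<in> carrier A" "b \<in> carrier B"
    then show "T'.pure (f (pA c \<otimes>\<^bsub>A\<^esub> a)) (g b) = T'.pure (f a) (g (pB c \<otimes>\<^bsub>B\<^esub> b))"
      by (simp add: f(2) g(2) T'.pure_bal cl)
  qed
  then show ?thesis by (rule T.tensor_universal[OF T'.E.abelian_group_axioms])
qed

section \<open>The canonical map between tensor products induced by subrings\<close>

locale tensor_sub = big: tensor_product K A B phiA phiB
    + small: tensor_product K "A\<lparr>carrier := S\<rparr>" "B\<lparr>carrier := T\<rparr>" phiA phiB
  for K :: "('k, 'l) ring_scheme" and A :: "'a ring" and B :: "'b ring" and phiA phiB S T +
  assumes S_sub: "subring S A" and T_sub: "subring T B"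
begin

lemma S_carrier: "s \<in> S \<Longrightarrow> s \<in> carrier A"
  using subringE(1)[OF S_sub] by blast

lemma T_carrier: "t \<in> T \<Longrightarrow> t \<in> carrier B"
  using subringE(1)[OF T_sub] by blast

text \<open>A function supported on S \<times> T is also one supported on the larger product, so a
  representative is simply read again there; \<open>incl_cls\<close> removes the dependence on the
  choice. Injectivity has to wait for the coordinates.\<close>

definition incl :: "('a \<times> 'b \<Rightarrow> int) set \<Rightarrow> ('a \<times> 'b \<Rightarrow> int) set" where
  "incl U = big.cls (tens_rep U)"

lemma free_sub: "f \<in> small.free \<Longrightarrow> f \<in> big.free"
  using S_carrier T_carrier by (simp add: tens_free_def)

lemma rel_sub: "f \<in> small.rel \<Longrightarrow> f \<in> big.rel"
proof (induction rule: tens_rel.induct)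
  case (addl a a' b)
  then show ?case using tens_rel.addl[of a A a' b B] by (simp add: S_carrier T_carrier)
next
  case (addr a b b')
  then show ?case using tens_rel.addr[of a A b B b'] by (simp add: S_carrier T_carrier)
next
  case (bal c a b)
  then show ?case using tens_rel.bal[of c K a A b B] by (simp add: S_carrier T_carrier)
qed (auto intro: tens_rel.zero tens_rel.plus tens_rel.neg)

lemma incl_cls: "f \<in> small.free \<Longrightarrow> incl (small.cls f) = big.cls f"
  unfolding incl_def by (intro big.cls_eqI rel_sub small.rep_cls)

lemma incl_pure: "s \<in> S \<Longrightarrow> t \<in> T \<Longrightarrow> incl (small.pure s t) = big.pure s t"
  unfolding small.pure_def big.pure_def by (rule incl_cls) (simp add: delta_in_free)

lemma incl_hom: "incl \<in> ring_hom small.E big.E"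
proof (rule ring_hom_memI)
  fix u v assume "u \<in> carrier small.E" "v \<in> carrier small.E"
  then obtain f g where f: "f \<in> small.free" "u = small.cls f" and g: "g \<in> small.free" "v = small.cls g"
    by (auto simp: small.E_carrier)
  have conv: "small.conv f g = big.conv f g" by (simp add: tens_conv_def)
  show "incl u \<in> carrier big.E" using f free_sub by (auto simp: incl_cls big.E_carrier)
  show "incl (u \<otimes>\<^bsub>small.E\<^esub> v) = incl u \<otimes>\<^bsub>big.E\<^esub> incl v"
    using f g small.conv_free[OF f(1) g(1)] free_sub
    by (simp add: small.cls_mult big.cls_mult incl_cls conv)
  show "incl (u \<oplus>\<^bsub>small.E\<^esub> v) = incl u \<oplus>\<^bsub>big.E\<^esub> incl v"
    using f g free_sub add_in_free[OF f(1) g(1)] by (simp add: small.cls_add big.cls_add incl_cls)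
next
  show "incl \<one>\<^bsub>small.E\<^esub> = \<one>\<^bsub>big.E\<^esub>"
    using subringE(3)[OF S_sub] subringE(3)[OF T_sub] by (simp add: small.E_one big.E_one incl_pure)
qed

lemma incl_addhom: "addhom small.E big.E incl"
  using incl_hom by (simp add: addhom_def ring_hom_def Pi_iff)

lemma incl_closed: "u \<in> carrier small.E \<Longrightarrow> incl u \<in> carrier big.E"
  by (rule addhom_closed[OF incl_addhom])

abbreviation "I \<equiv> incl ` carrier small.E"

lemma I_subring: "subring I big.E"
proof -
  interpret h: ring_hom_ring small.E big.E incl
    by (rule ring_hom_ringI2[OF small.E.ring_axioms big.E.ring_axioms incl_hom])
  show ?thesis using h.img_is_subring[OF small.E.carrier_is_subring] by simp
qed

lemma pure_in_I: "s \<in> S \<Longrightarrow> t \<in> T \<Longrightarrow> big.pure s t \<in> I"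
  by (rule image_eqI[of _ incl "small.pure s t"]) (simp_all add: incl_pure small.pure_closed)

end

text \<open>The tensor product of two nonzero algebras can vanish, as that of Z/2 and Z/3 over Z
  does. So \<open>nontriv\<close> is an assumption here, to be discharged in the special case of an
  enveloping algebra.\<close>

locale tensor_pbw = tensor_sub K A B phiA phiB S T + P: bij_pbw A S n x + Q: bij_pbw B T m z
  for K :: "('k, 'l) ring_scheme" and A :: "'a ring" and B :: "'b ring" and phiA phiB S T n x m z +
  assumes nontriv: "0 < n + m \<Longrightarrow> \<one>\<^bsub>small.E\<^esub> \<noteq> \<zero>\<^bsub>small.E\<^esub>"
begin

lemma phiA_S: "c \<in> carrier K \<Longrightarrow> phiA c \<in> S"
  using small.phiA_closed by simp

lemma phiB_T: "c \<in> carrier K \<Longrightarrow> phiB c \<in> T"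
  using small.phiB_closed by simp

lemma coef_map: "\<exists>h. addhom big.E small.E h \<and>
  (\<forall>a\<in>carrier A. \<forall>b\<in>carrier B. h (big.pure a b) = small.pure (P.coef \<alpha> a) (Q.coef \<beta> b))"
proof (rule tensor_map[OF big.tensor_product_axioms small.tensor_product_axioms])
  show "addhom A (A\<lparr>carrier := S\<rparr>) (P.coef \<alpha>)"
    using P.coef_addhom[of \<alpha>] by (simp add: addhom_def P.coef_in)
  show "addhom B (B\<lparr>carrier := T\<rparr>) (Q.coef \<beta>)"
    using Q.coef_addhom[of \<beta>] by (simp add: addhom_def Q.coef_in)
qed (simp_all add: P.coef_smult Q.coef_smult phiA_S phiB_T)

text \<open>The map coef_\<alpha> \<otimes> coef_\<beta>. It is chosen because
  \<open>tensor_map\<close> asserts existence only.\<close>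

definition proj :: "(nat \<Rightarrow> nat) \<Rightarrow> (nat \<Rightarrow> nat) \<Rightarrow> ('a \<times> 'b \<Rightarrow> int) set \<Rightarrow> ('a \<times> 'b \<Rightarrow> int) set" where
  "proj \<alpha> \<beta> = (SOME h. addhom big.E small.E h \<and>
    (\<forall>a\<in>carrier A. \<forall>b\<in>carrier B. h (big.pure a b) = small.pure (P.coef \<alpha> a) (Q.coef \<beta> b)))"

lemma proj_addhom: "addhom big.E small.E (proj \<alpha> \<beta>)"
  and proj_pure: "a \<in> carrier A \<Longrightarrow> b \<in> carrier B \<Longrightarrow>
    proj \<alpha> \<beta> (big.pure a b) = small.pure (P.coef \<alpha> a) (Q.coef \<beta> b)"
  using someI_ex[OF coef_map[of \<alpha> \<beta>]] by (simp_all flip: proj_def)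

lemma incl_mult_pure:
  assumes "s \<in> S" "t \<in> T" "a \<in> carrier A" "b \<in> carrier B"
  shows "incl (small.pure s t) \<otimes>\<^bsub>big.E\<^esub> big.pure a b = big.pure (s \<otimes>\<^bsub>A\<^esub> a) (t \<otimes>\<^bsub>B\<^esub> b)"
  using assms by (simp add: incl_pure big.pure_mult S_carrier T_carrier)

text \<open>Duality between the projections and the products of monomials. Both sides are additive
  in \<open>u\<close>, so u = s \<otimes> t may be assumed; there a mismatch in either exponent
  replaces one tensor factor by zero.\<close>

lemma proj_term:
  assumes u: "u \<in> carrier small.E" and e: "\<alpha>' \<in> expo n" "\<beta>' \<in> expo m"
  shows "proj \<alpha> \<beta> (incl u \<otimes>\<^bsub>big.E\<^esub> big.pure (P.M \<alpha>') (Q.M \<beta>')) =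
    (if \<alpha> = \<alpha>' \<and> \<beta> = \<beta>' then u else \<zero>\<^bsub>small.E\<^esub>)"
proof (rule addhom_eq[OF small.E.abelian_group_axioms small.E.abelian_group_axioms _ _
      small.pures_closed _ small.tensor_generated[OF u]])
  have M: "big.pure (P.M \<alpha>') (Q.M \<beta>') \<in> carrier big.E"
    by (intro big.pure_closed P.mon_closed Q.mon_closed)
  show "addhom small.E small.E (\<lambda>u. proj \<alpha> \<beta> (incl u \<otimes>\<^bsub>big.E\<^esub> big.pure (P.M \<alpha>') (Q.M \<beta>')))"
    by (rule addhom_comp[OF addhom_comp[OF incl_addhom big.E.addhom_r_mult[OF M]] proj_addhom])
  show "addhom small.E small.E (\<lambda>u. if \<alpha> = \<alpha>' \<and> \<beta> = \<beta>' then u else \<zero>\<^bsub>small.E\<^esub>)"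
    by (cases "\<alpha> = \<alpha>' \<and> \<beta> = \<beta>'") (auto simp: addhom_def)
  fix u assume "u \<in> small.pures"
  then obtain s t where st: "s \<in> S" "t \<in> T" "u = small.pure s t" by (auto simp: small.pures_def)
  then show "proj \<alpha> \<beta> (incl u \<otimes>\<^bsub>big.E\<^esub> big.pure (P.M \<alpha>') (Q.M \<beta>')) =
    (if \<alpha> = \<alpha>' \<and> \<beta> = \<beta>' then u else \<zero>\<^bsub>small.E\<^esub>)"
    using small.pure_zero_left small.pure_zero_right P.S_zero Q.S_zero e
    by (simp add: incl_mult_pure P.mon_closed Q.mon_closed proj_pure P.term_closed Q.term_closed
        P.coef_term Q.coef_term)
qed

lemma proj_incl:
  assumes "u \<in> carrier small.E" shows "proj (\<lambda>_. 0) (\<lambda>_. 0) (incl u) = u"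
  using proj_term[OF assms expo_zero expo_zero, of "\<lambda>_. 0" "\<lambda>_. 0"] incl_closed[OF assms]
  by (simp add: P.mon_zero Q.mon_zero big.E_one[symmetric])

lemma incl_inj: "inj_on incl (carrier small.E)"
  by (rule inj_on_inverseI) (rule proj_incl)

section \<open>Monomials in the two families of variables\<close>

definition var :: "nat \<Rightarrow> ('a \<times> 'b \<Rightarrow> int) set" where
  "var i = (if i < n then big.pure (x i) \<one>\<^bsub>B\<^esub> else big.pure \<one>\<^bsub>A\<^esub> (z (i - n)))"

lemma var_closed: "i < n + m \<Longrightarrow> var i \<in> carrier big.E"
  by (auto simp: var_def intro!: big.pure_closed P.x_closed Q.x_closed)

sublocale W: monomials big.E I "n + m" var
  by (intro monomials.intro monomials_axioms.intro big.E.ring_axioms I_subring var_closed)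

lemma pure_pow:
  "a \<in> carrier A \<Longrightarrow> big.pure a \<one>\<^bsub>B\<^esub> [^]\<^bsub>big.E\<^esub> (k::nat) = big.pure (a [^]\<^bsub>A\<^esub> k) \<one>\<^bsub>B\<^esub>"
  "b \<in> carrier B \<Longrightarrow> big.pure \<one>\<^bsub>A\<^esub> b [^]\<^bsub>big.E\<^esub> (k::nat) = big.pure \<one>\<^bsub>A\<^esub> (b [^]\<^bsub>B\<^esub> k)"
  by (induction k) (simp_all add: big.E_one big.pure_mult)

lemma monl_pure:
  "(\<And>i. i \<in> set xs \<Longrightarrow> u i \<in> carrier A) \<Longrightarrow>
    monl big.E xs (\<lambda>i. big.pure (u i) \<one>\<^bsub>B\<^esub>) \<gamma> = big.pure (monl A xs u \<gamma>) \<one>\<^bsub>B\<^esub>"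
  "(\<And>i. i \<in> set xs \<Longrightarrow> v i \<in> carrier B) \<Longrightarrow>
    monl big.E xs (\<lambda>i. big.pure \<one>\<^bsub>A\<^esub> (v i)) \<gamma> = big.pure \<one>\<^bsub>A\<^esub> (monl B xs v \<gamma>)"
  by (induction xs)
    (simp_all add: monl_Nil monl_Cons big.E_one pure_pow big.pure_mult big.A.monl_closed big.B.monl_closed)

text \<open>Exponents in n + m variables are pairs of exponents. Cutting off at n puts the left half
  in \<open>expo n\<close> whatever \<gamma> is, whereas the right half inherits its bound from
  \<gamma>.\<close>

definition lhalf :: "(nat \<Rightarrow> nat) \<Rightarrow> nat \<Rightarrow> nat" where
  "lhalf \<gamma> i = (if i < n then \<gamma> i else 0)"

definition rhalf :: "(nat \<Rightarrow> nat) \<Rightarrow> nat \<Rightarrow> nat" where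
  "rhalf \<gamma> i = \<gamma> (n + i)"

definition join :: "(nat \<Rightarrow> nat) \<Rightarrow> (nat \<Rightarrow> nat) \<Rightarrow> nat \<Rightarrow> nat" where
  "join \<alpha> \<beta> i = (if i < n then \<alpha> i else \<beta> (i - n))"

lemma halves_in: "lhalf \<gamma> \<in> expo n" "\<gamma> \<in> expo (n + m) \<Longrightarrow> rhalf \<gamma> \<in> expo m"
  by (auto simp: expo_def lhalf_def rhalf_def)

lemma join_in: "\<beta> \<in> expo m \<Longrightarrow> join \<alpha> \<beta> \<in> expo (n + m)"
  by (auto simp: expo_def join_def)

lemma halves_join: "\<alpha> \<in> expo n \<Longrightarrow> lhalf (join \<alpha> \<beta>) = \<alpha>" "rhalf (join \<alpha> \<beta>) = \<beta>"
  by (auto simp: expo_def lhalf_def rhalf_def join_def fun_eq_iff)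

lemma halves_eqD:
  assumes "lhalf \<gamma> = lhalf \<gamma>'" "rhalf \<gamma> = rhalf \<gamma>'" shows "\<gamma> = \<gamma>'"
proof
  fix i
  show "\<gamma> i = \<gamma>' i"
  proof (cases "i < n")
    case True then show ?thesis using fun_cong[OF assms(1), of i] by (simp add: lhalf_def)
  next
    case False then show ?thesis using fun_cong[OF assms(2), of "i - n"] by (simp add: rhalf_def)
  qed
qed

lemma W_mon: "W.M \<gamma> = big.pure (P.M (lhalf \<gamma>)) (Q.M (rhalf \<gamma>))"
proof -
  have split: "[0..<n + m] = [0..<n] @ map (\<lambda>i. n + i) [0..<m]"
    by (rule nth_equalityI) (simp_all add: nth_append)
  have "W.M \<gamma> = monl big.E [0..<n] var \<gamma> \<otimes>\<^bsub>big.E\<^esub> monl big.E (map (\<lambda>i. n + i) [0..<m]) var \<gamma>"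
    unfolding mon_monl split by (rule big.E.monl_append) (auto intro: var_closed)
  also have "monl big.E [0..<n] var \<gamma> = monl big.E [0..<n] (\<lambda>i. big.pure (x i) \<one>\<^bsub>B\<^esub>) (lhalf \<gamma>)"
    by (rule big.E.monl_cong) (simp add: var_def lhalf_def)
  also have "\<dots> = big.pure (P.M (lhalf \<gamma>)) \<one>\<^bsub>B\<^esub>"
    unfolding mon_monl by (rule monl_pure) (simp add: P.x_closed)
  also have "monl big.E (map (\<lambda>i. n + i) [0..<m]) var \<gamma> = monl big.E [0..<m] (\<lambda>i. big.pure \<one>\<^bsub>A\<^esub> (z i)) (rhalf \<gamma>)"
    unfolding monl_map by (rule big.E.monl_cong) (simp add: var_def rhalf_def)
  also have "\<dots> = big.pure \<one>\<^bsub>A\<^esub> (Q.M (rhalf \<gamma>))"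
    unfolding mon_monl by (rule monl_pure) (simp add: Q.x_closed)
  finally show ?thesis by (simp add: big.pure_mult P.mon_closed Q.mon_closed)
qed

text \<open>One tensor factor is expanded at a time: first an arbitrary left factor against a single
  term on the right, then an arbitrary right factor.\<close>

lemma W_generated:
  assumes "u \<in> carrier big.E" shows "u \<in> acl big.E W.terms"
proof -
  have pure: "big.pure (s \<otimes>\<^bsub>A\<^esub> P.M \<alpha>) (t \<otimes>\<^bsub>B\<^esub> Q.M \<beta>) \<in> W.terms"
    if "s \<in> S" "t \<in> T" "\<alpha> \<in> expo n" "\<beta> \<in> expo m" for s t \<alpha> \<beta>
    unfolding W.terms_def using that pure_in_I[OF that(1,2)] join_in[OF that(4), of \<alpha>]
    by (intro CollectI exI[of _ "big.pure s t"] exI[of _ "join \<alpha> \<beta>"])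
      (simp add: W_mon halves_join big.pure_mult P.mon_closed Q.mon_closed S_carrier T_carrier)
  have left: "big.pure a (t \<otimes>\<^bsub>B\<^esub> Q.M \<beta>) \<in> acl big.E W.terms"
    if "a \<in> carrier A" "t \<in> T" "\<beta> \<in> expo m" for a t \<beta>
    by (rule addhom_acl[OF big.A.abelian_group_axioms big.E.abelian_group_axioms
          big.pure_addhom_left[OF Q.term_closed[OF that(2)]] P.terms_closed _ P.generated[OF that(1)]])
      (use that in \<open>auto simp: P.terms_def intro!: acl.base pure\<close>)
  have "big.pure a b \<in> acl big.E W.terms" if "a \<in> carrier A" "b \<in> carrier B" for a b
    by (rule addhom_acl[OF big.B.abelian_group_axioms big.E.abelian_group_axioms
          big.pure_addhom_right[OF that(1)] Q.terms_closed _ Q.generated[OF that(2)]])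
      (use that in \<open>auto simp: Q.terms_def intro!: left\<close>)
  then have "big.pures \<subseteq> acl big.E W.terms" by (auto simp: big.pures_def)
  then show ?thesis by (rule acl_mono[OF big.tensor_generated[OF assms]])
qed

lemma incl_zero: "incl \<zero>\<^bsub>small.E\<^esub> = \<zero>\<^bsub>big.E\<^esub>"
  by (rule addhom_zero[OF small.E.abelian_group_axioms big.E.abelian_group_axioms incl_addhom])

text \<open>The functional for \<gamma> does not return the coefficient \<open>incl u\<close> but
  its preimage u; if u vanishes, so does the coefficient.\<close>

lemma W_independent:
  assumes "c \<in> coeffs big.E I (n + m)" "lin_comb big.E (n + m) var c = \<zero>\<^bsub>big.E\<^esub>"
  shows "c = (\<lambda>_. \<zero>\<^bsub>big.E\<^esub>)"
proof (rule W.independentI[OF _ small.E.abelian_group_axioms assms])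
  fix \<gamma> assume \<gamma>: "\<gamma> \<in> expo (n + m)"
  have "\<not> (lhalf \<gamma> = lhalf \<gamma>' \<and> rhalf \<gamma> = rhalf \<gamma>')" if "\<gamma>' \<noteq> \<gamma>" for \<gamma>'
    using halves_eqD that by blast
  then show "\<exists>h. addhom big.E small.E h \<and>
      (\<forall>s\<in>I. h (s \<otimes>\<^bsub>big.E\<^esub> W.M \<gamma>) = \<zero>\<^bsub>small.E\<^esub> \<longrightarrow> s = \<zero>\<^bsub>big.E\<^esub>) \<and>
      (\<forall>s\<in>I. \<forall>\<beta>\<in>expo (n + m). \<beta> \<noteq> \<gamma> \<longrightarrow> h (s \<otimes>\<^bsub>big.E\<^esub> W.M \<beta>) = \<zero>\<^bsub>small.E\<^esub>)"
    using \<gamma> proj_addhom incl_zero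
    by (intro exI[of _ "proj (lhalf \<gamma>) (rhalf \<gamma>)"]) (auto simp: W_mon proj_term halves_in)
qed

lemma minus_pure:
  "a \<in> carrier A \<Longrightarrow> a' \<in> carrier A \<Longrightarrow> b \<in> carrier B \<Longrightarrow>
    big.pure (a \<ominus>\<^bsub>A\<^esub> a') b = big.pure a b \<ominus>\<^bsub>big.E\<^esub> big.pure a' b"
  "a \<in> carrier A \<Longrightarrow> b \<in> carrier B \<Longrightarrow> b' \<in> carrier B \<Longrightarrow>
    big.pure a (b \<ominus>\<^bsub>B\<^esub> b') = big.pure a b \<ominus>\<^bsub>big.E\<^esub> big.pure a b'"
  using addhom_neg[OF big.B.abelian_group_axioms big.E.abelian_group_axioms big.pure_addhom_right]
  by (simp_all add: a_minus_def big.pure_add_left big.pure_add_right big.pure_neg_left)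

lemma low_pure_left: "a \<in> P.low \<Longrightarrow> big.pure a \<one>\<^bsub>B\<^esub> \<in> W.low"
  unfolding P.low_def
proof (erule addhom_acl[OF big.A.abelian_group_axioms big.E.abelian_group_axioms
      big.pure_addhom_left[OF big.B.one_closed] P.low_gens_closed, where Z = "I \<union> {s \<otimes>\<^bsub>big.E\<^esub> var l | s l. s \<in> I \<and> l < n + m}", folded W.low_def, rotated])
  fix a assume "a \<in> S \<union> {s \<otimes>\<^bsub>A\<^esub> x l | s l. s \<in> S \<and> l < n}"
  then consider "a \<in> S" | s l where "s \<in> S" "l < n" "a = s \<otimes>\<^bsub>A\<^esub> x l" by auto
  then show "big.pure a \<one>\<^bsub>B\<^esub> \<in> W.low"
  proof cases
    case 1 then show ?thesis by (intro W.low_S pure_in_I Q.S_one)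
  next
    case 2
    then have "big.pure a \<one>\<^bsub>B\<^esub> = big.pure s \<one>\<^bsub>B\<^esub> \<otimes>\<^bsub>big.E\<^esub> var l"
      by (simp add: var_def big.pure_mult S_carrier P.x_closed)
    then show ?thesis using W.low_x[OF pure_in_I[OF _ Q.S_one], of s l] 2 by simp
  qed
qed

lemma low_pure_right: "b \<in> Q.low \<Longrightarrow> big.pure \<one>\<^bsub>A\<^esub> b \<in> W.low"
  unfolding Q.low_def
proof (erule addhom_acl[OF big.B.abelian_group_axioms big.E.abelian_group_axioms
      big.pure_addhom_right[OF big.A.one_closed] Q.low_gens_closed, where Z = "I \<union> {s \<otimes>\<^bsub>big.E\<^esub> var l | s l. s \<in> I \<and> l < n + m}", folded W.low_def, rotated])
  fix b assume "b \<in> T \<union> {s \<otimes>\<^bsub>B\<^esub> z l | s l. s \<in> T \<and> l < m}"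
  then consider "b \<in> T" | s l where "s \<in> T" "l < m" "b = s \<otimes>\<^bsub>B\<^esub> z l" by auto
  then show "big.pure \<one>\<^bsub>A\<^esub> b \<in> W.low"
  proof cases
    case 1 then show ?thesis by (intro W.low_S pure_in_I P.S_one)
  next
    case 2
    then have "big.pure \<one>\<^bsub>A\<^esub> b = big.pure \<one>\<^bsub>A\<^esub> s \<otimes>\<^bsub>big.E\<^esub> var (n + l)"
      by (simp add: var_def big.pure_mult T_carrier Q.x_closed)
    then show ?thesis using W.low_x[OF pure_in_I[OF P.S_one], of s "n + l"] 2 by simp
  qed
qed

lemma pure_unit:
  assumes "c \<in> Units (A\<lparr>carrier := S\<rparr>)" "d \<in> Units (B\<lparr>carrier := T\<rparr>)"
  shows "big.pure c d \<in> Units (big.E\<lparr>carrier := I\<rparr>)"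
proof -
  obtain c' where c: "c \<in> S" "c' \<in> S" "c' \<otimes>\<^bsub>A\<^esub> c = \<one>\<^bsub>A\<^esub>" "c \<otimes>\<^bsub>A\<^esub> c' = \<one>\<^bsub>A\<^esub>"
    using assms(1) by (auto simp: Units_def)
  obtain d' where d: "d \<in> T" "d' \<in> T" "d' \<otimes>\<^bsub>B\<^esub> d = \<one>\<^bsub>B\<^esub>" "d \<otimes>\<^bsub>B\<^esub> d' = \<one>\<^bsub>B\<^esub>"
    using assms(2) by (auto simp: Units_def)
  have "big.pure c' d' \<otimes>\<^bsub>big.E\<^esub> big.pure c d = \<one>\<^bsub>big.E\<^esub>"
    "big.pure c d \<otimes>\<^bsub>big.E\<^esub> big.pure c' d' = \<one>\<^bsub>big.E\<^esub>"
    using c d by (simp_all add: big.pure_mult S_carrier T_carrier big.E_one)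
  then show ?thesis using pure_in_I[OF c(1) d(1)] pure_in_I[OF c(2) d(2)] unfolding Units_def
    by (intro CollectI conjI bexI[of _ "big.pure c' d'"]) simp_all
qed

lemma one_unit:
  "\<one>\<^bsub>A\<^esub> \<in> Units (A\<lparr>carrier := S\<rparr>)" "\<one>\<^bsub>B\<^esub> \<in> Units (B\<lparr>carrier := T\<rparr>)"
  using P.S_one Q.S_one by (auto simp: Units_def intro: bexI[of _ "\<one>\<^bsub>A\<^esub>"] bexI[of _ "\<one>\<^bsub>B\<^esub>"])

text \<open>Within one family the relation is the given one tensored with 1. Variables of different
  families commute exactly, so there the constant is 1 and the remainder 0.\<close>

lemma W_unit_ex:
  assumes ij: "i < j" "j < n + m"
  shows "\<exists>c\<in>Units (big.E\<lparr>carrier := I\<rparr>). var j \<otimes>\<^bsub>big.E\<^esub> var i \<ominus>\<^bsub>big.E\<^esub> c \<otimes>\<^bsub>big.E\<^esub> var i \<otimes>\<^bsub>big.E\<^esub> var j \<in> W.low"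
proof -
  consider "j < n" | "i < n" "n \<le> j" | "n \<le> i" by linarith
  then show ?thesis
  proof cases
    case 1
    then obtain c where c: "c \<in> Units (A\<lparr>carrier := S\<rparr>)"
      "x j \<otimes>\<^bsub>A\<^esub> x i \<ominus>\<^bsub>A\<^esub> c \<otimes>\<^bsub>A\<^esub> x i \<otimes>\<^bsub>A\<^esub> x j \<in> P.low" using P.unit_ex ij by blast
    have "c \<in> carrier A" using c(1) S_carrier by (auto simp: Units_def)
    then have "var j \<otimes>\<^bsub>big.E\<^esub> var i \<ominus>\<^bsub>big.E\<^esub> big.pure c \<one>\<^bsub>B\<^esub> \<otimes>\<^bsub>big.E\<^esub> var i \<otimes>\<^bsub>big.E\<^esub> var j =
      big.pure (x j \<otimes>\<^bsub>A\<^esub> x i \<ominus>\<^bsub>A\<^esub> c \<otimes>\<^bsub>A\<^esub> x i \<otimes>\<^bsub>A\<^esub> x j) \<one>\<^bsub>B\<^esub>"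
      using 1 ij by (simp add: var_def big.pure_mult minus_pure P.x_closed)
    then show ?thesis using low_pure_left[OF c(2)] pure_unit[OF c(1) one_unit(2)]
      by (intro bexI[of _ "big.pure c \<one>\<^bsub>B\<^esub>"]) simp_all
  next
    case 2
    then have "j - n < m" using ij by simp
    then have "var j \<otimes>\<^bsub>big.E\<^esub> var i \<ominus>\<^bsub>big.E\<^esub> \<one>\<^bsub>big.E\<^esub> \<otimes>\<^bsub>big.E\<^esub> var i \<otimes>\<^bsub>big.E\<^esub> var j = \<zero>\<^bsub>big.E\<^esub>"
      using 2 by (simp add: var_def big.pure_mult big.E_one P.x_closed Q.x_closed big.pure_closed a_minus_def big.E.r_neg)
    then show ?thesis using W.low_S[OF W.S_zero] pure_unit[OF one_unit]
      by (intro bexI[of _ "\<one>\<^bsub>big.E\<^esub>"]) (simp_all add: big.E_one)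
  next
    case 3
    then have ij': "i - n < j - n" "j - n < m" "\<not> i < n" "\<not> j < n" using ij by auto
    obtain c where c: "c \<in> Units (B\<lparr>carrier := T\<rparr>)"
      "z (j - n) \<otimes>\<^bsub>B\<^esub> z (i - n) \<ominus>\<^bsub>B\<^esub> c \<otimes>\<^bsub>B\<^esub> z (i - n) \<otimes>\<^bsub>B\<^esub> z (j - n) \<in> Q.low"
      using Q.unit_ex[OF ij'(1,2)] by blast
    have "c \<in> carrier B" using c(1) T_carrier by (auto simp: Units_def)
    moreover have "z (i - n) \<in> carrier B" "z (j - n) \<in> carrier B" using ij' Q.x_closed by auto
    ultimately have "var j \<otimes>\<^bsub>big.E\<^esub> var i \<ominus>\<^bsub>big.E\<^esub> big.pure \<one>\<^bsub>A\<^esub> c \<otimes>\<^bsub>big.E\<^esub> var i \<otimes>\<^bsub>big.E\<^esub> var j =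
      big.pure \<one>\<^bsub>A\<^esub> (z (j - n) \<otimes>\<^bsub>B\<^esub> z (i - n) \<ominus>\<^bsub>B\<^esub> c \<otimes>\<^bsub>B\<^esub> z (i - n) \<otimes>\<^bsub>B\<^esub> z (j - n))"
      using ij' by (simp add: var_def big.pure_mult minus_pure)
    then show ?thesis using low_pure_right[OF c(2)] pure_unit[OF one_unit(1) c(1)]
      by (intro bexI[of _ "big.pure \<one>\<^bsub>A\<^esub> c"]) simp_all
  qed
qed

text \<open>Twists are easy to build on the small tensor product by functoriality, but the
  definition wants them on its image \<open>I\<close>. This transfers them, with all conditions
  tested on pure tensors only.\<close>

lemma sigma_from_map:
  assumes i: "i < n + m" and h: "addhom small.E small.E h" and h': "addhom small.E small.E h'"
    and inv: "\<And>s t. s \<in> S \<Longrightarrow> t \<in> T \<Longrightarrow> h' (h (small.pure s t)) = small.pure s t"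
      "\<And>s t. s \<in> S \<Longrightarrow> t \<in> T \<Longrightarrow> h (h' (small.pure s t)) = small.pure s t"
    and comm: "\<And>s t. s \<in> S \<Longrightarrow> t \<in> T \<Longrightarrow>
      var i \<otimes>\<^bsub>big.E\<^esub> incl (small.pure s t) \<ominus>\<^bsub>big.E\<^esub> incl (h (small.pure s t)) \<otimes>\<^bsub>big.E\<^esub> var i \<in> I"
  shows "\<exists>\<sigma>. bij_betw \<sigma> I I \<and> (\<forall>r\<in>I. var i \<otimes>\<^bsub>big.E\<^esub> r \<ominus>\<^bsub>big.E\<^esub> \<sigma> r \<otimes>\<^bsub>big.E\<^esub> var i \<in> I)"
proof -
  note gr = small.E.abelian_group_axioms big.E.abelian_group_axioms
  have id: "f u = u" if "addhom small.E small.E f" "u \<in> carrier small.E"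
    "\<And>s t. s \<in> S \<Longrightarrow> t \<in> T \<Longrightarrow> f (small.pure s t) = small.pure s t" for f u
  proof (rule addhom_eq[OF gr(1) gr(1) that(1) addhom_id small.pures_closed _ small.tensor_generated[OF that(2)]])
    fix a assume "a \<in> small.pures"
    then obtain s t where "s \<in> S" "t \<in> T" "a = small.pure s t" by (auto simp: small.pures_def)
    then show "f a = a" using that(3) by simp
  qed
  have bij: "bij_betw h (carrier small.E) (carrier small.E)"
  proof (rule bij_betw_byWitness[of _ h'])
    show "\<forall>u\<in>carrier small.E. h' (h u) = u" using id[OF addhom_comp[OF h h']] inv by blast
    show "\<forall>u\<in>carrier small.E. h (h' u) = u" using id[OF addhom_comp[OF h' h]] inv by blast
    show "h ` carrier small.E \<subseteq> carrier small.E" "h' ` carrier small.E \<subseteq> carrier small.E"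
      using addhom_closed[OF h] addhom_closed[OF h'] by blast+
  qed
  have bij_incl: "bij_betw incl (carrier small.E) I" by (rule inj_on_imp_bij_betw[OF incl_inj])
  \<comment> \<open>The conjugate of \<open>h\<close> by \<open>incl\<close>: on \<open>I\<close>,
    the projection at the zero exponents is the inverse of \<open>incl\<close>.\<close>
  let ?\<sigma> = "incl \<circ> (h \<circ> proj (\<lambda>_. 0) (\<lambda>_. 0))"
  have "bij_betw (proj (\<lambda>_. 0) (\<lambda>_. 0)) I (carrier small.E)"
    by (rule bij_betw_byWitness[of _ incl]) (simp_all add: proj_incl image_image)
  then have bij_\<sigma>: "bij_betw ?\<sigma> I I"
    by (rule bij_betw_trans[OF bij_betw_trans[OF _ bij] bij_incl])
  have "var i \<otimes>\<^bsub>big.E\<^esub> r \<ominus>\<^bsub>big.E\<^esub> ?\<sigma> r \<otimes>\<^bsub>big.E\<^esub> var i \<in> I" if "r \<in> I" for r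
  proof -
    from that obtain u where u: "r = incl u" "u \<in> carrier small.E" by (rule imageE)
    have "var i \<otimes>\<^bsub>big.E\<^esub> incl u \<ominus>\<^bsub>big.E\<^esub> incl (h u) \<otimes>\<^bsub>big.E\<^esub> var i \<in> acl big.E I"
    proof (rule addhom_acl[OF gr _ small.pures_closed _ small.tensor_generated[OF u(2)]])
      show "addhom small.E big.E (\<lambda>u. var i \<otimes>\<^bsub>big.E\<^esub> incl u \<ominus>\<^bsub>big.E\<^esub> incl (h u) \<otimes>\<^bsub>big.E\<^esub> var i)"
        by (intro addhom_minus gr addhom_comp[OF incl_addhom big.E.addhom_l_mult]
            addhom_comp[OF addhom_comp[OF h incl_addhom] big.E.addhom_r_mult] var_closed i)
      fix a assume "a \<in> small.pures"
      then obtain s t where "s \<in> S" "t \<in> T" "a = small.pure s t" by (auto simp: small.pures_def)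
      then show "var i \<otimes>\<^bsub>big.E\<^esub> incl a \<ominus>\<^bsub>big.E\<^esub> incl (h a) \<otimes>\<^bsub>big.E\<^esub> var i \<in> acl big.E I"
        using comm by (simp only: acl.base)
    qed
    moreover have "a \<in> acl big.E I \<Longrightarrow> a \<in> I" for a
      by (induction rule: acl.induct) (blast intro: W.S_zero W.S_add)+
    ultimately show ?thesis using u by (simp add: proj_incl)
  qed
  with bij_\<sigma> show ?thesis by (intro exI[of _ ?\<sigma>] conjI ballI)
qed

text \<open>The map f \<otimes> id, chosen for the same reason as \<open>proj\<close>;
  \<open>right_map\<close> is id \<otimes> g.\<close>

definition left_map :: "('a \<Rightarrow> 'a) \<Rightarrow> ('a \<times> 'b \<Rightarrow> int) set \<Rightarrow> ('a \<times> 'b \<Rightarrow> int) set" where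
  "left_map f = (SOME h. addhom small.E small.E h \<and> (\<forall>s\<in>S. \<forall>t\<in>T. h (small.pure s t) = small.pure (f s) t))"

definition right_map :: "('b \<Rightarrow> 'b) \<Rightarrow> ('a \<times> 'b \<Rightarrow> int) set \<Rightarrow> ('a \<times> 'b \<Rightarrow> int) set" where
  "right_map g = (SOME h. addhom small.E small.E h \<and> (\<forall>s\<in>S. \<forall>t\<in>T. h (small.pure s t) = small.pure s (g t)))"

lemma left_map:
  assumes "\<And>s. s \<in> S \<Longrightarrow> f s \<in> S" "\<And>r s. r \<in> S \<Longrightarrow> s \<in> S \<Longrightarrow> f (r \<oplus>\<^bsub>A\<^esub> s) = f r \<oplus>\<^bsub>A\<^esub> f s"
    and "\<And>c s. c \<in> carrier K \<Longrightarrow> s \<in> S \<Longrightarrow> f (phiA c \<otimes>\<^bsub>A\<^esub> s) = phiA c \<otimes>\<^bsub>A\<^esub> f s"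
  shows "addhom small.E small.E (left_map f)"
    and "s \<in> S \<Longrightarrow> t \<in> T \<Longrightarrow> left_map f (small.pure s t) = small.pure (f s) t"
proof -
  have "addhom (A\<lparr>carrier := S\<rparr>) (A\<lparr>carrier := S\<rparr>) f" using assms by (simp add: addhom_def)
  then have "\<exists>h. addhom small.E small.E h \<and> (\<forall>s\<in>S. \<forall>t\<in>T. h (small.pure s t) = small.pure (f s) t)"
    using tensor_map[OF small.tensor_product_axioms small.tensor_product_axioms _ _ addhom_id, of f] assms(3) by simp
  from someI_ex[OF this] show "addhom small.E small.E (left_map f)"
    "s \<in> S \<Longrightarrow> t \<in> T \<Longrightarrow> left_map f (small.pure s t) = small.pure (f s) t"
    by (simp_all flip: left_map_def)
qed

lemma right_map:
  assumes "\<And>t. t \<in> T \<Longrightarrow> g t \<in> T" "\<And>r t. r \<in> T \<Longrightarrow> t \<in> T \<Longrightarrow> g (r \<oplus>\<^bsub>B\<^esub> t) = g r \<oplus>\<^bsub>B\<^esub> g t"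
    and "\<And>c t. c \<in> carrier K \<Longrightarrow> t \<in> T \<Longrightarrow> g (phiB c \<otimes>\<^bsub>B\<^esub> t) = phiB c \<otimes>\<^bsub>B\<^esub> g t"
  shows "addhom small.E small.E (right_map g)"
    and "s \<in> S \<Longrightarrow> t \<in> T \<Longrightarrow> right_map g (small.pure s t) = small.pure s (g t)"
proof -
  have "addhom (B\<lparr>carrier := T\<rparr>) (B\<lparr>carrier := T\<rparr>) g" using assms by (simp add: addhom_def)
  then have "\<exists>h. addhom small.E small.E h \<and> (\<forall>s\<in>S. \<forall>t\<in>T. h (small.pure s t) = small.pure s (g t))"
    using tensor_map[OF small.tensor_product_axioms small.tensor_product_axioms addhom_id, of g] assms(3) by simp
  from someI_ex[OF this] show "addhom small.E small.E (right_map g)"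
    "s \<in> S \<Longrightarrow> t \<in> T \<Longrightarrow> right_map g (small.pure s t) = small.pure s (g t)"
    by (simp_all flip: right_map_def)
qed

text \<open>The inverse of \<sigma>_i \<otimes> id is \<tau>_i \<otimes> id. On s \<otimes> t the
  remainder is \<delta>_i(s) \<otimes> t, with \<delta>_i the derivation attached to x_i, and this
  lies in \<open>I\<close>.\<close>

lemma sigma_map_left:
  assumes i: "i < n"
  shows "\<exists>\<sigma>. bij_betw \<sigma> I I \<and> (\<forall>r\<in>I. var i \<otimes>\<^bsub>big.E\<^esub> r \<ominus>\<^bsub>big.E\<^esub> \<sigma> r \<otimes>\<^bsub>big.E\<^esub> var i \<in> I)"
proof -
  have lin: "P.sigma i (phiA c \<otimes>\<^bsub>A\<^esub> s) = phiA c \<otimes>\<^bsub>A\<^esub> P.sigma i s" if "c \<in> carrier K" "s \<in> S" for c s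
    using P.sigma_central[OF i phiA_S[OF that(1)] that(2)] big.phiA_comm[OF that(1)] by blast
  note sm = left_map[of "P.sigma i", OF P.sigma_in[OF i] P.sigma_add[OF i] lin]
  have lin': "P.tau i (phiA c \<otimes>\<^bsub>A\<^esub> s) = phiA c \<otimes>\<^bsub>A\<^esub> P.tau i s" if "c \<in> carrier K" "s \<in> S" for c s
    by (rule P.tau_linear[OF i phiA_S[OF that(1)] lin[OF that(1)] that(2)])
  note tm = left_map[of "P.tau i", OF P.tau_in[OF i] P.tau_add[OF i] lin']
  show ?thesis
  proof (rule sigma_from_map[OF _ sm(1) tm(1)])
    fix s t assume st: "s \<in> S" "t \<in> T"
    show "left_map (P.tau i) (left_map (P.sigma i) (small.pure s t)) = small.pure s t"
      using st i by (simp add: sm(2) tm(2) P.sigma_in P.tau_sigma)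
    show "left_map (P.sigma i) (left_map (P.tau i) (small.pure s t)) = small.pure s t"
      using st i by (simp add: sm(2) tm(2) P.tau_in P.sigma_tau)
    have "var i \<otimes>\<^bsub>big.E\<^esub> incl (small.pure s t) \<ominus>\<^bsub>big.E\<^esub> incl (left_map (P.sigma i) (small.pure s t)) \<otimes>\<^bsub>big.E\<^esub> var i
      = big.pure (x i \<otimes>\<^bsub>A\<^esub> s \<ominus>\<^bsub>A\<^esub> P.sigma i s \<otimes>\<^bsub>A\<^esub> x i) t"
      using st i by (simp add: sm(2) incl_pure P.sigma_in var_def big.pure_mult S_carrier T_carrier P.x_closed minus_pure)
    then show "var i \<otimes>\<^bsub>big.E\<^esub> incl (small.pure s t) \<ominus>\<^bsub>big.E\<^esub> incl (left_map (P.sigma i) (small.pure s t)) \<otimes>\<^bsub>big.E\<^esub> var i \<in> I"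
      using pure_in_I[OF P.sigma_diff[OF i st(1)] st(2)] by simp
  qed (use i in simp)
qed

lemma sigma_map_right:
  assumes j: "j < m"
  shows "\<exists>\<sigma>. bij_betw \<sigma> I I \<and> (\<forall>r\<in>I. var (n + j) \<otimes>\<^bsub>big.E\<^esub> r \<ominus>\<^bsub>big.E\<^esub> \<sigma> r \<otimes>\<^bsub>big.E\<^esub> var (n + j) \<in> I)"
proof -
  have lin: "Q.sigma j (phiB c \<otimes>\<^bsub>B\<^esub> t) = phiB c \<otimes>\<^bsub>B\<^esub> Q.sigma j t" if "c \<in> carrier K" "t \<in> T" for c t
    using Q.sigma_central[OF j phiB_T[OF that(1)] that(2)] big.phiB_comm[OF that(1)] by blast
  note sm = right_map[of "Q.sigma j", OF Q.sigma_in[OF j] Q.sigma_add[OF j] lin]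
  have lin': "Q.tau j (phiB c \<otimes>\<^bsub>B\<^esub> s) = phiB c \<otimes>\<^bsub>B\<^esub> Q.tau j s" if "c \<in> carrier K" "s \<in> T" for c s
    by (rule Q.tau_linear[OF j phiB_T[OF that(1)] lin[OF that(1)] that(2)])
  note tm = right_map[of "Q.tau j", OF Q.tau_in[OF j] Q.tau_add[OF j] lin']
  show ?thesis
  proof (rule sigma_from_map[OF _ sm(1) tm(1)])
    fix s t assume st: "s \<in> S" "t \<in> T"
    show "right_map (Q.tau j) (right_map (Q.sigma j) (small.pure s t)) = small.pure s t"
      using st j by (simp add: sm(2) tm(2) Q.sigma_in Q.tau_sigma)
    show "right_map (Q.sigma j) (right_map (Q.tau j) (small.pure s t)) = small.pure s t"
      using st j by (simp add: sm(2) tm(2) Q.tau_in Q.sigma_tau)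
    have "var (n + j) \<otimes>\<^bsub>big.E\<^esub> incl (small.pure s t) \<ominus>\<^bsub>big.E\<^esub> incl (right_map (Q.sigma j) (small.pure s t)) \<otimes>\<^bsub>big.E\<^esub> var (n + j)
      = big.pure s (z j \<otimes>\<^bsub>B\<^esub> t \<ominus>\<^bsub>B\<^esub> Q.sigma j t \<otimes>\<^bsub>B\<^esub> z j)"
      using st j by (simp add: sm(2) incl_pure Q.sigma_in var_def big.pure_mult S_carrier T_carrier Q.x_closed minus_pure)
    then show "var (n + j) \<otimes>\<^bsub>big.E\<^esub> incl (small.pure s t) \<ominus>\<^bsub>big.E\<^esub> incl (right_map (Q.sigma j) (small.pure s t)) \<otimes>\<^bsub>big.E\<^esub> var (n + j) \<in> I"
      using pure_in_I[OF st(1) Q.sigma_diff[OF j st(2)]] by simp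
  qed (use j in simp)
qed

lemma tensor_bij_pbw: "bij_pbw big.E I (n + m) var"
proof (intro bij_pbw.intro free_monomials.intro W.monomials_axioms free_monomials_axioms.intro bij_pbw_axioms.intro)
  show "\<forall>a\<in>carrier big.E. \<exists>!c. c \<in> coeffs big.E I (n + m) \<and> a = lin_comb big.E (n + m) var c"
    by (rule W.freeI[OF W_generated W_independent])
  show "\<exists>\<sigma>. bij_betw \<sigma> I I \<and> (\<forall>r\<in>I. var i \<otimes>\<^bsub>big.E\<^esub> r \<ominus>\<^bsub>big.E\<^esub> \<sigma> r \<otimes>\<^bsub>big.E\<^esub> var i \<in> I)" if "i < n + m" for i
    using sigma_map_left[of i] sigma_map_right[of "i - n"] that by (cases "i < n") auto
  show "\<one>\<^bsub>big.E\<^esub> \<noteq> \<zero>\<^bsub>big.E\<^esub>" if "0 < n + m"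
    using nontriv[OF that] incl_zero ring_hom_one[OF incl_hom] inj_onD[OF incl_inj]
      small.E.one_closed small.E.zero_closed by metis
qed (rule W_unit_ex)

end

theorem theorem4p3:
  fixes K :: "'k ring" and A :: "'a ring" and S :: "'a set"
    and phi :: "'k \<Rightarrow> 'a" and n :: nat and x :: "nat \<Rightarrow> 'a"
  assumes "is_algebra K (A\<lparr>carrier := S\<rparr>) phi"
    and "is_algebra K A phi"
    and "bij_skew_PBW A S n x"
  shows "\<exists>m y.
     env_incl K A phi \<in> ring_hom (envelop K (A\<lparr>carrier := S\<rparr>) phi) (envelop K A phi) \<and>
     inj_on (env_incl K A phi) (carrier (envelop K (A\<lparr>carrier := S\<rparr>) phi)) \<and>
     bij_skew_PBW (envelop K A phi)
        (env_incl K A phi ` carrier (envelop K (A\<lparr>carrier := S\<rparr>) phi)) m y"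
proof -
  interpret P: bij_pbw A S n x by (rule bij_skew_PBW_imp[OF assms(3)])
  have alg: "is_algebra K (opp A) phi" "is_algebra K ((opp A)\<lparr>carrier := S\<rparr>) phi"
    using is_algebra_opp[OF assms(2)] is_algebra_opp[OF assms(1)] by (simp_all add: opp_restrict)
  have small: "tensor_product K (A\<lparr>carrier := S\<rparr>) ((opp A)\<lparr>carrier := S\<rparr>) phi phi"
    by (intro tensor_product.intro assms alg)
  then interpret R: tensor_product K "A\<lparr>carrier := S\<rparr>" "(opp A)\<lparr>carrier := S\<rparr>" phi phi .
  have sub: "tensor_sub K A (opp A) phi phi S S"
    by (intro tensor_sub.intro tensor_sub_axioms.intro tensor_product.intro small assms alg
        P.S_subring subring_opp P.ring_axioms)
  \<comment> \<open>Multiplication a \<otimes> b \<mapsto> ab gives an additive map from R^e to A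
    that sends 1 \<otimes> 1 to 1. Hence R^e is nonzero when A is.\<close>
  have nontriv: "\<one>\<^bsub>R.E\<^esub> \<noteq> \<zero>\<^bsub>R.E\<^esub>" if "0 < n"
  proof
    assume eq: "\<one>\<^bsub>R.E\<^esub> = \<zero>\<^bsub>R.E\<^esub>"
    have ph: "phi c \<in> S" if "c \<in> carrier K" for c using R.phiA_closed[OF that] by simp
    have "R.balanced A (\<lambda>a b. a \<otimes>\<^bsub>A\<^esub> b)"
      unfolding R.balanced_def
    proof (intro conjI ballI)
      fix c a b assume "c \<in> carrier K" "a \<in> carrier (A\<lparr>carrier := S\<rparr>)" "b \<in> carrier ((opp A)\<lparr>carrier := S\<rparr>)"
      then have cl: "c \<in> carrier K" "phi c \<in> carrier A" "a \<in> carrier A" "b \<in> carrier A"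
        using ph P.S_closed by auto
      \<comment> \<open>Balancedness: the scalar acts on the second factor through the opposite
        product, hence from the right, and centrality in A brings it there.\<close>
      then have "phi c \<otimes>\<^bsub>A\<^esub> a \<otimes>\<^bsub>A\<^esub> b = a \<otimes>\<^bsub>A\<^esub> b \<otimes>\<^bsub>A\<^esub> phi c"
        using assms(2) P.m_closed[of a b] by (simp add: is_algebra_def P.m_assoc)
      then show "phi c \<otimes>\<^bsub>A\<lparr>carrier := S\<rparr>\<^esub> a \<otimes>\<^bsub>A\<^esub> b = a \<otimes>\<^bsub>A\<^esub> (phi c \<otimes>\<^bsub>(opp A)\<lparr>carrier := S\<rparr>\<^esub> b)"
        using cl by (simp add: P.m_assoc)
    qed (auto simp: addhom_def P.S_closed P.r_distr P.l_distr)
    from R.tensor_universal[OF P.abelian_group_axioms this]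
    obtain h where h: "addhom R.E A h" "\<forall>a\<in>S. \<forall>b\<in>S. h (R.pure a b) = a \<otimes>\<^bsub>A\<^esub> b" by auto
    have "h \<one>\<^bsub>R.E\<^esub> = \<one>\<^bsub>A\<^esub>" using h(2) P.S_one by (simp add: R.E_one)
    moreover have "h \<zero>\<^bsub>R.E\<^esub> = \<zero>\<^bsub>A\<^esub>"
      by (rule addhom_zero[OF R.E.abelian_group_axioms P.abelian_group_axioms h(1)])
    ultimately show False using eq P.nontrivial that by simp
  qed
  \<comment> \<open>The variables of A^e are the n elements x_i \<otimes> 1 followed by the n
    elements 1 \<otimes> x_i in reverse order, which makes 2n in all.\<close>
  interpret T: tensor_pbw K A "opp A" phi phi S S n x n P.flip_var
    by (intro tensor_pbw.intro tensor_pbw_axioms.intro sub P.bij_pbw_axioms P.opp_bij_pbw nontriv) simp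
  have incl: "env_incl K A phi = T.incl" by (simp add: env_incl_def T.incl_def fun_eq_iff)
  have "bij_skew_PBW T.big.E T.I (n + n) T.var" by (rule bij_pbw.bij_skew_PBW[OF T.tensor_bij_pbw])
  then show ?thesis
    unfolding incl envelop_def opp_restrict using T.incl_hom T.incl_inj by blast
qed

end
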